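(* Let $\mathcal{H}$ be a Hilbert space with $2\le\dim\mathcal{H}\le\infty$, let $A(t)$ be a bounded linear operator on $\mathcal{H}$ (for each $t$), and consider the differential equation $Y'=A(t)Y$ in $\mathcal{H}$ with $Y(0)=I$. If $\dim\mathcal{H}<\infty$, then the Magnus series $\Omega(t)=\sum_{k=1}^{\infty}\Omega_k(t)$ converges in the interval $t\in[0,T)$ such that $$\int_0^T\|A(s)\|\,ds<\pi,$$ and its sum $\Omega(t)$ satisfies $\exp\Omega(t)=Y(t)$. The statement also holds when $\mathcal{H}$ is infinite-dimensional if $Y$ is a normal operator (in particular, if $Y$ is unitary).
   Context: $I$ is the identity operator on $\mathcal{H}$ and $\|\cdot\|$ is the (operator) norm induced by the inner product of $\mathcal{H}$. The function $t\mapsto A(t)$ is assumed sufficiently smooth that the initial value problem makes sense. A bounded operator $Y$ is normal if $YY^*=Y^*Y$, where $Y^*$ is the adjoint. Notation: $[X,Z]=XZ-ZX$ and $\mathrm{ad}_X Z=[X,Z]$. The numbers $B_j$ are the Bernoulli numbers, with generating function $\frac{x}{e^x-1}=\sum_{j\ge0}\frac{B_j}{j!}x^j$ (so $B_1=-\tfrac12$). The terms of the Magnus series are defined recursively by $\Omega_1(t)=\int_0^tA(s)\,ds$ and, for $m\ge2$, $$\Omega_m(t)=\sum_{j=1}^{m-1}\frac{B_j}{j!}\sum_{\substack{k_1+\cdots+k_j=m-1\\ k_1\ge1,\ldots,k_j\ge1}}\int_0^t\mathrm{ad}_{\Omega_{k_1}(s)}\,\mathrm{ad}_{\Omega_{k_2}(s)}\cdots\mathrm{ad}_{\Omega_{k_j}(s)}A(s)\,ds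 .$$ *)

theory Defs
  imports "HOL-Analysis.Analysis" "HOL-Computational_Algebra.Formal_Power_Series"
begin

text \<open>
  The carrier of a Hilbert space is a type of class \<open>real_inner\<close> and \<open>banach\<close>. This is a real
  Hilbert space; a complex one is obtained by adding a complex scalar multiplication and a
  Hermitian form whose real part is the real inner product. Then
  \<open>norm x = sqrt (Re (cinner x x))\<close>, and positive definiteness and completeness are inherited.
\<close>

locale complex_hilbert_space = vector_space scaleC
  for scaleC :: "complex \<Rightarrow> 'a::{real_inner,banach} \<Rightarrow> 'a" +
  fixes cinner :: "'a \<Rightarrow> 'a \<Rightarrow> complex"
  assumes scaleC_of_real: "scaleC (of_real r) x = r *\<^sub>R x"
    and cinner_add_left: "cinner (x + y) z = cinner x z + cinner y z"
    and cinner_scaleC_left: "cinner (scaleC c x) y = c * cinner x y"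
    and cinner_commute: "cinner x y = cnj (cinner y x)"
    and inner_eq_Re_cinner: "inner x y = Re (cinner x y)"

text \<open>
  Dimension relative to a scalar multiplication. The library's \<open>dim\<close> is \<open>0\<close> on
  infinite-dimensional spaces, hence \<open>dim \<ge> 2\<close> is stated by an independent pair.
\<close>

definition finite_dimensional :: "('k::field \<Rightarrow> 'a::ab_group_add \<Rightarrow> 'a) \<Rightarrow> bool" where
  "finite_dimensional scl \<longleftrightarrow> (\<exists>B. finite B \<and> module.span scl B = UNIV)"

definition dim_at_least_2 :: "('k::field \<Rightarrow> 'a::ab_group_add \<Rightarrow> 'a) \<Rightarrow> bool" where
  "dim_at_least_2 scl \<longleftrightarrow> (\<exists>x y. x \<noteq> y \<and> \<not> module.dependent scl {x, y})"

text \<open>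
  Adjoints relative to a form \<open>ip\<close>, which is \<open>inner\<close> in the real and \<open>cinner\<close> in the complex case.
  In a Hilbert space every bounded operator has exactly one adjoint.
\<close>

definition is_adjoint ::
    "('a \<Rightarrow> 'a \<Rightarrow> 'k) \<Rightarrow> ('a::real_normed_vector \<Rightarrow>\<^sub>L 'a) \<Rightarrow> ('a \<Rightarrow>\<^sub>L 'a) \<Rightarrow> bool" where
  "is_adjoint ip Y Z \<longleftrightarrow> (\<forall>x y. ip (blinfun_apply Y x) y = ip x (blinfun_apply Z y))"

definition normal_op :: "('a \<Rightarrow> 'a \<Rightarrow> 'k) \<Rightarrow> ('a::real_normed_vector \<Rightarrow>\<^sub>L 'a) \<Rightarrow> bool" where
  "normal_op ip Y \<longleftrightarrow> (\<exists>Z. is_adjoint ip Y Z \<and> Y o\<^sub>L Z = Z o\<^sub>L Y)"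

definition unitary_op :: "('a \<Rightarrow> 'a \<Rightarrow> 'k) \<Rightarrow> ('a::real_normed_vector \<Rightarrow>\<^sub>L 'a) \<Rightarrow> bool" where
  "unitary_op ip Y \<longleftrightarrow>
     (\<exists>Z. is_adjoint ip Y Z \<and> Y o\<^sub>L Z = id_blinfun \<and> Z o\<^sub>L Y = id_blinfun)"

text \<open>
  The library's \<open>exp\<close> needs a normed algebra, and \<open>blinfun\<close> is not an instance of that class. The
  series converges in the operator norm for every \<open>Z\<close>, so \<open>suminf\<close> is its sum.
\<close>

definition op_exp :: "('a::{real_normed_vector,banach} \<Rightarrow>\<^sub>L 'a) \<Rightarrow> ('a \<Rightarrow>\<^sub>L 'a)" where
  "op_exp Z = (\<Sum>n. (1 / fact n) *\<^sub>R (((\<lambda>W. Z o\<^sub>L W) ^^ n) id_blinfun))"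

definition ad :: "('a::real_normed_vector \<Rightarrow>\<^sub>L 'a) \<Rightarrow> ('a \<Rightarrow>\<^sub>L 'a) \<Rightarrow> ('a \<Rightarrow>\<^sub>L 'a)" where
  "ad X Z = (X o\<^sub>L Z) - (Z o\<^sub>L X)"

definition bernoulli :: "nat \<Rightarrow> real" where
  "bernoulli j = fact j * fps_nth (fps_X / (fps_exp 1 - 1)) j"

definition compositions :: "nat \<Rightarrow> nat \<Rightarrow> nat list set" where
  "compositions j n = {ks. length ks = j \<and> (\<forall>k\<in>set ks. 1 \<le> k) \<and> sum_list ks = n}"

lemma finite_compositions: "finite (compositions j n)"
proof (rule finite_subset)
  show "compositions j n \<subseteq> {ks. set ks \<subseteq> {..n} \<and> length ks = j}"
    by (auto simp: compositions_def intro: member_le_sum_list)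
  show "finite {ks. set ks \<subseteq> {..n} \<and> length ks = j}"
    by (intro finite_lists_length_eq) simp
qed

lemma compositions_less: "\<lbrakk>ks \<in> compositions j (m - Suc 0); k \<in> set ks; 0 < m\<rbrakk> \<Longrightarrow> k < m"
  using member_le_sum_list[of k ks] by (auto simp: compositions_def)

text \<open>
  The index starts at \<open>1\<close>; the value at \<open>0\<close> is a dummy. The iterated commutator is
  \<open>foldr (\<lambda>k. ad (\<Omega> k)) [k1, \<dots>, kj] A = ad (\<Omega> k1) (\<dots> (ad (\<Omega> kj) A))\<close>.
\<close>

context
  notes integral_cong [fundef_cong]
begin

function magnus_term ::
    "(real \<Rightarrow> 'a::{real_normed_vector,banach} \<Rightarrow>\<^sub>L 'a) \<Rightarrow> nat \<Rightarrow> real \<Rightarrow> ('a \<Rightarrow>\<^sub>L 'a)" where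
  "magnus_term A m t =
     (if m = 0 then 0
      else if m = 1 then integral {0..t} A
      else (\<Sum>j = 1..m - 1. (bernoulli j / fact j) *\<^sub>R
             (\<Sum>ks\<in>compositions j (m - 1).
                integral {0..t} (\<lambda>s. foldr (\<lambda>k Z. ad (magnus_term A k s) Z) ks (A s)))))"
  by pat_completeness auto
termination
  by (relation "Wellfounded.measure (\<lambda>(A, m, t). m)") (auto dest: compositions_less)

end

declare magnus_term.simps [simp del]

end

theory Submission
  imports Defs "HOL-Complex_Analysis.Cauchy_Integral_Formula"
begin

text \<open>
The idea is to insert a complex coupling constant \<open>z\<close> and to let \<open>Y\<^sub>z\<close> solve
\<open>Y\<^sub>z' = z A Y\<^sub>z\<close>, \<open>Y\<^sub>z 0 = 1\<close>. Formally \<open>log Y\<^sub>z\<close> is the power series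
\<open>\<Sum>\<^sub>k z\<^sup>k \<Omega>\<^sub>k\<close>, so the Magnus series is the value at \<open>z = 1\<close> of the Taylor series of
\<open>log Y\<^sub>z\<close> at \<open>0\<close>. It converges to \<open>log Y\<^sub>1\<close> as soon as \<open>log Y\<^sub>z\<close> is holomorphic in a disc
of radius greater than \<open>1\<close>.

\<^bold>\<open>The constant \<open>\<pi>\<close>.\<close> Put \<open>\<theta> = \<bar>z\<bar> \<integral> \<parallel>A\<parallel>\<close>. A solution \<open>y = Y\<^sub>z x\<close> turns with angular velocity at
most \<open>\<bar>z\<bar> \<parallel>A\<parallel>\<close>, so the angle between \<open>x\<close> and \<open>Y\<^sub>z x\<close> is at most \<open>\<theta>\<close>; for \<open>\<theta> < \<pi>\<close>,
\<open>inner_solution_lower_bound\<close> proves the slightly weaker bound \<open>(\<theta> + \<pi>) / 2 < \<pi>\<close>. Then the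
segment from \<open>x\<close> to \<open>Y\<^sub>z x\<close> stays away from \<open>0\<close>, which makes all operators
\<open>1 + \<sigma> (Y\<^sub>z - 1)\<close>, \<open>0 \<le> \<sigma> \<le> 1\<close>, uniformly bounded below.
They form a path that starts at the identity, and a path of operators with a common lower bound
cannot leave the open set of invertible operators (\<open>invertible_along_segment\<close>). Hence the
spectrum of \<open>Y\<^sub>z\<close> does not meet the closed negative real axis
(\<open>evolution_segment_invertible\<close>).

\<^bold>\<open>The logarithm.\<close> The integral \<open>log Y\<^sub>z = \<integral>\<^sub>0\<^sup>1 (Y\<^sub>z - 1) (1 + \<sigma> (Y\<^sub>z - 1))\<^sup>-\<^sup>1 d\<sigma>\<close> therefore
exists, is bounded and holomorphic on a disc of radius \<open>r > 1\<close> and satisfies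
\<open>exp (log Y\<^sub>z) = Y\<^sub>z\<close> (\<open>exp_integral_log\<close>, \<open>logY_holomorphic\<close>).

\<^bold>\<open>The Taylor coefficients.\<close> In the ring of formal power series \<open>X = \<Sum>\<^sub>k z\<^sup>k \<Omega>\<^sub>k\<close> satisfies
\<open>X' = \<Sum>\<^sub>j (B\<^sub>j / j!) ad\<^sub>X\<^sup>j (z A)\<close>, which is the Magnus recursion read coefficient by coefficient.
Since \<open>(exp X)' = \<Sum>\<^sub>k ad\<^sub>X\<^sup>k X' / (k + 1)! \<cdot> exp X\<close> and the two scalar series are inverse to each
other, \<open>(exp X)' = z A exp X\<close> (\<open>fexp_magnus_has_derivative\<close>). So the coefficients of \<open>exp X\<close>
are the terms of the Dyson series of \<open>Y\<^sub>z\<close>. The exponential is injective near \<open>0\<close>, and thus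
\<open>log Y\<^sub>z = \<Sum>\<^sub>k\<^sub>\<le>\<^sub>N z\<^sup>k \<Omega>\<^sub>k + O(z\<^sup>N\<^sup>+\<^sup>1)\<close> for real \<open>z \<rightarrow> 0\<close> (\<open>logY_expansion\<close>), which identifies
the Taylor coefficients. Cauchy's estimates for the scalar functions \<open>\<langle>x, log Y\<^sub>z y\<rangle>\<close> bound
\<open>\<parallel>\<Omega>\<^sub>k\<parallel>\<close> by a convergent geometric series.

\<^bold>\<open>Scalars.\<close> The argument is carried out in the Banach algebra of bounded real linear operators on
\<open>E \<times> E\<close> with \<open>E = H \<times> \<real>\<close>, in which the rotation \<open>(x, y) \<mapsto> (-y, x)\<close> plays the part of the
imaginary unit. A complex Hilbert space is treated as the real Hilbert space underlying it: the
operator norm, the Magnus terms and the exponential depend on the real structure only. The result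
for real Hilbert spaces is \<open>magnus_series_converges\<close>.
\<close>

section \<open>The Banach algebra of bounded operators\<close>

text \<open>The operators on a space form an algebra with \<open>0 \<noteq> 1\<close> and \<open>norm 1 = 1\<close> only if the space is
  nonzero.\<close>

class nontrivial_vector = real_normed_vector +
  assumes ex_nonzero: "\<exists>x::'a. x \<noteq> 0"

instance real :: nontrivial_vector
  by standard (rule exI[of _ 1], simp)

instance prod :: (real_normed_vector, nontrivial_vector) nontrivial_vector
proof
  obtain y :: 'b where "y \<noteq> 0" using ex_nonzero by blast
  then show "\<exists>x::'a \<times> 'b. x \<noteq> 0" by (intro exI[of _ "(0, y)"]) (simp add: prod_eq_iff)
qed

text \<open>A copy of the type of bounded operators that carries the product and the norm of a Banach algebra,
  so that the exponential, powers and formal power series apply to operators.\<close>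

typedef (overloaded) 'a endo = "UNIV :: ('a::nontrivial_vector \<Rightarrow>\<^sub>L 'a) set"
  morphisms blinfun_of Endo by simp

lemma blinfun_of_Endo [simp]: "blinfun_of (Endo f) = f"
  by (simp add: Endo_inverse)

lemma endo_eq_iff: "f = g \<longleftrightarrow> blinfun_of f = blinfun_of g"
  by (simp add: blinfun_of_inject)

instantiation endo :: (nontrivial_vector) real_normed_vector
begin
definition "0 = Endo 0"
definition "f + g = Endo (blinfun_of f + blinfun_of g)"
definition "f - g = Endo (blinfun_of f - blinfun_of g)"
definition "- f = Endo (- blinfun_of f)"
definition "c *\<^sub>R f = Endo (c *\<^sub>R blinfun_of f)"
definition "norm f = norm (blinfun_of f)"
definition "dist f g = norm (f - g :: 'a endo)"
definition "sgn f = inverse (norm f) *\<^sub>R (f :: 'a endo)"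
definition "uniformity = (INF e\<in>{0 <..}. principal {(x, y). dist x (y :: 'a endo) < e})"
definition "open U = (\<forall>x\<in>U. eventually (\<lambda>(x', y). x' = x \<longrightarrow> y \<in> (U :: 'a endo set)) uniformity)"

instance
  by standard (simp_all add: endo_eq_iff zero_endo_def plus_endo_def minus_endo_def
      uminus_endo_def scaleR_endo_def norm_endo_def dist_endo_def sgn_endo_def
      uniformity_endo_def open_endo_def norm_triangle_ineq algebra_simps)
end

instantiation endo :: (nontrivial_vector) real_normed_algebra_1
begin
definition "1 = Endo id_blinfun"
definition "f * g = Endo (blinfun_of f o\<^sub>L blinfun_of g)"

instance
proof
  note defs = endo_eq_iff zero_endo_def one_endo_def plus_endo_def times_endo_def
    scaleR_endo_def norm_endo_def
  obtain x :: 'a where "x \<noteq> 0" using ex_nonzero by blast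
  have "norm x \<le> norm (id_blinfun :: 'a \<Rightarrow>\<^sub>L 'a) * norm x"
    using norm_blinfun[of id_blinfun x] by simp
  with \<open>x \<noteq> 0\<close> have one: "norm (id_blinfun :: 'a \<Rightarrow>\<^sub>L 'a) = 1"
    using norm_blinfun_id_le[where 'a='a] by simp
  show "norm (1 :: 'a endo) = 1" by (simp add: defs one)
  show "(0 :: 'a endo) \<noteq> 1" using one by (auto simp add: defs)
  fix f g h :: "'a endo" and c :: real
  show "norm (f * g) \<le> norm f * norm g"
    by (simp add: defs norm_blinfun_compose)
  show "f * g * h = f * (g * h)" "1 * f = f" "f * 1 = f"
    by (auto simp: defs intro!: blinfun_eqI)
  show "(f + g) * h = f * h + g * h" "f * (g + h) = f * g + f * h"
    "c *\<^sub>R f * g = c *\<^sub>R (f * g)" "f * c *\<^sub>R g = c *\<^sub>R (f * g)"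
    by (auto simp: defs blinfun.bilinear_simps intro!: blinfun_eqI)
qed
end

lemma blinfun_of_simps [simp]:
  "blinfun_of 0 = 0" "blinfun_of 1 = id_blinfun"
  "blinfun_of (f + g) = blinfun_of f + blinfun_of g"
  "blinfun_of (f - g) = blinfun_of f - blinfun_of g"
  "blinfun_of (- f) = - blinfun_of f"
  "blinfun_of (f * g) = blinfun_of f o\<^sub>L blinfun_of g"
  "blinfun_of (c *\<^sub>R f) = c *\<^sub>R blinfun_of f"
  by (simp_all add: zero_endo_def one_endo_def plus_endo_def minus_endo_def uminus_endo_def
      times_endo_def scaleR_endo_def)

lemma norm_blinfun_of [simp]: "norm (blinfun_of f) = norm f"
  by (simp add: norm_endo_def)

lemma bounded_linear_blinfun_of: "bounded_linear blinfun_of"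
  by (rule bounded_linear_intro[of _ 1]) simp_all

lemma bounded_linear_Endo: "bounded_linear Endo"
  by (rule bounded_linear_intro[of _ 1]) (simp_all add: endo_eq_iff norm_endo_def)

instance endo :: ("{nontrivial_vector,banach}") banach
proof
  fix F :: "nat \<Rightarrow> 'a endo" assume "Cauchy F"
  then have "Cauchy (\<lambda>n. blinfun_of (F n))"
    by (rule bounded_linear.Cauchy[OF bounded_linear_blinfun_of])
  then obtain l where "(\<lambda>n. blinfun_of (F n)) \<longlonglongrightarrow> l"
    using Cauchy_convergent convergent_def by blast
  then have "(\<lambda>n. Endo (blinfun_of (F n))) \<longlonglongrightarrow> Endo l"
    by (rule bounded_linear.tendsto[OF bounded_linear_Endo])
  then show "convergent F"
    by (auto simp: convergent_def blinfun_of_inverse)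
qed

abbreviation eapp :: "'a::nontrivial_vector endo \<Rightarrow> 'a \<Rightarrow> 'a"
  where "eapp f \<equiv> blinfun_apply (blinfun_of f)"

section \<open>Inverses and the exponential in a Banach algebra\<close>

definition inverse_pair :: "'b::real_normed_algebra_1 \<Rightarrow> 'b \<Rightarrow> bool" where
  "inverse_pair G V \<longleftrightarrow> G * V = 1 \<and> V * G = 1"

lemma inverse_pair_commute:
  assumes "inverse_pair G V" and "a * V = V * a"
  shows "a * G = G * a"
proof -
  have "a * G = G * V * a * G" using assms(1) by (simp add: inverse_pair_def)
  also have "\<dots> = G * (V * a) * G" by (simp add: mult.assoc)
  also have "\<dots> = G * a * (V * G)" by (simp add: assms(2)[symmetric] mult.assoc)
  finally show ?thesis using assms(1) by (simp add: inverse_pair_def)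
qed

lemma inverse_pair_diff:
  assumes "inverse_pair G V" and "inverse_pair H W"
  shows "H - G = H * (V - W) * G"
  using assms by (simp add: inverse_pair_def algebra_simps)

lemma neumann_inverse:
  fixes Z :: "'b::{real_normed_algebra_1,banach}"
  assumes "norm Z < 1"
  shows "\<exists>N. inverse_pair N (1 - Z)"
proof (intro exI)
  have s: "summable (\<lambda>n. Z ^ n)" by (rule complete_algebra_summable_geometric[OF assms])
  have "(\<Sum>n. Z ^ n) = 1 + (\<Sum>n. Z ^ Suc n)"
    using suminf_split_head[OF s] by simp
  moreover have "(\<Sum>n. Z ^ Suc n) = Z * (\<Sum>n. Z ^ n)"
    using suminf_mult[OF s, of Z] by simp
  moreover have "(\<Sum>n. Z ^ Suc n) = (\<Sum>n. Z ^ n) * Z"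
    using suminf_mult2[OF s, of Z] by (simp add: power_commutes)
  ultimately show "inverse_pair (\<Sum>n. Z ^ n) (1 - Z)"
    by (simp add: inverse_pair_def algebra_simps)
qed

lemma inverse_pair_perturb:
  fixes V W :: "'b::{real_normed_algebra_1,banach}"
  assumes G: "inverse_pair G V" and small: "norm G * norm (W - V) < 1"
  shows "\<exists>H. inverse_pair H W"
proof -
  define Z where "Z = G * (V - W)"
  have "norm Z < 1"
    unfolding Z_def by (rule le_less_trans[OF norm_mult_ineq]) (use small in \<open>simp add: norm_minus_commute\<close>)
  then obtain N where N: "inverse_pair N (1 - Z)" using neumann_inverse by blast
  have W: "V * (1 - Z) = W"
    using G by (simp add: Z_def inverse_pair_def right_diff_distrib mult.assoc[symmetric])
  have "N * G * W = N * (G * V) * (1 - Z)" "W * (N * G) = V * ((1 - Z) * N) * G"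
    unfolding W[symmetric] by (simp_all add: mult.assoc)
  then have "inverse_pair (N * G) W"
    using N G by (simp add: inverse_pair_def)
  then show ?thesis ..
qed

text \<open>An a priori bound \<open>C\<close> on inverses lets the Neumann series invert every operator within distance
  \<open>1 / C\<close> of an invertible one. The step size does not shrink, so finitely many steps lead from the
  identity to any point of the segment.\<close>

lemma invertible_along_segment:
  fixes U :: "'b::{real_normed_algebra_1,banach}"
  assumes bound: "\<And>\<sigma> G. \<sigma> \<in> {0..1} \<Longrightarrow> inverse_pair G (1 + \<sigma> *\<^sub>R U) \<Longrightarrow> norm G \<le> C"
    and "\<sigma> \<in> {0..1}"
  shows "\<exists>G. inverse_pair G (1 + \<sigma> *\<^sub>R U)"
proof -
  obtain n :: nat where n: "C * norm U < real n" using reals_Archimedean2 by blast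
  have C: "0 \<le> C"
    using bound[of 0 1] by (simp add: inverse_pair_def order_trans[OF zero_le_one])
  then have n0: "0 < real n" using n by (meson le_less_trans mult_nonneg_nonneg norm_ge_zero)
  have "k \<le> n \<Longrightarrow> \<exists>G. inverse_pair G (1 + (\<sigma> * (real k / real n)) *\<^sub>R U)" for k
  proof (induction k)
    case 0
    show ?case by (intro exI[of _ 1]) (simp add: inverse_pair_def)
  next
    case (Suc k)
    then obtain G where G: "inverse_pair G (1 + (\<sigma> * (real k / real n)) *\<^sub>R U)" by auto
    have in01: "\<sigma> * (real k / real n) \<in> {0..1}"
    proof -
      have "0 \<le> real k / real n" "real k / real n \<le> 1" using Suc.prems n0 by auto
      then have "\<sigma> * (real k / real n) \<le> 1" "0 \<le> \<sigma> * (real k / real n)"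
        using assms(2) by (auto intro!: mult_le_one mult_nonneg_nonneg simp del: times_divide_eq_right)
      then show ?thesis unfolding atLeastAtMost_iff by (intro conjI)
    qed
    have "norm G * norm ((1 + (\<sigma> * (real (Suc k) / real n)) *\<^sub>R U) - (1 + (\<sigma> * (real k / real n)) *\<^sub>R U))
        = norm G * norm ((\<sigma> / real n) *\<^sub>R U)"
      by (simp add: scaleR_diff_left[symmetric] diff_divide_distrib[symmetric] distrib_left)
    also have "\<dots> = norm G * ((\<sigma> / real n) * norm U)"
      using assms(2) by simp
    also have "\<dots> \<le> C * ((1 / real n) * norm U)"
      using bound[OF in01 G] assms(2) C n0 
      by (intro mult_mono mult_right_mono divide_right_mono) auto
    also have "\<dots> < 1" using n n0 by (simp add: field_simps)
    finally show ?case using inverse_pair_perturb[OF G] by blast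
  qed
  from this[of n] n0 show ?thesis by simp
qed

lemma exp_partial_sum_bound:
  fixes x :: "'b::{real_normed_algebra_1,banach}"
  shows "norm (exp x - (\<Sum>n\<le>N. x ^ n /\<^sub>R fact n)) \<le> norm x ^ Suc N * exp (norm x)"
proof -
  have s: "summable (\<lambda>n. norm (x ^ n /\<^sub>R fact n))" by (rule summable_norm_exp)
  have ss: "summable (\<lambda>n. norm (x ^ (n + Suc N) /\<^sub>R fact (n + Suc N)))"
    by (rule summable_ignore_initial_segment[OF s])
  have "exp x - (\<Sum>n\<le>N. x ^ n /\<^sub>R fact n) = (\<Sum>n. x ^ (n + Suc N) /\<^sub>R fact (n + Suc N))"
    unfolding exp_def lessThan_Suc_atMost[symmetric]
    by (rule suminf_minus_initial_segment[symmetric, OF summable_exp_generic])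
  also have "norm \<dots> \<le> (\<Sum>n. norm (x ^ (n + Suc N) /\<^sub>R fact (n + Suc N)))"
    by (rule summable_norm[OF ss])
  also have "\<dots> \<le> (\<Sum>n. norm x ^ Suc N * (norm x ^ n /\<^sub>R fact n))"
  proof (rule suminf_le[OF _ ss])
    show "summable (\<lambda>n. norm x ^ Suc N * (norm x ^ n /\<^sub>R fact n))"
      by (rule summable_mult[OF summable_exp_generic])
    fix n
    have "norm (x ^ (n + Suc N)) \<le> norm x ^ n * norm x ^ Suc N"
      by (rule order_trans[OF norm_power_ineq]) (simp add: power_add)
    moreover have "inverse (fact (n + Suc N)) \<le> (inverse (fact n) :: real)"
      by (rule le_imp_inverse_le[OF fact_mono]) auto
    ultimately have "inverse (fact (n + Suc N)) * norm (x ^ (n + Suc N))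
        \<le> inverse (fact n) * (norm x ^ n * norm x ^ Suc N)"
      by (intro mult_mono) auto
    then show "norm (x ^ (n + Suc N) /\<^sub>R fact (n + Suc N)) \<le> norm x ^ Suc N * (norm x ^ n /\<^sub>R fact n)"
      by (simp add: mult_ac)
  qed
  also have "\<dots> = norm x ^ Suc N * exp (norm x)"
    unfolding exp_def by (rule suminf_mult[OF summable_exp_generic])
  finally show ?thesis .
qed

lemma norm_power_diff_le:
  fixes X Z :: "'b::real_normed_algebra_1"
  assumes "norm X \<le> r" "norm Z \<le> r"
  shows "norm (X ^ Suc n - Z ^ Suc n) \<le> real (Suc n) * r ^ n * norm (X - Z)"
proof (induction n)
  case (Suc n)
  have r: "0 \<le> r" using assms(1) norm_ge_zero order_trans by blast
  have "X ^ Suc (Suc n) - Z ^ Suc (Suc n) = X * (X ^ Suc n - Z ^ Suc n) + (X - Z) * Z ^ Suc n"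
    by (simp add: algebra_simps)
  also have "norm \<dots> \<le> norm X * norm (X ^ Suc n - Z ^ Suc n) + norm (X - Z) * norm Z ^ Suc n"
    by (intro norm_triangle_mono norm_mult_ineq order_trans[OF norm_mult_ineq]
        mult_left_mono norm_power_ineq norm_ge_zero)
  also have "\<dots> \<le> r * (real (Suc n) * r ^ n * norm (X - Z)) + norm (X - Z) * r ^ Suc n"
    by (intro add_mono mult_mono mult_left_mono Suc.IH power_mono assms r norm_ge_zero)
  also have "\<dots> = real (Suc (Suc n)) * r ^ Suc n * norm (X - Z)"
    by (simp add: algebra_simps)
  finally show ?case .
qed simp

text \<open>On the ball of radius \<open>1/4\<close> the exponential differs from the identity by a map with Lipschitz
  constant at most \<open>1/3\<close>. This replaces a local inverse of \<open>exp\<close>: it turns an estimate for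
  exponentials into one for their arguments.\<close>

lemma exp_injective_near_0:
  fixes X Z :: "'b::{real_normed_algebra_1,banach}"
  assumes "norm X \<le> 1/4" "norm Z \<le> 1/4"
  shows "norm (X - Z) \<le> 2 * norm (exp X - exp Z)"
proof -
  define f where "f n = (X ^ n - Z ^ n) /\<^sub>R fact n" for n
  have s: "summable f"
    unfolding f_def scaleR_diff_right by (intro summable_diff summable_exp_generic)
  have "exp X - exp Z = suminf f"
    unfolding f_def scaleR_diff_right exp_def by (intro suminf_diff summable_exp_generic)
  also have "\<dots> = (X - Z) + (\<Sum>n. f (n + 2))"
    using suminf_split_initial_segment[OF s, of 2] by (simp add: f_def eval_nat_numeral)
  finally have e: "X - Z = (exp X - exp Z) - (\<Sum>n. f (n + 2))" by simp
  have b: "norm (f (n + 2)) \<le> norm (X - Z) * (1/4) * (1/4) ^ n" for n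
  proof -
    have "norm (f (n + 2)) \<le> inverse (fact (Suc (Suc n))) * (real (Suc (Suc n)) * (1/4) ^ Suc n * norm (X - Z))"
      unfolding f_def using norm_power_diff_le[OF assms, of "Suc n"]
      by (auto intro!: mult_left_mono simp del: power_Suc fact_Suc)
    also have "\<dots> = inverse (fact (Suc n)) * ((1/4) ^ Suc n * norm (X - Z))"
      by (subst fact_Suc) (simp add: field_simps del: fact_Suc power_Suc of_nat_Suc)
    also have "\<dots> \<le> 1 * ((1/4) ^ Suc n * norm (X - Z))"
      by (intro mult_right_mono) (auto simp: inverse_le_1_iff simp del: fact_Suc)
    finally show ?thesis by (simp add: mult_ac)
  qed
  have g: "(\<lambda>n. norm (X - Z) * (1/4) * (1/4) ^ n) sums (norm (X - Z) * (1/4) * (1 / (1 - 1/4)))"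
    by (intro sums_mult geometric_sums) auto
  have "norm (\<Sum>n. f (n + 2)) \<le> (\<Sum>n. norm (X - Z) * (1/4) * (1/4) ^ n)"
    by (rule norm_suminf_le[OF b sums_summable[OF g]])
  also have "\<dots> = norm (X - Z) / 3" using sums_unique[OF g] by simp
  finally have "norm (X - Z) \<le> norm (exp X - exp Z) + norm (X - Z) / 3"
    using norm_triangle_ineq4[of "exp X - exp Z" "\<Sum>n. f (n + 2)"] unfolding e[symmetric] by linarith
  then show ?thesis using norm_ge_zero[of "exp X - exp Z"] by linarith
qed

lemma has_derivative_exp_0:
  "(exp has_derivative (\<lambda>h. h :: 'b::{real_normed_algebra_1,banach})) (at 0)"
proof (rule has_derivativeI_sandwich[where e=1 and H="\<lambda>h. norm h * exp (norm h)"])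
  fix y :: 'b assume "y \<noteq> 0"
  have "norm (exp y - 1 - y) \<le> norm y ^ 2 * exp (norm y)"
    using exp_partial_sum_bound[of y 1] by (simp add: numeral_2_eq_2 algebra_simps)
  then show "norm (exp y - exp 0 - (y - 0)) / norm (y - 0) \<le> norm y * exp (norm y)"
    using \<open>y \<noteq> 0\<close> by (simp add: divide_simps power2_eq_square mult_ac)
qed (auto intro!: tendsto_eq_intros bounded_linear_ident)

text \<open>For commuting values, \<open>exp (Z u) = exp (Z u - Z s) exp (Z s)\<close>, so that only the derivative of
  \<open>exp\<close> at \<open>0\<close> matters.\<close>

lemma has_vector_derivative_exp_commuting:
  fixes Z :: "real \<Rightarrow> 'b::{real_normed_algebra_1,banach}"
  assumes Z: "(Z has_vector_derivative Z') (at s within S)" and "s \<in> S"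
    and comm: "\<And>u. u \<in> S \<Longrightarrow> Z u * Z s = Z s * Z u"
  shows "((\<lambda>u. exp (Z u)) has_vector_derivative Z' * exp (Z s)) (at s within S)"
proof -
  have "((\<lambda>u. Z u - Z s) has_derivative (\<lambda>h. h *\<^sub>R Z')) (at s within S)"
    using Z by (auto simp: has_vector_derivative_def intro!: derivative_eq_intros)
  from has_derivative_compose[OF this, of exp "\<lambda>h. h"] has_derivative_exp_0
  have "((\<lambda>u. exp (Z u - Z s)) has_vector_derivative Z') (at s within S)"
    by (simp add: has_vector_derivative_def)
  then have d: "((\<lambda>u. exp (Z u - Z s) * exp (Z s)) has_vector_derivative Z' * exp (Z s)) (at s within S)"
    by (rule bounded_linear.has_vector_derivative[OF bounded_linear_mult_left])
  have e: "exp (Z u) = exp (Z u - Z s) * exp (Z s)" if "u \<in> S" for u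
    using exp_add_commuting[of "Z u - Z s" "Z s"] comm[OF that] by (simp add: algebra_simps)
  show ?thesis
    by (rule has_vector_derivative_transform[OF \<open>s \<in> S\<close> e d])
qed

lemma exp_commutes:
  fixes a x :: "'b::{real_normed_algebra_1,banach}"
  assumes "x * a = a * x"
  shows "a * exp x = exp x * a"
  using summable_exp_generic[of x] 
  by (simp add: exp_def suminf_mult[symmetric] suminf_mult2 power_commuting_commutes[OF assms])

lemma has_vector_derivative_product:
  fixes f g :: "real \<Rightarrow> 'b::real_normed_algebra"
  assumes "(f has_vector_derivative f') (at x within S)" "(g has_vector_derivative g') (at x within S)"
  shows "((\<lambda>x. f x * g x) has_vector_derivative f x * g' + f' * g x) (at x within S)"
  using bounded_bilinear.has_vector_derivative[OF bounded_bilinear_mult assms] .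

text \<open>The integral of \<open>U (1 + \<sigma> U)\<^sup>-\<^sup>1\<close> from \<open>0\<close> to \<open>s\<close> is \<open>log (1 + s U)\<close>. Its exponential and
  \<open>1 + s U\<close> solve the same linear differential equation in \<open>s\<close> with value \<open>1\<close> at \<open>s = 0\<close>; all
  operators involved commute.\<close>

lemma exp_integral_log:
  fixes U :: "'b::{real_normed_algebra_1,banach}"
  assumes G: "\<And>\<sigma>. \<sigma> \<in> {0..1} \<Longrightarrow> inverse_pair (G \<sigma>) (1 + \<sigma> *\<^sub>R U)"
    and cont: "continuous_on {0..1} G"
  shows "exp (integral {0..1} (\<lambda>\<sigma>. U * G \<sigma>)) = 1 + U"
proof -
  define X where "X \<sigma> = U * G \<sigma>" for \<sigma>
  define Z where "Z \<sigma> = integral {0..\<sigma>} X" for \<sigma>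
  have contX: "continuous_on {0..1} X"
    unfolding X_def by (intro continuous_intros cont)
  have intX: "X integrable_on {0..\<sigma>}" if "\<sigma> \<in> {0..1}" for \<sigma>
    by (rule integrable_continuous_real) (use that in \<open>auto intro: continuous_on_subset[OF contX]\<close>)
  have XU: "a * X \<sigma> = X \<sigma> * a" if "\<sigma> \<in> {0..1}" "a * U = U * a" for a \<sigma>
  proof -
    have "a * G \<sigma> = G \<sigma> * a"
      by (rule inverse_pair_commute[OF G]) (use that in \<open>auto simp: algebra_simps\<close>)
    then show ?thesis using that(2) by (simp add: X_def) (metis mult.assoc)
  qed
  have ZU: "a * Z \<sigma> = Z \<sigma> * a" if \<sigma>: "\<sigma> \<in> {0..1}" and a: "a * U = U * a" for a \<sigma>
  proof -
    have "a * Z \<sigma> = integral {0..\<sigma>} (\<lambda>\<tau>. a * X \<tau>)"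
      unfolding Z_def using integral_linear[OF intX[OF \<sigma>] bounded_linear_mult_right[of a]]
      by (simp add: o_def)
    also have "\<dots> = integral {0..\<sigma>} (\<lambda>\<tau>. X \<tau> * a)"
      by (rule integral_cong) (use XU \<sigma> a in auto)
    also have "\<dots> = Z \<sigma> * a"
      unfolding Z_def using integral_linear[OF intX[OF \<sigma>] bounded_linear_mult_left[of a]]
      by (simp add: o_def)
    finally show ?thesis .
  qed
  have dZ: "(Z has_vector_derivative X \<sigma>) (at \<sigma> within {0..1})" if "\<sigma> \<in> {0..1}" for \<sigma>
    unfolding Z_def by (rule integral_has_vector_derivative[OF contX that])
  have UZ: "U * Z \<sigma> = Z \<sigma> * U" if "\<sigma> \<in> {0..1}" for \<sigma>
    by (rule ZU[OF that]) simp
  have ZZ: "Z \<tau> * Z \<sigma> = Z \<sigma> * Z \<tau>" if "\<sigma> \<in> {0..1}" "\<tau> \<in> {0..1}" for \<sigma> \<tau>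
    by (rule ZU) (use that UZ in auto)
  have ZX: "X \<tau> * Z \<sigma> = Z \<sigma> * X \<tau>" if "\<sigma> \<in> {0..1}" "\<tau> \<in> {0..1}" for \<sigma> \<tau>
    by (rule XU[symmetric]) (use that UZ in auto)
  \<comment> \<open>The quotient of the two solutions is constant.\<close>
  define W where "W \<sigma> = exp (- Z \<sigma>) * (1 + \<sigma> *\<^sub>R U)" for \<sigma>
  have dW: "(W has_vector_derivative 0) (at \<sigma> within {0..1})" if \<sigma>: "\<sigma> \<in> {0..1}" for \<sigma>
  proof -
    have 1: "((\<lambda>u. exp (- Z u)) has_vector_derivative - X \<sigma> * exp (- Z \<sigma>)) (at \<sigma> within {0..1})"
      by (rule has_vector_derivative_exp_commuting)
         (use \<sigma> ZZ has_vector_derivative_minus[OF dZ[OF \<sigma>]] in auto)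
    have 2: "((\<lambda>u. 1 + u *\<^sub>R U) has_vector_derivative U) (at \<sigma> within {0..1})"
      by (auto intro!: derivative_eq_intros simp: has_vector_derivative_def)
    have c: "X \<sigma> * exp (- Z \<sigma>) = exp (- Z \<sigma>) * X \<sigma>"
      using ZX[OF \<sigma> \<sigma>] by (intro exp_commutes) auto
    have "X \<sigma> * (1 + \<sigma> *\<^sub>R U) = U"
      using G[OF \<sigma>] by (simp add: X_def inverse_pair_def mult.assoc)
    then have "exp (- Z \<sigma>) * U + - X \<sigma> * exp (- Z \<sigma>) * (1 + \<sigma> *\<^sub>R U) = 0"
      by (simp add: c mult.assoc)
    then show ?thesis
      unfolding W_def using has_vector_derivative_product[OF 1 2] by simp
  qed
  have "W 1 = W 0"
    by (rule has_derivative_zero_unique[of "{0..1}"])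
       (use dW in \<open>auto simp: has_vector_derivative_def\<close>)
  then have "exp (- Z 1) * (1 + U) = 1"
    by (simp add: W_def Z_def)
  then have "exp (Z 1) * (exp (- Z 1) * (1 + U)) = exp (Z 1)" by simp
  then have "1 + U = exp (Z 1)"
    using exp_add_commuting[of "Z 1" "- Z 1"] by (simp add: mult.assoc[symmetric])
  then show ?thesis by (simp add: Z_def X_def[abs_def])
qed

section \<open>The Magnus recursion for formal power series\<close>

definition commutator :: "'b::ring \<Rightarrow> 'b \<Rightarrow> 'b" where
  "commutator a z = a * z - z * a"

text \<open>Order of vanishing at \<open>0\<close>. All infinite sums below are locally finite because \<open>X\<close> vanishes at
  \<open>0\<close>, so that multiplication by \<open>X\<close> and \<open>ad X\<close> raise this order.\<close>

definition vanishes :: "nat \<Rightarrow> 'b::zero fps \<Rightarrow> bool" where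
  "vanishes n P \<longleftrightarrow> (\<forall>i<n. fps_nth P i = 0)"

lemma vanishes_mult:
  fixes P Q :: "'b::ring fps"
  assumes "vanishes a P" "vanishes b Q"
  shows "vanishes (a + b) (P * Q)"
  unfolding vanishes_def fps_mult_nth
proof (intro allI impI sum.neutral ballI)
  fix m i assume "m < a + b" "i \<in> {0..m}"
  then have "i < a \<or> m - i < b" by auto
  then show "fps_nth P i * fps_nth Q (m - i) = 0"
    using assms by (auto simp: vanishes_def)
qed

lemma vanishes_commutator:
  fixes X Z :: "'b::ring fps"
  assumes "vanishes 1 X" "vanishes n Z"
  shows "vanishes (Suc n) (commutator X Z)"
  using vanishes_mult[OF assms] vanishes_mult[OF assms(2,1)]
  by (simp add: commutator_def vanishes_def)

lemma vanishes_ad_power: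
  fixes X Z :: "'b::ring fps"
  assumes "vanishes 1 X" "vanishes n Z"
  shows "vanishes (n + j) ((commutator X ^^ j) Z)"
  by (induction j) (auto intro: vanishes_commutator assms)

lemma vanishes_power:
  fixes X :: "'b::ring_1 fps"
  assumes "vanishes 1 X"
  shows "vanishes n (X ^ n)"
proof (induction n)
  case (Suc n)
  then show ?case using vanishes_mult[OF assms Suc] by simp
qed (simp add: vanishes_def)

text \<open>For the scalar power series with coefficients \<open>c\<close> this is \<open>c (ad X) Z\<close>. When \<open>X\<close> vanishes at \<open>0\<close>, the terms
  with \<open>j > m\<close> do not contribute to the coefficient \<open>m\<close>.\<close>

definition ad_series :: "(nat \<Rightarrow> real) \<Rightarrow> 'b::real_algebra_1 fps \<Rightarrow> 'b fps \<Rightarrow> 'b fps" where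
  "ad_series c X Z = Abs_fps (\<lambda>m. \<Sum>j\<le>m. c j *\<^sub>R fps_nth ((commutator X ^^ j) Z) m)"

text \<open>The exponential of a formal power series without constant term, truncated in the same way.\<close>

definition fexp :: "'b::real_algebra_1 fps \<Rightarrow> 'b fps" where
  "fexp X = Abs_fps (\<lambda>m. \<Sum>n\<le>m. fps_nth (X ^ n) m /\<^sub>R fact n)"

lemma sum_extend_zero:
  fixes g :: "nat \<Rightarrow> 'c::comm_monoid_add"
  assumes "m \<le> M" "\<And>j. m < j \<Longrightarrow> g j = 0"
  shows "sum g {..M} = sum g {..m}"
  by (rule sum.mono_neutral_right) (use assms in auto)

lemma ad_series_nth:
  assumes "vanishes 1 X" "m \<le> M"
  shows "fps_nth (ad_series c X Z) m = (\<Sum>j\<le>M. c j *\<^sub>R fps_nth ((commutator X ^^ j) Z) m)"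
proof -
  have "vanishes (0 + j) ((commutator X ^^ j) Z)" for j
    by (rule vanishes_ad_power[OF assms(1)]) (simp add: vanishes_def)
  then show ?thesis
    unfolding ad_series_def fps_nth_Abs_fps
    by (intro sum_extend_zero[symmetric, OF assms(2)]) (auto simp: vanishes_def)
qed

lemma fexp_nth:
  assumes "vanishes 1 X" "m \<le> M"
  shows "fps_nth (fexp X) m = (\<Sum>n\<le>M. fps_nth (X ^ n) m /\<^sub>R fact n)"
  unfolding fexp_def fps_nth_Abs_fps
  by (intro sum_extend_zero[symmetric, OF assms(2)])
     (use vanishes_power[OF assms(1)] in \<open>auto simp: vanishes_def\<close>)

text \<open>Multiplication by \<open>X\<close> on either side can be interchanged with the sum over \<open>j\<close>, because up to a
  fixed coefficient the sum is finite. This is what makes power series in \<open>ad X\<close> compose like the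
  scalar series multiply.\<close>

lemma commutator_ad_series:
  assumes "vanishes 1 X"
  shows "commutator X (ad_series c X Z) = ad_series c X (commutator X Z)"
proof (rule fps_ext)
  fix m
  have "fps_nth (X * ad_series c X Z) m
      = (\<Sum>i=0..m. fps_nth X i * (\<Sum>j\<le>m. c j *\<^sub>R fps_nth ((commutator X ^^ j) Z) (m - i)))"
    unfolding fps_mult_nth by (intro sum.cong refl) (simp add: ad_series_nth[OF assms, of _ m])
  also have "\<dots> = (\<Sum>j\<le>m. c j *\<^sub>R fps_nth (X * (commutator X ^^ j) Z) m)"
    unfolding fps_mult_nth sum_distrib_left scaleR_sum_right
    by (subst sum.swap) simp
  finally have 1: "fps_nth (X * ad_series c X Z) m = \<dots>" .
  have "fps_nth (ad_series c X Z * X) m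
      = (\<Sum>i=0..m. (\<Sum>j\<le>m. c j *\<^sub>R fps_nth ((commutator X ^^ j) Z) i) * fps_nth X (m - i))"
    unfolding fps_mult_nth by (intro sum.cong refl) (simp add: ad_series_nth[OF assms, of _ m])
  also have "\<dots> = (\<Sum>j\<le>m. c j *\<^sub>R fps_nth ((commutator X ^^ j) Z * X) m)"
    unfolding fps_mult_nth sum_distrib_right scaleR_sum_right
    by (subst sum.swap) simp
  finally have 2: "fps_nth (ad_series c X Z * X) m = \<dots>" .
  have "fps_nth (commutator X (ad_series c X Z)) m
      = (\<Sum>j\<le>m. c j *\<^sub>R fps_nth (commutator X ((commutator X ^^ j) Z)) m)"
    unfolding commutator_def[of X "ad_series c X Z"] commutator_def[of X "(commutator X ^^ j) Z" for j]
      fps_sub_nth 1 2 by (simp add: sum_subtractf scaleR_diff_right)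
  also have "\<dots> = fps_nth (ad_series c X (commutator X Z)) m"
    by (simp add: ad_series_def funpow_swap1)
  finally show "fps_nth (commutator X (ad_series c X Z)) m = fps_nth (ad_series c X (commutator X Z)) m" .
qed

lemma ad_power_ad_series:
  assumes "vanishes 1 X"
  shows "(commutator X ^^ i) (ad_series c X Z) = ad_series c X ((commutator X ^^ i) Z)"
  by (induction i) (simp_all add: commutator_ad_series[OF assms])

lemma ad_series_ad_series:
  assumes "vanishes 1 X"
  shows "ad_series d X (ad_series c X Z) = ad_series (\<lambda>n. \<Sum>i\<le>n. d i * c (n - i)) X Z"
proof (rule fps_ext)
  fix m
  define g where "g i j = (d i * c j) *\<^sub>R fps_nth ((commutator X ^^ (i + j)) Z) m" for i j
  have "vanishes (0 + j) ((commutator X ^^ j) Z)" for j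
    by (rule vanishes_ad_power[OF assms(1)]) (simp add: vanishes_def)
  then have g0: "g i j = 0" if "m < i + j" for i j
    using that by (simp add: g_def vanishes_def)
  have "fps_nth (ad_series d X (ad_series c X Z)) m = (\<Sum>i\<le>m. \<Sum>j\<le>m. g i j)"
    by (simp add: ad_series_nth[OF assms, of m m] ad_power_ad_series[OF assms]
        scaleR_sum_right g_def funpow_add[symmetric, THEN fun_cong, unfolded o_def] add.commute)
  also have "\<dots> = (\<Sum>(i, j)\<in>{..m} \<times> {..m}. g i j)"
    by (simp add: sum.cartesian_product)
  also have "\<dots> = (\<Sum>(i, j)\<in>{(i, j). i + j \<le> m}. g i j)"
    by (rule sum.mono_neutral_right) (auto, meson g0 not_le)
  also have "\<dots> = (\<Sum>k\<le>m. \<Sum>i\<le>k. g i (k - i))"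
    by (rule sum.triangle_reindex_eq)
  also have "\<dots> = fps_nth (ad_series (\<lambda>n. \<Sum>i\<le>n. d i * c (n - i)) X Z) m"
    by (simp add: ad_series_def g_def scaleR_sum_left)
  finally show "fps_nth (ad_series d X (ad_series c X Z)) m = \<dots>" .
qed

lemma ad_series_delta:
  "ad_series (\<lambda>n. if n = 0 then 1 else 0) X Z = Z"
  by (rule fps_ext) (simp add: ad_series_def if_distrib if_distribR cong: if_cong)

text \<open>The identity \<open>(e\<^sup>x - 1) / x \<cdot> x / (e\<^sup>x - 1) = 1\<close>, coefficient by coefficient.\<close>

lemma bernoulli_convolution:
  "(\<Sum>i\<le>n. (1 / fact (Suc i)) * (bernoulli (n - i) / fact (n - i))) = (if n = 0 then 1 else 0)"
proof -
  define F :: "real fps" where "F = Abs_fps (\<lambda>i. 1 / fact (Suc i))"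
  have F0: "fps_nth F 0 \<noteq> 0" by (simp add: F_def)
  have "fps_exp 1 - 1 = fps_X * F"
  proof (rule fps_ext)
    fix k show "fps_nth (fps_exp 1 - 1) k = fps_nth (fps_X * F) k"
      by (cases k) (simp_all add: F_def algebra_simps)
  qed
  then have "fps_X / (fps_exp 1 - 1 :: real fps) = (fps_X * 1) / (fps_X * F)" by simp
  also have "\<dots> = 1 / F" by (rule div_mult_mult1) simp
  also have "\<dots> = inverse F" using fps_divide_unit[OF F0, of 1] by simp
  finally have "fps_X / (fps_exp 1 - 1 :: real fps) = inverse F" .
  then have "F * (fps_X / (fps_exp 1 - 1)) = 1"
    using inverse_mult_eq_1[OF F0] by (simp add: mult.commute)
  then have "fps_nth (F * (fps_X / (fps_exp 1 - 1))) n = fps_nth 1 n" by simp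
  then show ?thesis
    by (simp add: fps_mult_nth F_def bernoulli_def atMost_atLeast0)
qed

text \<open>The sum of \<open>X\<^sup>i Z X\<^sup>n\<^sup>-\<^sup>1\<^sup>-\<^sup>i\<close> over \<open>i < n\<close>, which is the derivative of the \<open>n\<close>-th power
  at \<open>X\<close> in the direction \<open>Z\<close>.\<close>

primrec power_deriv :: "'b::ring_1 \<Rightarrow> 'b \<Rightarrow> nat \<Rightarrow> 'b" where
  "power_deriv X Z 0 = 0"
| "power_deriv X Z (Suc n) = X * power_deriv X Z n + Z * X ^ n"

text \<open>Moving all factors \<open>X\<close> to the right of \<open>Z\<close> by means of \<open>X b = ad X b + b X\<close> produces the
  iterated commutators; the coefficients obey the recursion of Pascal.\<close>

lemma power_deriv_ad:
  fixes X Z :: "'b::ring_1"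
  shows "power_deriv X Z n
    = (\<Sum>k<n. of_nat (n choose Suc k) * ((commutator X ^^ k) Z * X ^ (n - Suc k)))"
proof (induction n)
  case (Suc n)
  define c where "c k = (commutator X ^^ k) Z" for k
  have Xc: "X * c k = c (Suc k) + c k * X" for k
    by (simp add: c_def commutator_def)
  define a where "a k = (of_nat (n choose k) :: 'b)" for k
  have "X * power_deriv X Z n = (\<Sum>k<n. a (Suc k) * ((X * c k) * X ^ (n - Suc k)))"
    unfolding Suc.IH sum_distrib_left a_def c_def[symmetric]
    by (intro sum.cong refl) (metis mult.assoc mult_of_nat_commute)
  also have "\<dots> = (\<Sum>k<n. a (Suc k) * (c (Suc k) * X ^ (n - Suc k)))
      + (\<Sum>k<n. a (Suc k) * (c k * X ^ (n - k)))"
    unfolding sum.distrib[symmetric] Xc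
    by (intro sum.cong refl)
       (simp add: distrib_left distrib_right mult.assoc power_Suc[symmetric] Suc_diff_Suc del: power_Suc)
  also have "(\<Sum>k<n. a (Suc k) * (c (Suc k) * X ^ (n - Suc k)))
      = (\<Sum>k<Suc n. a k * (c k * X ^ (n - k))) - c 0 * X ^ n"
    by (simp add: sum.lessThan_Suc_shift a_def del: sum.lessThan_Suc)
  also have "(\<Sum>k<n. a (Suc k) * (c k * X ^ (n - k))) = (\<Sum>k<Suc n. a (Suc k) * (c k * X ^ (n - k)))"
    by (simp add: a_def binomial_eq_0)
  finally have "power_deriv X Z (Suc n) = (\<Sum>k<Suc n. (a k + a (Suc k)) * (c k * X ^ (n - k)))"
    by (simp add: c_def[of 0] sum.distrib distrib_right del: sum.lessThan_Suc)
  then show ?case by (simp add: a_def c_def del: sum.lessThan_Suc)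
qed simp

definition fps_has_derivative ::
    "(real \<Rightarrow> 'b::real_normed_vector fps) \<Rightarrow> 'b fps \<Rightarrow> real filter \<Rightarrow> bool" where
  "fps_has_derivative F F' net \<longleftrightarrow>
     (\<forall>m. ((\<lambda>u. fps_nth (F u) m) has_vector_derivative fps_nth F' m) net)"

lemma fps_has_derivative_mult:
  fixes F G :: "real \<Rightarrow> 'b::real_normed_algebra fps"
  assumes "fps_has_derivative F F' (at s within S)" "fps_has_derivative G G' (at s within S)"
  shows "fps_has_derivative (\<lambda>u. F u * G u) (F s * G' + F' * G s) (at s within S)"
  using assms unfolding fps_has_derivative_def fps_mult_nth fps_add_nth sum.distrib[symmetric]
  by (intro allI has_vector_derivative_sum has_vector_derivative_product) auto

lemma fps_has_derivative_power:
  fixes X :: "real \<Rightarrow> 'b::real_normed_algebra_1 fps"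
  assumes "fps_has_derivative X X' (at s within S)"
  shows "fps_has_derivative (\<lambda>u. X u ^ n) (power_deriv (X s) X' n) (at s within S)"
proof (induction n)
  case (Suc n)
  then show ?case using fps_has_derivative_mult[OF assms Suc] by simp
qed (simp add: fps_has_derivative_def)

lemma fps_nth_of_nat_mult:
  fixes F :: "'b::real_algebra_1 fps"
  shows "fps_nth (of_nat c * F) m = real c *\<^sub>R fps_nth F m"
  unfolding fps_of_nat[symmetric] fps_mult_left_const_nth by (simp add: scaleR_conv_of_real)

text \<open>The derivative of the exponential, \<open>(exp X)' = (\<Sum>\<^sub>k ad\<^sub>X\<^sup>k X' / (k + 1)!) exp X\<close>. After division by
  \<open>n!\<close> the binomial coefficients of \<open>power_deriv_ad\<close> factor as \<open>1 / ((k + 1)! l!)\<close> with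
  \<open>k + l = n - 1\<close>, so that the double sum is a Cauchy product.\<close>

lemma fexp_has_derivative:
  fixes X :: "real \<Rightarrow> 'b::real_normed_algebra_1 fps"
  assumes X: "fps_has_derivative X X' (at s within S)"
    and v: "vanishes 1 (X s)" "vanishes 1 X'"
  shows "fps_has_derivative (\<lambda>u. fexp (X u)) (ad_series (\<lambda>k. 1 / fact (Suc k)) (X s) X' * fexp (X s))
    (at s within S)"
  unfolding fps_has_derivative_def
proof
  fix m
  define T where "T k = (commutator (X s) ^^ k) X'" for k
  define g where "g k l = (1 / (fact (Suc k) * fact l)) *\<^sub>R fps_nth (T k * X s ^ l) m" for k l
  have g0: "g k l = 0" if "m \<le> k + l" for k l
  proof -
    have "vanishes (1 + k + l) (T k * X s ^ l)"
      unfolding T_def by (intro vanishes_mult vanishes_ad_power vanishes_power v)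
    then show ?thesis using that by (simp add: g_def vanishes_def)
  qed
  have "fps_nth (power_deriv (X s) X' (Suc n)) m /\<^sub>R fact (Suc n) = (\<Sum>k\<le>n. g k (n - k))" for n
  proof -
    have "fps_nth (of_nat (Suc n choose Suc k) * (T k * X s ^ (n - k))) m /\<^sub>R fact (Suc n) = g k (n - k)"
      if "k \<le> n" for k
    proof -
      have "real (Suc n choose Suc k) / fact (Suc n) = 1 / (fact (Suc k) * fact (n - k))"
        using that by (subst binomial_fact) (simp_all add: field_simps del: fact_Suc)
      then have "(real (Suc n choose Suc k) / fact (Suc n)) *\<^sub>R fps_nth (T k * X s ^ (n - k)) m
          = g k (n - k)"
        by (simp only: g_def)
      then show ?thesis
        by (simp only: fps_nth_of_nat_mult scaleR_scaleR divide_inverse mult.commute)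
    qed
    then show ?thesis
      by (simp add: power_deriv_ad T_def[symmetric] fps_sum_nth scaleR_sum_right lessThan_Suc_atMost
          del: power_deriv.simps fact_Suc binomial_Suc_Suc)
  qed
  then have "(\<Sum>n\<le>m. fps_nth (power_deriv (X s) X' n) m /\<^sub>R fact n) = (\<Sum>n<m. \<Sum>k\<le>n. g k (n - k))"
    by (simp add: sum.atMost_shift del: power_deriv.simps(2) fact_Suc)
  also have "\<dots> = (\<Sum>(k, l)\<in>{(k, l). k + l < m}. g k l)"
    by (rule sum.triangle_reindex[symmetric])
  also have "\<dots> = (\<Sum>(k, l)\<in>{..m} \<times> {..m}. g k l)"
    by (rule sum.mono_neutral_left) (auto, meson g0 not_le)
  also have "\<dots> = (\<Sum>k\<le>m. \<Sum>l\<le>m. g k l)"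
    by (simp add: sum.cartesian_product)
  also have "\<dots> = (\<Sum>k\<le>m. \<Sum>l\<le>m. \<Sum>i=0..m. ((1 / fact (Suc k)) *\<^sub>R fps_nth (T k) i) * (fps_nth (X s ^ l) (m - i) /\<^sub>R fact l))"
    by (simp add: g_def fps_mult_nth scaleR_sum_right divide_inverse mult.commute)
  also have "\<dots> = (\<Sum>i=0..m. \<Sum>k\<le>m. \<Sum>l\<le>m. ((1 / fact (Suc k)) *\<^sub>R fps_nth (T k) i) * (fps_nth (X s ^ l) (m - i) /\<^sub>R fact l))"
    by (subst (2) sum.swap, subst sum.swap) (rule refl)
  also have "\<dots> = (\<Sum>i=0..m. (\<Sum>k\<le>m. ((1 / fact (Suc k)) *\<^sub>R fps_nth (T k) i)) * (\<Sum>l\<le>m. (fps_nth (X s ^ l) (m - i) /\<^sub>R fact l)))"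
    unfolding sum_product ..
  also have "\<dots> = fps_nth (ad_series (\<lambda>k. 1 / fact (Suc k)) (X s) X' * fexp (X s)) m"
    unfolding fps_mult_nth T_def
    by (intro sum.cong refl) (simp add: ad_series_nth[OF v(1), of _ m] fexp_nth[OF v(1), of _ m])
  finally have eq: "(\<Sum>n\<le>m. fps_nth (power_deriv (X s) X' n) m /\<^sub>R fact n) = \<dots>" .
  show "((\<lambda>u. fps_nth (fexp (X u)) m) has_vector_derivative
      fps_nth (ad_series (\<lambda>k. 1 / fact (Suc k)) (X s) X' * fexp (X s)) m) (at s within S)"
    unfolding eq[symmetric]
    unfolding fexp_def fps_nth_Abs_fps
    using fps_has_derivative_power[OF X]
    by (intro has_vector_derivative_sum bounded_linear.has_vector_derivative[OF bounded_linear_scaleR_right])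
       (auto simp: fps_has_derivative_def)
qed

lemma compositions_0: "compositions 0 n = (if n = 0 then {[]} else {})"
  by (auto simp: compositions_def)

lemma compositions_Suc:
  "compositions (Suc j) n = (\<lambda>(k, ks). k # ks) ` (SIGMA k:{1..n}. compositions j (n - k))"
proof (intro set_eqI iffI)
  fix ks assume "ks \<in> compositions (Suc j) n"
  then obtain k ks' where "ks = k # ks'" "length ks' = j" "1 \<le> k" "\<forall>k\<in>set ks'. 1 \<le> k" "k + sum_list ks' = n"
    by (cases ks) (auto simp: compositions_def)
  then show "ks \<in> (\<lambda>(k, ks). k # ks) ` (SIGMA k:{1..n}. compositions j (n - k))"
    by (intro image_eqI[of _ _ "(k, ks')"]) (auto simp: compositions_def)
qed (auto simp: compositions_def)

text \<open>Each commutator with \<open>X\<close> splits off the first part of a composition, so \<open>j\<close> of them collect the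
  compositions into \<open>j\<close> parts. The factor \<open>fps_X\<close> is the coupling constant of \<open>z A\<close> and accounts for
  the compositions of \<open>m - 1\<close>, not \<open>m\<close>, in the recursion for the term with index \<open>m\<close>.\<close>

lemma ad_power_nth:
  fixes w :: "nat \<Rightarrow> 'b::ring_1"
  assumes "X = Abs_fps (\<lambda>k. if k = 0 then 0 else w k)"
  shows "fps_nth ((commutator X ^^ j) (fps_X * fps_const a)) (Suc m)
    = (\<Sum>ks\<in>compositions j m. foldr (\<lambda>k. commutator (w k)) ks a)"
proof (induction j arbitrary: m)
  case 0
  then show ?case by (simp add: compositions_0)
next
  case (Suc j)
  define W where "W = (commutator X ^^ j) (fps_X * fps_const a)"
  have "vanishes (1 + j) W"
    unfolding W_def by (rule vanishes_ad_power) (auto simp: vanishes_def assms)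
  then have W0: "fps_nth W 0 = 0" by (simp add: vanishes_def)
  have "fps_nth (W * X) (Suc m) = (\<Sum>i=0..Suc m. fps_nth W (Suc m - i) * fps_nth X i)"
    unfolding fps_mult_nth by (subst sum.atLeastAtMost_rev) simp
  then have "fps_nth (commutator X W) (Suc m) = (\<Sum>i=0..Suc m. commutator (fps_nth X i) (fps_nth W (Suc m - i)))"
    by (simp only: commutator_def fps_sub_nth sum_subtractf fps_mult_nth)
  also have "\<dots> = (\<Sum>i\<in>{1..m}. commutator (w i) (fps_nth W (Suc (m - i))))"
    by (rule sum.mono_neutral_cong_right) (auto simp: assms commutator_def W0 Suc_diff_le not_le le_Suc_eq)
  also have "\<dots> = (\<Sum>i\<in>{1..m}. \<Sum>ks\<in>compositions j (m - i). commutator (w i) (foldr (\<lambda>k. commutator (w k)) ks a))"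
    unfolding W_def Suc.IH
    by (simp add: commutator_def sum_distrib_left sum_distrib_right sum_subtractf)
  also have "\<dots> = (\<Sum>ks\<in>compositions (Suc j) m. foldr (\<lambda>k. commutator (w k)) ks a)"
    unfolding compositions_Suc
    by (subst sum.reindex) (auto simp: inj_on_def sum.Sigma finite_compositions split_def)
  finally show ?case by (simp add: W_def)
qed

text \<open>The derivative that the Magnus recursion prescribes for the term with index \<open>m + 1\<close>. The sum may
  start at \<open>j = 0\<close>: only \<open>0\<close> has a composition into no parts, so this summand is \<open>a\<close> for \<open>m = 0\<close> and
  \<open>0\<close> otherwise. This covers the first term of the series as well.\<close>

definition magnus_rhs :: "(nat \<Rightarrow> 'b::real_algebra_1) \<Rightarrow> 'b \<Rightarrow> nat \<Rightarrow> 'b" where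
  "magnus_rhs w a m = (\<Sum>j\<le>m. (bernoulli j / fact j) *\<^sub>R
     (\<Sum>ks\<in>compositions j m. foldr (\<lambda>k. commutator (w k)) ks a))"

lemma compositions_empty: "m < j \<Longrightarrow> compositions j m = {}"
proof -
  have "length ks \<le> sum_list ks" if "\<forall>k\<in>set ks. 1 \<le> k" for ks :: "nat list"
    using that by (induction ks) auto
  then show "m < j \<Longrightarrow> compositions j m = {}" by (fastforce simp: compositions_def)
qed

definition magnus_fps :: "(nat \<Rightarrow> 'b::zero) \<Rightarrow> 'b fps" where
  "magnus_fps w = Abs_fps (\<lambda>k. if k = 0 then 0 else w k)"

lemma vanishes_magnus_fps: "vanishes 1 (magnus_fps w)"
  by (simp add: magnus_fps_def vanishes_def)

text \<open>The Magnus recursion says that \<open>X' = g (ad X) (z a)\<close> with \<open>g x = x / (e\<^sup>x - 1)\<close>. The derivative of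
  the exponential applies the inverse series \<open>(e\<^sup>x - 1) / x\<close> to it, and what is left is
  \<open>(exp X)' = z a exp X\<close>.\<close>

theorem fexp_magnus_has_derivative:
  fixes w :: "nat \<Rightarrow> real \<Rightarrow> 'b::real_normed_algebra_1"
  assumes "\<And>m. ((w (Suc m)) has_vector_derivative magnus_rhs (\<lambda>k. w k s) a m) (at s within S)"
  shows "((\<lambda>u. fps_nth (fexp (magnus_fps (\<lambda>k. w k u))) m) has_vector_derivative
     (if m = 0 then 0 else a * fps_nth (fexp (magnus_fps (\<lambda>k. w k s))) (m - 1))) (at s within S)"
proof -
  define X where "X u = magnus_fps (\<lambda>k. w k u)" for u
  define X' where "X' = ad_series (\<lambda>j. bernoulli j / fact j) (X s) (fps_X * fps_const a)"
  have v: "vanishes 1 (X s)" unfolding X_def by (rule vanishes_magnus_fps)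
  have X'0: "fps_nth X' 0 = 0" by (simp add: X'_def ad_series_def)
  have X'Suc: "fps_nth X' (Suc m) = magnus_rhs (\<lambda>k. w k s) a m" for m
    unfolding X'_def ad_series_def fps_nth_Abs_fps ad_power_nth[OF X_def[of s, unfolded magnus_fps_def]]
    by (simp add: magnus_rhs_def compositions_empty)
  have "fps_has_derivative X X' (at s within S)"
    unfolding fps_has_derivative_def
  proof
    fix m show "((\<lambda>u. fps_nth (X u) m) has_vector_derivative fps_nth X' m) (at s within S)"
      using assms by (cases m) (simp_all add: X_def magnus_fps_def X'0 X'Suc)
  qed
  from fexp_has_derivative[OF this v] X'0
  have "fps_has_derivative (\<lambda>u. fexp (X u))
     (ad_series (\<lambda>k. 1 / fact (Suc k)) (X s) X' * fexp (X s)) (at s within S)"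
    by (simp add: vanishes_def)
  also have "ad_series (\<lambda>k. 1 / fact (Suc k)) (X s) X' = fps_X * fps_const a"
    unfolding X'_def ad_series_ad_series[OF v] bernoulli_convolution by (rule ad_series_delta)
  finally show ?thesis
    by (cases m) (auto simp: fps_has_derivative_def X_def mult.assoc dest: spec[of _ m])
qed

section \<open>The Dyson series\<close>

text \<open>The bilinear map \<open>L\<close> is scalar multiplication for real variables, and multiplication through a
  complex structure for complex ones.\<close>

lemma has_derivative_suminf:
  fixes f :: "nat \<Rightarrow> 'a::real_normed_vector \<Rightarrow> 'b::banach" and D :: "nat \<Rightarrow> 'a \<Rightarrow> 'c::banach"
  assumes L: "bounded_bilinear L" and "convex S"
    and der: "\<And>n x. x \<in> S \<Longrightarrow> (f n has_derivative (\<lambda>h. L h (D n x))) (at x within S)"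
    and bound: "\<And>n x. x \<in> S \<Longrightarrow> norm (D n x) \<le> m n" and "summable m"
    and x0: "x0 \<in> S" "summable (\<lambda>n. f n x0)"
    and x: "x \<in> S"
  shows "((\<lambda>x. \<Sum>n. f n x) has_derivative (\<lambda>h. L h (\<Sum>n. D n x))) (at x within S)"
proof -
  interpret L: bounded_bilinear L by fact
  obtain K where K: "0 < K" "\<And>a b. norm (L a b) \<le> norm a * norm b * K"
    using L.pos_bounded by blast
  have ul: "uniform_limit S (\<lambda>n x. \<Sum>i<n. D i x) (\<lambda>x. \<Sum>i. D i x) sequentially"
    by (rule Weierstrass_m_test[OF bound \<open>summable m\<close>])
  have "\<exists>g. \<forall>x\<in>S. (\<lambda>n. f n x) sums (g x) \<and> (g has_derivative (\<lambda>h. L h (\<Sum>n. D n x))) (at x within S)"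
  proof (rule has_derivative_series[OF \<open>convex S\<close> der _ x0(1) summable_sums[OF x0(2)]])
    fix e :: real assume "e > 0"
    then have "e / K > 0" using K by simp
    from uniform_limitD[OF ul this]
    show "\<forall>\<^sub>F n in sequentially. \<forall>x\<in>S. \<forall>h. norm ((\<Sum>i<n. L h (D i x)) - L h (\<Sum>n. D n x)) \<le> e * norm h"
    proof eventually_elim
      case (elim n)
      show ?case
      proof (intro ballI allI)
        fix y h assume "y \<in> S"
        have "norm (L h ((\<Sum>i<n. D i y) - (\<Sum>n. D n y))) \<le> norm h * norm ((\<Sum>i<n. D i y) - (\<Sum>n. D n y)) * K"
          by (rule K)
        also have "\<dots> \<le> norm h * (e / K) * K"
          using elim \<open>y \<in> S\<close> K by (intro mult_right_mono mult_left_mono) (auto simp: dist_norm less_imp_le)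
        finally show "norm ((\<Sum>i<n. L h (D i y)) - L h (\<Sum>n. D n y)) \<le> e * norm h"
          using K by (simp add: L.diff_right L.sum_right mult.commute)
      qed
    qed
  qed
  then obtain g where g: "\<And>x. x \<in> S \<Longrightarrow> (\<lambda>n. f n x) sums (g x)"
    "(g has_derivative (\<lambda>h. L h (\<Sum>n. D n x))) (at x within S)" using x by blast
  show ?thesis
    by (rule has_derivative_transform[OF x _ g(2)]) (use sums_unique[OF g(1)] in auto)
qed

text \<open>Iterated integrals decay like \<open>1 / n!\<close>. With \<open>R 0 = 1\<close> this bounds the terms of the Dyson series,
  and with \<open>R 0\<close> an arbitrary solution it bounds the remainders of the series.\<close>

lemma iterated_integral_bound:
  fixes R :: "nat \<Rightarrow> real \<Rightarrow> 'b::real_normed_algebra_1"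
  assumes der: "\<And>n s. s \<in> {0..t} \<Longrightarrow> (R (Suc n) has_vector_derivative A s * R n s) (at s within {0..t})"
    and init: "\<And>n. R (Suc n) 0 = 0"
    and A: "\<And>s. s \<in> {0..t} \<Longrightarrow> norm (A s) \<le> M"
    and R0: "\<And>s. s \<in> {0..t} \<Longrightarrow> norm (R 0 s) \<le> K"
    and s: "s \<in> {0..t}"
  shows "norm (R n s) \<le> K * ((M * s) ^ n / fact n)"
  using s
proof (induction n arbitrary: s)
  case 0
  then show ?case using R0 by simp
next
  case (Suc n)
  have M: "0 \<le> M" using A[OF Suc.prems] norm_ge_zero order_trans by blast
  show ?case
  proof (cases "s = 0")
    case False
    then have s: "0 < s" "s \<le> t" using Suc.prems by auto
    have sub: "{0..s} \<subseteq> {0..t}" using s by auto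
    have d: "(R (Suc n) has_vector_derivative A u * R n u) (at u within {0..s})" if "u \<in> {0..s}" for u
      by (rule has_vector_derivative_within_subset[OF der sub]) (use that s in auto)
    have "norm (R (Suc n) s - R (Suc n) 0)
        \<le> K * ((M * s) ^ Suc n / fact (Suc n)) - K * ((M * 0) ^ Suc n / fact (Suc n))"
    proof (rule differentiable_bound_general[where f'="\<lambda>u. A u * R n u" and \<phi>'="\<lambda>u. K * (M * (M * u) ^ n / fact n)", OF s(1)])
      show "continuous_on {0..s} (R (Suc n))"
        using d by (meson continuous_on_eq_continuous_within has_vector_derivative_continuous)
      show "continuous_on {0..s} (\<lambda>u. K * ((M * u) ^ Suc n / fact (Suc n)))"
        by (intro continuous_intros) auto
      fix u assume u: "0 < u" "u < s"
      show "(R (Suc n) has_vector_derivative A u * R n u) (at u)"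
        using d[of u] u by (auto simp: at_within_Icc_at)
      show "((\<lambda>u. K * ((M * u) ^ Suc n / fact (Suc n))) has_vector_derivative K * (M * (M * u) ^ n / fact n)) (at u)"
        unfolding has_real_derivative_iff_has_vector_derivative[symmetric]
        by (auto intro!: derivative_eq_intros simp del: power_Suc of_nat_Suc)
      have "norm (A u * R n u) \<le> M * (K * ((M * u) ^ n / fact n))"
        using u s by (intro order_trans[OF norm_mult_ineq] mult_mono A Suc.IH M) auto
      then show "norm (A u * R n u) \<le> K * (M * (M * u) ^ n / fact n)" by (simp add: mult_ac)
    qed
    then show ?thesis using init by simp
  qed (use init in simp)
qed

primrec dyson :: "(real \<Rightarrow> 'b::{real_normed_algebra_1,banach}) \<Rightarrow> nat \<Rightarrow> real \<Rightarrow> 'b" where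
  "dyson A 0 s = 1"
| "dyson A (Suc n) s = integral {0..s} (\<lambda>u. A u * dyson A n u)"

text \<open>The solution of \<open>Y' = A Y\<close>, \<open>Y 0 = 1\<close>.\<close>

definition evolution :: "(real \<Rightarrow> 'b::{real_normed_algebra_1,banach}) \<Rightarrow> real \<Rightarrow> 'b" where
  "evolution A s = (\<Sum>n. dyson A n s)"

lemma continuous_on_dyson:
  assumes "continuous_on {0..t} A"
  shows "continuous_on {0..t} (dyson A n)"
proof (induction n)
  case 0
  show ?case by (simp add: dyson.simps(1)[abs_def])
next
  case (Suc n)
  then have "(\<lambda>u. A u * dyson A n u) integrable_on {0..t}"
    by (intro integrable_continuous_real continuous_intros assms)
  then show ?case
    by (simp add: dyson.simps(2)[abs_def] indefinite_integral_continuous_1)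
qed

lemma dyson_has_vector_derivative:
  assumes "continuous_on {0..t} A" "s \<in> {0..t}"
  shows "(dyson A (Suc n) has_vector_derivative A s * dyson A n s) (at s within {0..t})"
  unfolding dyson.simps(2)[abs_def]
  by (rule integral_has_vector_derivative) (intro continuous_intros continuous_on_dyson assms)+

lemma dyson_unique:
  assumes A: "continuous_on {0..t} A" and s: "s \<in> {0..t}"
    and P: "\<And>s. s \<in> {0..t} \<Longrightarrow> P 0 s = 1" "\<And>n. P (Suc n) 0 = 0"
    and der: "\<And>n s. s \<in> {0..t} \<Longrightarrow> (P (Suc n) has_vector_derivative A s * P n s) (at s within {0..t})"
  shows "P n s = dyson A n s"
  using s
proof (induction n arbitrary: s)
  case 0
  then show ?case using P by simp
next
  case (Suc n)
  have "((\<lambda>u. P (Suc n) u - dyson A (Suc n) u) has_derivative (\<lambda>h. 0)) (at u within {0..t})"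
    if "u \<in> {0..t}" for u
    using has_vector_derivative_diff[OF der[OF that, of n] dyson_has_vector_derivative[OF A that, of n]] Suc.IH[OF that]
    by (simp add: has_vector_derivative_def)
  then have "P (Suc n) s - dyson A (Suc n) s = P (Suc n) 0 - dyson A (Suc n) 0"
    using Suc.prems
    by (intro has_derivative_zero_unique[where f="\<lambda>u. P (Suc n) u - dyson A (Suc n) u" and s="{0..t}"]) auto
  then show ?case using P by simp
qed

lemma dyson_bound:
  assumes "continuous_on {0..t} A" "\<And>s. s \<in> {0..t} \<Longrightarrow> norm (A s) \<le> M" "s \<in> {0..t}"
  shows "norm (dyson A n s) \<le> (M * s) ^ n / fact n"
  using iterated_integral_bound[where R="dyson A" and A=A and K=1, OF dyson_has_vector_derivative[OF assms(1)] _ assms(2) _ assms(3)]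
  by simp

lemma summable_exp_real: "summable (\<lambda>n. (x::real) ^ n / fact n)"
  using summable_exp_generic[of x] by (simp add: divide_inverse mult.commute)

lemma norm_bound_exists:
  fixes A :: "real \<Rightarrow> 'b::real_normed_vector"
  assumes "continuous_on {0..t} A"
  obtains M where "0 < M" "\<And>s. s \<in> {0..t} \<Longrightarrow> norm (A s) \<le> M"
proof -
  have "bounded (A ` {0..t})"
    by (intro compact_imp_bounded compact_continuous_image assms) auto
  then show ?thesis using that unfolding bounded_pos by blast
qed

lemma summable_dyson:
  assumes "continuous_on {0..t} A" "s \<in> {0..t}"
  shows "summable (\<lambda>n. norm (dyson A n s))"
proof -
  obtain M where M: "\<And>s. s \<in> {0..t} \<Longrightarrow> norm (A s) \<le> M" using norm_bound_exists[OF assms(1)] by blast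
  show ?thesis
    by (rule summable_comparison_test'[OF summable_exp_real[of "M * s"]])
       (use dyson_bound[OF assms(1) M assms(2)] in simp)
qed

lemma evolution_0 [simp]: "evolution A 0 = 1"
proof -
  have "dyson A n 0 = (if n = 0 then 1 else 0)" for n by (cases n) auto
  then show ?thesis using suminf_finite[of "{0}" "\<lambda>n. dyson A n 0"] by (simp add: evolution_def)
qed

lemma evolution_has_vector_derivative:
  assumes A: "continuous_on {0..t} A" and s: "s \<in> {0..t}"
  shows "(evolution A has_vector_derivative A s * evolution A s) (at s within {0..t})"
proof -
  obtain M where M: "0 < M" "\<And>s. s \<in> {0..t} \<Longrightarrow> norm (A s) \<le> M" using norm_bound_exists[OF A] by blast
  define D where "D n s = (case n of 0 \<Rightarrow> 0 | Suc k \<Rightarrow> A s * dyson A k s)" for n s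
  define m where "m n = (case n of 0 \<Rightarrow> 0 | Suc k \<Rightarrow> M * ((M * t) ^ k / fact k))" for n
  have "summable (\<lambda>k. m (Suc k))"
    unfolding m_def by (simp add: summable_exp_real summable_mult del: times_divide_eq_right)
  then have m: "summable m" by (simp add: summable_Suc_iff)
  have der: "(dyson A n has_derivative (\<lambda>h. h *\<^sub>R D n u)) (at u within {0..t})" if "u \<in> {0..t}" for n u
    using dyson_has_vector_derivative[OF A that]
    by (cases n) (auto simp: D_def has_vector_derivative_def dyson.simps(1)[abs_def] simp del: dyson.simps(2))
  have bound: "norm (D n u) \<le> m n" if u: "u \<in> {0..t}" for n u
  proof (cases n)
    case (Suc k)
    have "norm (dyson A k u) \<le> (M * t) ^ k / fact k"
      by (rule order_trans[OF dyson_bound[OF A M(2) u]])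
         (use u M in \<open>auto intro!: divide_right_mono power_mono\<close>)
    then have "norm (A u * dyson A k u) \<le> M * ((M * t) ^ k / fact k)"
      using M u by (intro order_trans[OF norm_mult_ineq] mult_mono) auto
    then show ?thesis by (simp add: D_def m_def Suc)
  qed (simp add: D_def m_def)
  have sD: "summable (\<lambda>n. D (Suc n) s)"
    using summable_mult[OF summable_norm_cancel[OF summable_dyson[OF A s]], of "A s"] by (simp add: D_def)
  have "(\<Sum>n. D n s) = (\<Sum>n. D (Suc n) s)"
    using suminf_split_head[of "\<lambda>n. D n s"] sD summable_Suc_iff[of "\<lambda>n. D n s"] by (simp add: D_def)
  also have "\<dots> = A s * evolution A s"
    unfolding evolution_def using suminf_mult[OF summable_norm_cancel[OF summable_dyson[OF A s]]] 
    by (simp add: D_def)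
  finally show ?thesis
    using has_derivative_suminf[OF bounded_bilinear_scaleR convex_real_interval(5) der bound m s
        summable_norm_cancel[OF summable_dyson[OF A s]] s]
    unfolding has_vector_derivative_def evolution_def by simp
qed

lemma evolution_unique:
  assumes A: "continuous_on {0..t} A" and s: "s \<in> {0..t}" and Y0: "Y 0 = 1"
    and Y: "\<And>s. s \<in> {0..t} \<Longrightarrow> (Y has_vector_derivative A s * Y s) (at s within {0..t})"
  shows "Y s = evolution A s"
proof -
  obtain M where M: "0 < M" "\<And>s. s \<in> {0..t} \<Longrightarrow> norm (A s) \<le> M" using norm_bound_exists[OF A] by blast
  \<comment> \<open>Each remainder is an iterated integral of the one before.\<close>
  define R where "R n u = Y u - (\<Sum>k<n. dyson A k u)" for n u
  have "continuous_on {0..t} Y"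
    using Y by (meson continuous_on_eq_continuous_within has_vector_derivative_continuous)
  then obtain K where K: "\<And>s. s \<in> {0..t} \<Longrightarrow> norm (Y s) \<le> K" using norm_bound_exists by blast
  have d0: "dyson A (Suc k) 0 = 0" for k by simp
  have der: "(R (Suc n) has_vector_derivative A u * R n u) (at u within {0..t})" if u: "u \<in> {0..t}" for n u
  proof -
    have "R (Suc n) = (\<lambda>u. Y u - 1 - (\<Sum>k<n. dyson A (Suc k) u))"
      by (auto simp: R_def sum.lessThan_Suc_shift simp del: dyson.simps(2) sum.lessThan_Suc)
    moreover have "((\<lambda>u. Y u - 1 - (\<Sum>k<n. dyson A (Suc k) u)) has_vector_derivative
        A u * Y u - 0 - (\<Sum>k<n. A u * dyson A k u)) (at u within {0..t})"
      by (intro has_vector_derivative_diff Y u has_vector_derivative_sum dyson_has_vector_derivative A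
          has_vector_derivative_const)
    ultimately show ?thesis by (simp add: R_def right_diff_distrib sum_distrib_left)
  qed
  have init: "R (Suc n) 0 = 0" for n
    using Y0 by (simp add: R_def sum.lessThan_Suc_shift del: sum.lessThan_Suc)
  have "norm (R n s) \<le> K * ((M * s) ^ n / fact n)" for n
    by (rule iterated_integral_bound[where R=R, OF der init M(2) _ s]) (use K in \<open>auto simp: R_def\<close>)
  then have ev: "\<forall>\<^sub>F n in sequentially. norm (R n s) \<le> K * ((M * s) ^ n / fact n)"
    by (rule always_eventually[OF allI])
  have "(\<lambda>n. K * ((M * s) ^ n / fact n)) \<longlonglongrightarrow> 0"
    by (rule tendsto_mult_right_zero[OF summable_LIMSEQ_zero[OF summable_exp_real]])
  with ev have "(\<lambda>n. R n s) \<longlonglongrightarrow> 0"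
    by (rule Lim_null_comparison)
  then have "(\<lambda>n. Y s - R n s) \<longlonglongrightarrow> Y s - 0" by (intro tendsto_intros)
  then have "(\<lambda>n. dyson A n s) sums Y s" by (simp add: sums_def R_def)
  then show ?thesis by (simp add: evolution_def sums_unique)
qed

text \<open>The coupling constant enters the Dyson series as in a power series.\<close>

lemma dyson_mult_commuting:
  assumes A: "continuous_on {0..t} A" and c: "\<And>u. u \<in> {0..t} \<Longrightarrow> c * A u = A u * c"
    and s: "s \<in> {0..t}"
  shows "dyson (\<lambda>u. c * A u) n s = c ^ n * dyson A n s"
proof (rule dyson_unique[OF _ s, symmetric, where P="\<lambda>n s. c ^ n * dyson A n s"])
  fix n u assume u: "u \<in> {0..t}"
  have "((\<lambda>v. c ^ Suc n * dyson A (Suc n) v) has_vector_derivative c ^ Suc n * (A u * dyson A n u)) (at u within {0..t})"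
    by (rule bounded_linear.has_vector_derivative[OF bounded_linear_mult_right dyson_has_vector_derivative[OF A u]])
  moreover have "c ^ n * A u = A u * c ^ n"
    by (rule power_commuting_commutes) (use c[OF u] in simp)
  ultimately show "((\<lambda>v. c ^ Suc n * dyson A (Suc n) v) has_vector_derivative c * A u * (c ^ n * dyson A n u)) (at u within {0..t})"
    by (simp add: mult.assoc[symmetric]) (simp add: mult.assoc)
qed (auto intro!: continuous_intros A)

lemma dyson_commutes:
  assumes A: "continuous_on {0..t} A" and c: "\<And>u. u \<in> {0..t} \<Longrightarrow> c * A u = A u * c"
    and s: "s \<in> {0..t}"
  shows "c * dyson A n s = dyson A n s * c"
  using s
proof (induction n arbitrary: s)
  case (Suc n)
  have i: "(\<lambda>u. A u * dyson A n u) integrable_on {0..s}"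
    by (intro integrable_continuous_real continuous_intros)
       (use Suc.prems in \<open>auto intro: continuous_on_subset[OF A] continuous_on_subset[OF continuous_on_dyson[OF A]]\<close>)
  have "c * dyson A (Suc n) s = integral {0..s} (\<lambda>u. c * (A u * dyson A n u))"
    using integral_linear[OF i bounded_linear_mult_right[of c]] by (simp add: o_def)
  also have "\<dots> = integral {0..s} (\<lambda>u. A u * dyson A n u * c)"
  proof (rule integral_cong)
    fix u assume "u \<in> {0..s}"
    then have u: "u \<in> {0..t}" using Suc.prems by auto
    have "c * (A u * dyson A n u) = A u * (c * dyson A n u)"
      using c[OF u] by (simp add: mult.assoc[symmetric])
    then show "c * (A u * dyson A n u) = A u * dyson A n u * c"
      using Suc.IH[OF u] by (simp add: mult.assoc)
  qed
  also have "\<dots> = dyson A (Suc n) s * c"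
    using integral_linear[OF i bounded_linear_mult_left[of c]] by (simp add: o_def)
  finally show ?case .
qed simp

section \<open>Asymptotic expansions in the coupling constant\<close>

text \<open>The interval \<open>(0, 1]\<close> is only a convenient neighbourhood of \<open>0\<close>: there every higher power of
  \<open>\<epsilon>\<close> is dominated by a lower one.\<close>

definition asymptotic ::
    "nat \<Rightarrow> (real \<Rightarrow> 'b::real_normed_vector) \<Rightarrow> (nat \<Rightarrow> 'b) \<Rightarrow> bool" where
  "asymptotic N f F \<longleftrightarrow>
     (\<exists>C. \<forall>\<epsilon>\<in>{0<..1}. norm (f \<epsilon> - (\<Sum>k\<le>N. \<epsilon> ^ k *\<^sub>R F k)) \<le> C * \<epsilon> ^ Suc N)"

lemma asymptoticI:
  assumes "\<And>\<epsilon>. 0 < \<epsilon> \<Longrightarrow> \<epsilon> \<le> 1 \<Longrightarrow> norm (f \<epsilon> - (\<Sum>k\<le>N. \<epsilon> ^ k *\<^sub>R F k)) \<le> C * \<epsilon> ^ Suc N"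
  shows "asymptotic N f F"
  unfolding asymptotic_def using assms by (intro exI[of _ C]) auto

lemma asymptoticE:
  assumes "asymptotic N f F"
  obtains C where "0 \<le> C"
    "\<And>\<epsilon>. 0 < \<epsilon> \<Longrightarrow> \<epsilon> \<le> 1 \<Longrightarrow> norm (f \<epsilon> - (\<Sum>k\<le>N. \<epsilon> ^ k *\<^sub>R F k)) \<le> C * \<epsilon> ^ Suc N"
proof -
  obtain C where C: "\<And>\<epsilon>. 0 < \<epsilon> \<Longrightarrow> \<epsilon> \<le> 1 \<Longrightarrow> norm (f \<epsilon> - (\<Sum>k\<le>N. \<epsilon> ^ k *\<^sub>R F k)) \<le> C * \<epsilon> ^ Suc N"
    using assms unfolding asymptotic_def by (metis greaterThanAtMost_iff)
  have "0 \<le> C" using order_trans[OF norm_ge_zero C[of 1]] by simp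
  with C that show ?thesis by blast
qed

lemma asymptotic_poly: "asymptotic N (\<lambda>\<epsilon>. \<Sum>k\<le>N. \<epsilon> ^ k *\<^sub>R F k) F"
  by (rule asymptoticI[where C=0]) simp

lemma asymptotic_sum:
  assumes "\<And>i. i \<in> I \<Longrightarrow> asymptotic N (f i) (F i)"
  shows "asymptotic N (\<lambda>\<epsilon>. \<Sum>i\<in>I. f i \<epsilon>) (\<lambda>k. \<Sum>i\<in>I. F i k)"
proof -
  have "\<exists>C. \<forall>\<epsilon>. 0 < \<epsilon> \<longrightarrow> \<epsilon> \<le> 1 \<longrightarrow> norm (f i \<epsilon> - (\<Sum>k\<le>N. \<epsilon> ^ k *\<^sub>R F i k)) \<le> C * \<epsilon> ^ Suc N"
    if "i \<in> I" for i
    using asymptoticE[OF assms[OF that]] by metis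
  then obtain C where C: "\<And>i \<epsilon>. i \<in> I \<Longrightarrow> 0 < \<epsilon> \<Longrightarrow> \<epsilon> \<le> 1 \<Longrightarrow> norm (f i \<epsilon> - (\<Sum>k\<le>N. \<epsilon> ^ k *\<^sub>R F i k)) \<le> C i * \<epsilon> ^ Suc N"
    by metis
  show ?thesis
  proof (rule asymptoticI)
    fix \<epsilon> :: real assume \<epsilon>: "0 < \<epsilon>" "\<epsilon> \<le> 1"
    have "(\<Sum>i\<in>I. f i \<epsilon>) - (\<Sum>k\<le>N. \<epsilon> ^ k *\<^sub>R (\<Sum>i\<in>I. F i k))
        = (\<Sum>i\<in>I. f i \<epsilon> - (\<Sum>k\<le>N. \<epsilon> ^ k *\<^sub>R F i k))"
      unfolding scaleR_sum_right by (subst sum.swap) (simp add: sum_subtractf)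
    also have "norm \<dots> \<le> (\<Sum>i\<in>I. C i * \<epsilon> ^ Suc N)"
      by (rule sum_norm_le) (use C \<epsilon> in auto)
    finally show "norm ((\<Sum>i\<in>I. f i \<epsilon>) - (\<Sum>k\<le>N. \<epsilon> ^ k *\<^sub>R (\<Sum>i\<in>I. F i k))) \<le> (\<Sum>i\<in>I. C i) * \<epsilon> ^ Suc N"
      by (simp add: sum_distrib_right)
  qed
qed

lemma asymptotic_scaleR:
  assumes "asymptotic N f F"
  shows "asymptotic N (\<lambda>\<epsilon>. c *\<^sub>R f \<epsilon>) (\<lambda>k. c *\<^sub>R F k)"
proof -
  from assms obtain C where C: "0 \<le> C" "\<And>\<epsilon>. 0 < \<epsilon> \<Longrightarrow> \<epsilon> \<le> 1 \<Longrightarrow> norm (f \<epsilon> - (\<Sum>k\<le>N. \<epsilon> ^ k *\<^sub>R F k)) \<le> C * \<epsilon> ^ Suc N"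
    by (rule asymptoticE) blast
  show ?thesis
  proof (rule asymptoticI)
    fix \<epsilon> :: real assume \<epsilon>: "0 < \<epsilon>" "\<epsilon> \<le> 1"
    have "c *\<^sub>R f \<epsilon> - (\<Sum>k\<le>N. \<epsilon> ^ k *\<^sub>R c *\<^sub>R F k) = c *\<^sub>R (f \<epsilon> - (\<Sum>k\<le>N. \<epsilon> ^ k *\<^sub>R F k))"
      by (simp add: scaleR_diff_right scaleR_sum_right mult.commute)
    then show "norm (c *\<^sub>R f \<epsilon> - (\<Sum>k\<le>N. \<epsilon> ^ k *\<^sub>R c *\<^sub>R F k)) \<le> (\<bar>c\<bar> * C) * \<epsilon> ^ Suc N"
      using mult_left_mono[OF C(2)[OF \<epsilon>], of "\<bar>c\<bar>"] by (simp add: mult_ac)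
  qed
qed

text \<open>Asymptotic expansions multiply like formal power series. This carries the formal identities over
  to functions without any convergence of the formal series.\<close>

lemma asymptotic_mult:
  fixes F G :: "'b::real_normed_algebra_1 fps"
  assumes "asymptotic N f (fps_nth F)" "asymptotic N g (fps_nth G)"
  shows "asymptotic N (\<lambda>\<epsilon>. f \<epsilon> * g \<epsilon>) (fps_nth (F * G))"
proof -
  from assms(1) obtain C where C: "0 \<le> C"
    "\<And>\<epsilon>. 0 < \<epsilon> \<Longrightarrow> \<epsilon> \<le> 1 \<Longrightarrow> norm (f \<epsilon> - (\<Sum>k\<le>N. \<epsilon> ^ k *\<^sub>R fps_nth F k)) \<le> C * \<epsilon> ^ Suc N"
    by (rule asymptoticE) blast
  from assms(2) obtain D where D: "0 \<le> D"
    "\<And>\<epsilon>. 0 < \<epsilon> \<Longrightarrow> \<epsilon> \<le> 1 \<Longrightarrow> norm (g \<epsilon> - (\<Sum>k\<le>N. \<epsilon> ^ k *\<^sub>R fps_nth G k)) \<le> D * \<epsilon> ^ Suc N"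
    by (rule asymptoticE) blast
  define p where "p \<epsilon> = (\<Sum>k\<le>N. \<epsilon> ^ k *\<^sub>R fps_nth F k)" for \<epsilon>
  define q where "q \<epsilon> = (\<Sum>k\<le>N. \<epsilon> ^ k *\<^sub>R fps_nth G k)" for \<epsilon>
  define a where "a = (\<Sum>k\<le>N. norm (fps_nth F k))"
  define b where "b = (\<Sum>k\<le>N. norm (fps_nth G k))"
  have a0: "0 \<le> a" "0 \<le> b" by (simp_all add: a_def b_def sum_nonneg)
  show ?thesis
  proof (rule asymptoticI)
    fix \<epsilon> :: real assume \<epsilon>: "0 < \<epsilon>" "\<epsilon> \<le> 1"
    have pow: "\<epsilon> ^ k \<le> 1" for k using \<epsilon> by (simp add: power_le_one)
    have pb: "norm (p \<epsilon>) \<le> a" "norm (q \<epsilon>) \<le> b"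
      unfolding p_def a_def q_def b_def
      by (rule sum_norm_le; use \<epsilon> pow in \<open>simp add: mult_left_le_one_le\<close>)+
    have gb: "norm (g \<epsilon>) \<le> b + D"
    proof -
      have "norm (g \<epsilon>) \<le> norm (q \<epsilon>) + norm (g \<epsilon> - q \<epsilon>)" by norm
      also have "norm (g \<epsilon> - q \<epsilon>) \<le> D * 1"
        unfolding q_def using D(1) \<epsilon> pow[of "Suc N"] by (intro order_trans[OF D(2)] mult_left_mono) simp_all
      finally show ?thesis using pb by simp
    qed
    define h where "h i j = \<epsilon> ^ (i + j) *\<^sub>R (fps_nth F i * fps_nth G j)" for i j
    have "(\<Sum>k\<le>N. \<epsilon> ^ k *\<^sub>R fps_nth (F * G) k) = (\<Sum>k\<le>N. \<Sum>i\<le>k. h i (k - i))"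
      by (simp add: fps_mult_nth scaleR_sum_right h_def atMost_atLeast0)
    also have "\<dots> = (\<Sum>(i, j)\<in>{(i, j). i + j \<le> N}. h i j)"
      by (rule sum.triangle_reindex_eq[symmetric])
    finally have 1: "(\<Sum>k\<le>N. \<epsilon> ^ k *\<^sub>R fps_nth (F * G) k) = \<dots>" .
    have "p \<epsilon> * q \<epsilon> = (\<Sum>(i, j)\<in>{..N} \<times> {..N}. h i j)"
      unfolding p_def q_def sum_product sum.cartesian_product
      by (simp add: h_def power_add mult.commute)
    also have "\<dots> = (\<Sum>(i, j)\<in>{(i, j). i + j \<le> N}. h i j) + (\<Sum>(i, j)\<in>{..N} \<times> {..N} - {(i, j). i + j \<le> N}. h i j)"
      by (subst sum.subset_diff[of "{(i, j). i + j \<le> N}"]) (auto simp: add.commute)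
    finally have 2: "p \<epsilon> * q \<epsilon> - (\<Sum>k\<le>N. \<epsilon> ^ k *\<^sub>R fps_nth (F * G) k)
        = (\<Sum>(i, j)\<in>{..N} \<times> {..N} - {(i, j). i + j \<le> N}. h i j)"
      unfolding 1 by simp
    have "norm \<dots> \<le> (\<Sum>(i, j)\<in>{..N} \<times> {..N} - {(i, j). i + j \<le> N}. \<epsilon> ^ Suc N * (norm (fps_nth F i) * norm (fps_nth G j)))"
    proof (rule sum_norm_le)
      fix x assume "x \<in> {..N} \<times> {..N} - {(i, j). i + j \<le> N}"
      then obtain i j where x: "x = (i, j)" and ij: "Suc N \<le> i + j" by (cases x) auto
      have "\<epsilon> ^ (i + j) \<le> \<epsilon> ^ Suc N" using \<epsilon> ij by (intro power_decreasing) auto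
      then have "norm (h i j) \<le> \<epsilon> ^ Suc N * (norm (fps_nth F i) * norm (fps_nth G j))"
        using \<epsilon> unfolding h_def norm_scaleR
        by (intro mult_mono norm_mult_ineq) auto
      then show "norm (case x of (i, j) \<Rightarrow> h i j)
          \<le> (case x of (i, j) \<Rightarrow> \<epsilon> ^ Suc N * (norm (fps_nth F i) * norm (fps_nth G j)))"
        by (simp add: x)
    qed
    also have "\<dots> \<le> (\<Sum>(i, j)\<in>{..N} \<times> {..N}. \<epsilon> ^ Suc N * (norm (fps_nth F i) * norm (fps_nth G j)))"
      by (rule sum_mono2) (use \<epsilon> in auto)
    also have "\<dots> = \<epsilon> ^ Suc N * (a * b)"
      by (simp only: sum.cartesian_product[symmetric] sum_distrib_left[symmetric] a_def b_def sum_product)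
    finally have 3: "norm (p \<epsilon> * q \<epsilon> - (\<Sum>k\<le>N. \<epsilon> ^ k *\<^sub>R fps_nth (F * G) k)) \<le> \<epsilon> ^ Suc N * (a * b)"
      unfolding 2 .
    have "norm (p \<epsilon> * (g \<epsilon> - q \<epsilon>)) \<le> a * (D * \<epsilon> ^ Suc N)"
      using D(2)[OF \<epsilon>] pb a0 by (intro order_trans[OF norm_mult_ineq] mult_mono) (auto simp: q_def)
    moreover have "norm ((f \<epsilon> - p \<epsilon>) * g \<epsilon>) \<le> C * \<epsilon> ^ Suc N * (b + D)"
      using C \<epsilon> gb by (intro order_trans[OF norm_mult_ineq] mult_mono) (auto simp: p_def)
    moreover have "f \<epsilon> * g \<epsilon> - (\<Sum>k\<le>N. \<epsilon> ^ k *\<^sub>R fps_nth (F * G) k)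
        = (p \<epsilon> * q \<epsilon> - (\<Sum>k\<le>N. \<epsilon> ^ k *\<^sub>R fps_nth (F * G) k)) + p \<epsilon> * (g \<epsilon> - q \<epsilon>) + (f \<epsilon> - p \<epsilon>) * g \<epsilon>"
      by (simp add: algebra_simps)
    moreover have "norm (u + v + w) \<le> norm u + norm v + norm w" for u v w :: 'b by norm
    ultimately have "norm (f \<epsilon> * g \<epsilon> - (\<Sum>k\<le>N. \<epsilon> ^ k *\<^sub>R fps_nth (F * G) k))
        \<le> \<epsilon> ^ Suc N * (a * b) + a * (D * \<epsilon> ^ Suc N) + C * \<epsilon> ^ Suc N * (b + D)"
      using 3 by (smt (verit))
    then show "norm (f \<epsilon> * g \<epsilon> - (\<Sum>k\<le>N. \<epsilon> ^ k *\<^sub>R fps_nth (F * G) k))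
        \<le> (a * b + a * D + C * (b + D)) * \<epsilon> ^ Suc N"
      by (simp add: algebra_simps)
  qed
qed

lemma asymptotic_power:
  fixes F :: "'b::real_normed_algebra_1 fps"
  assumes "asymptotic N f (fps_nth F)"
  shows "asymptotic N (\<lambda>\<epsilon>. f \<epsilon> ^ n) (fps_nth (F ^ n))"
proof (induction n)
  case 0
  have "(\<Sum>k\<le>N. \<epsilon> ^ k *\<^sub>R fps_nth 1 k) = (1 :: 'b)" for \<epsilon> :: real
    by (simp add: if_distrib if_distribR cong: if_cong)
  then show ?case by (intro asymptoticI[where C=0]) simp
next
  case (Suc n)
  then show ?case using asymptotic_mult[OF assms Suc] by simp
qed

text \<open>The Taylor polynomial of degree \<open>N\<close> of \<open>exp\<close> suffices, because its argument is of order \<open>\<epsilon>\<close>.\<close>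

lemma asymptotic_exp:
  fixes X :: "'b::{real_normed_algebra_1,banach} fps"
  assumes X: "vanishes 1 X"
  shows "asymptotic N (\<lambda>\<epsilon>. exp (\<Sum>k\<le>N. \<epsilon> ^ k *\<^sub>R fps_nth X k)) (fps_nth (fexp X))"
proof -
  define x where "x \<epsilon> = (\<Sum>k\<le>N. \<epsilon> ^ k *\<^sub>R fps_nth X k)" for \<epsilon>
  define c where "c = (\<Sum>k\<le>N. norm (fps_nth X k))"
  have c0: "0 \<le> c" by (simp add: c_def sum_nonneg)
  have xb: "norm (x \<epsilon>) \<le> c * \<epsilon>" if "0 < \<epsilon>" "\<epsilon> \<le> 1" for \<epsilon>
    unfolding x_def c_def sum_distrib_right
  proof (rule sum_norm_le)
    fix k
    show "norm (\<epsilon> ^ k *\<^sub>R fps_nth X k) \<le> norm (fps_nth X k) * \<epsilon>"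
    proof (cases k)
      case 0 then show ?thesis using X by (simp add: vanishes_def)
    next
      case (Suc l)
      then have "\<epsilon> ^ k \<le> \<epsilon>" using that by (simp add: mult_left_le power_le_one)
      then show ?thesis using that mult_right_mono[of "\<epsilon> ^ k" \<epsilon> "norm (fps_nth X k)"]
        by (simp add: mult.commute)
    qed
  qed
  have "asymptotic N (\<lambda>\<epsilon>. \<Sum>n\<le>N. inverse (fact n) *\<^sub>R x \<epsilon> ^ n) (\<lambda>k. \<Sum>n\<le>N. inverse (fact n) *\<^sub>R fps_nth (X ^ n) k)"
    unfolding x_def
    by (intro asymptotic_sum asymptotic_scaleR asymptotic_power asymptotic_poly)
  then obtain C where C: "0 \<le> C" "\<And>\<epsilon>. 0 < \<epsilon> \<Longrightarrow> \<epsilon> \<le> 1 \<Longrightarrow>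
      norm ((\<Sum>n\<le>N. x \<epsilon> ^ n /\<^sub>R fact n) - (\<Sum>k\<le>N. \<epsilon> ^ k *\<^sub>R (\<Sum>n\<le>N. fps_nth (X ^ n) k /\<^sub>R fact n))) \<le> C * \<epsilon> ^ Suc N"
    by (rule asymptoticE) blast
  have "asymptotic N (\<lambda>\<epsilon>. exp (x \<epsilon>)) (fps_nth (fexp X))"
  proof (rule asymptoticI)
    fix \<epsilon> :: real assume \<epsilon>: "0 < \<epsilon>" "\<epsilon> \<le> 1"
    have "norm (x \<epsilon>) \<le> c" using xb[OF \<epsilon>] c0 \<epsilon> mult_left_le[of \<epsilon> c] by linarith
    then have "norm (x \<epsilon>) ^ Suc N * exp (norm (x \<epsilon>)) \<le> (c * \<epsilon>) ^ Suc N * exp c"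
      using xb[OF \<epsilon>] c0 \<epsilon> by (intro mult_mono power_mono) auto
    with exp_partial_sum_bound[of "x \<epsilon>" N]
    have "norm (exp (x \<epsilon>) - (\<Sum>n\<le>N. x \<epsilon> ^ n /\<^sub>R fact n)) \<le> (c ^ Suc N * exp c) * \<epsilon> ^ Suc N"
      by (simp add: power_mult_distrib mult_ac)
    moreover have "(\<Sum>k\<le>N. \<epsilon> ^ k *\<^sub>R fps_nth (fexp X) k) = (\<Sum>k\<le>N. \<epsilon> ^ k *\<^sub>R (\<Sum>n\<le>N. fps_nth (X ^ n) k /\<^sub>R fact n))"
      by (intro sum.cong refl) (simp add: fexp_nth[OF X, of _ N])
    ultimately have "norm (exp (x \<epsilon>) - (\<Sum>k\<le>N. \<epsilon> ^ k *\<^sub>R fps_nth (fexp X) k))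
        \<le> (c ^ Suc N * exp c) * \<epsilon> ^ Suc N + C * \<epsilon> ^ Suc N"
      using C(2)[OF \<epsilon>] by (smt (verit) norm_diff_triangle_ineq norm_triangle_ineq diff_add_cancel add_diff_eq)
    then show "norm (exp (x \<epsilon>) - (\<Sum>k\<le>N. \<epsilon> ^ k *\<^sub>R fps_nth (fexp X) k)) \<le> (c ^ Suc N * exp c + C) * \<epsilon> ^ Suc N"
      by (simp add: distrib_right)
  qed
  then show ?thesis by (simp add: x_def)
qed

lemma asymptotic_power_series:
  fixes P :: "nat \<Rightarrow> 'b::banach"
  assumes "summable (\<lambda>n. norm (P n))"
  shows "asymptotic N (\<lambda>\<epsilon>. \<Sum>n. \<epsilon> ^ n *\<^sub>R P n) P"
proof (rule asymptoticI)
  fix \<epsilon> :: real assume \<epsilon>: "0 < \<epsilon>" "\<epsilon> \<le> 1"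
  have b: "norm (\<epsilon> ^ (n + k) *\<^sub>R P (n + k)) \<le> \<epsilon> ^ k * norm (P (n + k))" for n k
    using \<epsilon> by (auto intro!: mult_right_mono power_decreasing)
  have s: "summable (\<lambda>n. \<epsilon> ^ n *\<^sub>R P n)"
    by (rule summable_comparison_test'[OF assms]) (use b[of _ 0] in simp)
  have s2: "summable (\<lambda>n. \<epsilon> ^ Suc N * norm (P (n + Suc N)))"
    by (intro summable_mult summable_ignore_initial_segment assms)
  have "norm ((\<Sum>n. \<epsilon> ^ n *\<^sub>R P n) - (\<Sum>k\<le>N. \<epsilon> ^ k *\<^sub>R P k)) = norm (\<Sum>n. \<epsilon> ^ (n + Suc N) *\<^sub>R P (n + Suc N))"
    unfolding lessThan_Suc_atMost[symmetric] by (simp only: suminf_minus_initial_segment[OF s])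
  also have "\<dots> \<le> (\<Sum>n. \<epsilon> ^ Suc N * norm (P (n + Suc N)))"
    by (rule norm_suminf_le[OF b s2])
  also have "\<dots> = (\<Sum>n. norm (P (n + Suc N))) * \<epsilon> ^ Suc N"
    by (subst suminf_mult) (auto intro!: summable_ignore_initial_segment assms simp: mult.commute
        simp del: power_Suc add_Suc_right)
  finally show "norm ((\<Sum>n. \<epsilon> ^ n *\<^sub>R P n) - (\<Sum>k\<le>N. \<epsilon> ^ k *\<^sub>R P k)) \<le> (\<Sum>n. norm (P (n + Suc N))) * \<epsilon> ^ Suc N" .
qed

section \<open>The angle swept out by a solution\<close>

text \<open>At the first zero the function would come down from positive values, yet it increases there.\<close>

lemma positive_if_increasing_at_zeros:
  fixes f :: "real \<Rightarrow> real"
  assumes cont: "continuous_on {0..t} f" and f0: "0 < f 0"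
    and inc: "\<And>s. s \<in> {0..t} \<Longrightarrow> f s = 0 \<Longrightarrow> \<exists>l>0. (f has_real_derivative l) (at s within {0..t})"
    and s: "s \<in> {0..t}"
  shows "0 < f s"
proof (rule ccontr)
  assume "\<not> 0 < f s"
  have zero: "\<exists>u\<in>{0..v}. f u = 0" if "v \<in> {0..t}" "f v \<le> 0" for v
  proof -
    have "\<exists>u. 0 \<le> u \<and> u \<le> v \<and> f u = 0"
      by (rule IVT2') (use that f0 in \<open>auto intro: continuous_on_subset[OF cont]\<close>)
    then show ?thesis by auto
  qed
  define Z where "Z = {u\<in>{0..t}. f u = 0}"
  have "Z \<noteq> {}" using zero[OF s] \<open>\<not> 0 < f s\<close> s by (force simp: Z_def)
  moreover have "compact ({0..t} \<inter> Z)"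
    using continuous_closed_preimage_constant[OF cont closed_atLeastAtMost]
    by (intro compact_Int_closed) (auto simp: Z_def)
  moreover have "{0..t} \<inter> Z = Z" by (auto simp: Z_def)
  ultimately obtain s0 where s0: "s0 \<in> Z" "\<And>u. u \<in> Z \<Longrightarrow> s0 \<le> u"
    using compact_attains_inf by metis
  then have s0': "s0 \<in> {0..t}" "f s0 = 0" by (auto simp: Z_def)
  then obtain l where "l > 0" "(f has_real_derivative l) (at s0 within {0..t})" using inc by blast
  then obtain d where d: "d > 0" "\<And>h. h > 0 \<Longrightarrow> s0 - h \<in> {0..t} \<Longrightarrow> h < d \<Longrightarrow> f (s0 - h) < f s0"
    using has_real_derivative_pos_inc_left by blast
  have "s0 \<noteq> 0" using s0' f0 by auto
  define h where "h = min (s0 / 2) (d / 2)"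
  have h: "0 < h" "h < d" "s0 - h \<in> {0..t}"
    using d s0' \<open>s0 \<noteq> 0\<close> by (auto simp: h_def min_def)
  then have "f (s0 - h) \<le> 0" using d(2)[of h] s0' by simp
  with zero[OF h(3)] obtain u where "u \<in> {0..s0 - h}" "f u = 0" by blast
  then have "u \<in> Z" using s0' h by (auto simp: Z_def)
  then show False using s0(2)[of u] \<open>u \<in> {0..s0 - h}\<close> h by simp
qed

lemma norm_solution_lower_bound:
  fixes y :: "real \<Rightarrow> 'a::real_inner"
  assumes y: "\<And>s. s \<in> {0..t} \<Longrightarrow> (y has_vector_derivative y' s) (at s within {0..t})"
    and b: "\<And>s. s \<in> {0..t} \<Longrightarrow> norm (y' s) \<le> \<beta> s * norm (y s)"
    and \<beta>: "continuous_on {0..t} \<beta>" and s: "s \<in> {0..t}"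
  shows "exp (- integral {0..s} \<beta>) * norm (y 0) \<le> norm (y s)"
proof -
  define \<theta> where "\<theta> s = integral {0..s} \<beta>" for s
  define f where "f s = inner (y s) (y s) * exp (2 * \<theta> s)" for s
  have d\<theta>: "(\<theta> has_real_derivative \<beta> s) (at s within {0..t})" if "s \<in> {0..t}" for s
    unfolding \<theta>_def has_real_derivative_iff_has_vector_derivative
    by (rule integral_has_vector_derivative[OF \<beta> that])
  have df: "(f has_real_derivative (2 * inner (y s) (y' s) + 2 * \<beta> s * inner (y s) (y s)) * exp (2 * \<theta> s)) (at s within {0..t})"
    if "s \<in> {0..t}" for s
    unfolding f_def
    using y[OF that] d\<theta>[OF that]
    by (auto simp: has_vector_derivative_def has_field_derivative_def intro!: derivative_eq_intros)
       (auto simp: algebra_simps inner_commute)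
  have nonneg: "0 \<le> 2 * inner (y s) (y' s) + 2 * \<beta> s * inner (y s) (y s)" if "s \<in> {0..t}" for s
  proof -
    have "\<bar>inner (y s) (y' s)\<bar> \<le> norm (y s) * (\<beta> s * norm (y s))"
      using Cauchy_Schwarz_ineq2[of "y s" "y' s"] mult_left_mono[OF b[OF that], of "norm (y s)"] by simp
    then show ?thesis by (simp add: dot_square_norm power2_eq_square algebra_simps)
  qed
  have "f 0 \<le> f s"
  proof (rule DERIV_nonneg_imp_increasing_open[where f=f])
    show "0 \<le> s" using s by simp
    show "continuous_on {0..s} f"
      using s by (intro continuous_on_subset[OF DERIV_continuous_on[OF df]]) auto
    fix u assume "0 < u" "u < s"
    then have u: "u \<in> {0..t}" "u \<in> {0<..<t}" using s by auto
    then show "\<exists>l. DERIV f u :> l \<and> 0 \<le> l"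
      using df[OF u(1)] nonneg[OF u(1)] at_within_Icc_at[of 0 u t]
      by (auto intro!: exI mult_nonneg_nonneg)
  qed
  then have "norm (y 0) ^ 2 \<le> (norm (y s) * exp (\<theta> s)) ^ 2"
    by (simp add: f_def \<theta>_def dot_square_norm power_mult_distrib exp_double)
  then have "norm (y 0) \<le> norm (y s) * exp (\<theta> s)"
    by (rule power2_le_imp_le) simp
  then show ?thesis
    by (simp add: \<theta>_def exp_minus field_simps)
qed

text \<open>The angle between \<open>y 0\<close> and \<open>y s\<close> grows with speed at most \<open>\<beta>\<close>, but it is not differentiable where
  \<open>y s\<close> is parallel to \<open>y 0\<close>, in particular at the start. It is therefore compared with an angle
  \<open>\<psi>\<close> that starts above it and turns with speed \<open>\<beta> + \<delta>\<close>: whenever the two are equal, the true angle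
  falls behind, so it never overtakes. Half of the slack between \<open>\<integral> \<beta>\<close> and \<open>\<pi>\<close> is spent on \<open>\<delta>\<close>.\<close>

lemma inner_solution_lower_bound:
  fixes y :: "real \<Rightarrow> 'a::real_inner"
  assumes t: "0 \<le> t"
    and y: "\<And>s. s \<in> {0..t} \<Longrightarrow> (y has_vector_derivative y' s) (at s within {0..t})"
    and b: "\<And>s. s \<in> {0..t} \<Longrightarrow> norm (y' s) \<le> \<beta> s * norm (y s)"
    and \<beta>: "continuous_on {0..t} \<beta>" "\<And>s. s \<in> {0..t} \<Longrightarrow> 0 \<le> \<beta> s"
    and less_pi: "integral {0..t} \<beta> < pi"
    and y0: "y 0 \<noteq> 0"
  shows "cos ((integral {0..t} \<beta> + pi) / 2) * (norm (y 0) * norm (y t)) \<le> inner (y 0) (y t)"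
proof -
  define \<theta> where "\<theta> s = integral {0..s} \<beta>" for s
  define \<delta> where "\<delta> = (pi - \<theta> t) / (2 * (1 + t))"
  define \<psi> where "\<psi> s = \<theta> s + \<delta> * (1 + s)" for s
  define f where "f s = inner (y 0) (y s) - norm (y 0) * (norm (y s) * cos (\<psi> s))" for s
  have \<delta>: "0 < \<delta>" using less_pi t by (simp add: \<delta>_def \<theta>_def)
  have \<psi>t: "\<psi> t = (\<theta> t + pi) / 2"
    using t by (simp add: \<psi>_def \<delta>_def divide_simps) (simp add: algebra_simps)
  have d\<theta>: "(\<theta> has_real_derivative \<beta> s) (at s within {0..t})" if "s \<in> {0..t}" for s
    unfolding \<theta>_def has_real_derivative_iff_has_vector_derivative
    by (rule integral_has_vector_derivative[OF \<beta>(1) that])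
  have \<theta>_bounds: "0 \<le> \<theta> s" "\<theta> s \<le> \<theta> t" if "s \<in> {0..t}" for s
  proof -
    have i: "\<beta> integrable_on {0..u}" if "u \<le> t" for u
      by (rule integrable_continuous_real) (use that in \<open>auto intro: continuous_on_subset[OF \<beta>(1)]\<close>)
    show "0 \<le> \<theta> s"
      unfolding \<theta>_def by (rule integral_nonneg) (use that i \<beta>(2) in auto)
    show "\<theta> s \<le> \<theta> t"
      unfolding \<theta>_def by (rule integral_subset_le) (use that i \<beta>(2) in auto)
  qed
  have \<psi>: "0 < \<psi> s" "\<psi> s < pi" if "s \<in> {0..t}" for s
  proof -
    have "0 < \<delta> * (1 + s)" "\<delta> * (1 + s) \<le> \<delta> * (1 + t)" using that \<delta> by auto
    then show "0 < \<psi> s" "\<psi> s < pi"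
      using \<theta>_bounds[OF that] \<psi>t less_pi by (auto simp: \<psi>_def \<theta>_def)
  qed
  have ynz: "y s \<noteq> 0" if "s \<in> {0..t}" for s
    using norm_solution_lower_bound[OF y b \<beta>(1) that] y0
    by (metis exp_gt_zero mult_pos_pos norm_eq_zero not_le zero_less_norm_iff)
  define l where "l s = inner (y 0) (y' s) - norm (y 0) *
      (inner (y s) (y' s) / norm (y s) * cos (\<psi> s) - norm (y s) * (sin (\<psi> s) * (\<beta> s + \<delta>)))" for s
  have df: "(f has_real_derivative l s) (at s within {0..t})" if s: "s \<in> {0..t}" for s
  proof -
    have n: "((\<lambda>u. norm (y u)) has_derivative (\<lambda>h. inner (h *\<^sub>R y' s) (sgn (y s)))) (at s within {0..t})"
      using has_derivative_compose[OF y[OF s, unfolded has_vector_derivative_def] has_derivative_norm[OF ynz[OF s]]] .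
    show ?thesis
      unfolding f_def l_def \<psi>_def
      using y[OF s] d\<theta>[OF s] n
      by (auto simp: has_vector_derivative_def has_field_derivative_def intro!: derivative_eq_intros)
         (auto simp: fun_eq_iff sgn_div_norm inner_commute algebra_simps divide_inverse)
  qed
  have "0 < f t"
  proof (rule positive_if_increasing_at_zeros[where f=f])
    show "continuous_on {0..t} f"
      by (rule DERIV_continuous_on[OF df])
    have "cos (\<psi> 0) < 1"
      using \<psi>[of 0] t cos_monotone_0_pi[of 0 "\<psi> 0"] by simp
    then show "0 < f 0"
      using y0 by (simp add: f_def dot_square_norm power2_eq_square)
    show "t \<in> {0..t}" using t by simp
    fix s assume s: "s \<in> {0..t}" and zero: "f s = 0"
    define a where "a = norm (y 0)"
    define c where "c = cos (\<psi> s)"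
    define q where "q = norm (y s)"
    have pos: "0 < a" "0 < q" "0 < sin (\<psi> s)"
      using y0 ynz[OF s] \<psi>[OF s] by (auto simp: a_def q_def sin_gt_zero)
    have ip: "inner (y 0) (y s) = a * (q * c)" using zero by (simp add: f_def a_def q_def c_def)
    \<comment> \<open>At a zero of \<open>f\<close> this is the component of \<open>y 0\<close> orthogonal to \<open>y s\<close>, and its length \<open>a sin \<psi>\<close> is
      matched by the derivative of \<open>cos \<psi>\<close>.\<close>
    define v where "v = y 0 - (a * c / q) *\<^sub>R y s"
    have "norm v ^ 2 = (a * sin (\<psi> s)) ^ 2"
    proof -
      have "norm v ^ 2 = inner (y 0) (y 0) - 2 * (a * c / q) * inner (y 0) (y s) + (a * c / q) ^ 2 * inner (y s) (y s)"
        unfolding v_def power2_norm_eq_inner inner_diff_left inner_diff_right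
          inner_scaleR_left inner_scaleR_right inner_commute[of "y s" "y 0"]
        by (simp add: power2_eq_square algebra_simps)
      also have "\<dots> = a ^ 2 * (1 - c ^ 2)"
        using pos unfolding ip dot_square_norm a_def[symmetric] q_def[symmetric]
        by (simp add: field_simps power2_eq_square)
      also have "1 - c ^ 2 = sin (\<psi> s) ^ 2" by (simp add: c_def sin_squared_eq)
      finally show ?thesis by (simp add: power_mult_distrib)
    qed
    then have nv: "norm v = a * sin (\<psi> s)"
      using pos by (simp add: power2_eq_iff_nonneg)
    have "l s = inner v (y' s) + a * q * sin (\<psi> s) * (\<beta> s + \<delta>)"
      by (simp add: l_def v_def a_def c_def q_def inner_diff_left algebra_simps)
    moreover have "\<bar>inner v (y' s)\<bar> \<le> a * sin (\<psi> s) * (\<beta> s * q)"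
      using Cauchy_Schwarz_ineq2[of v "y' s"] mult_left_mono[OF b[OF s] norm_ge_zero[of v]]
      unfolding nv q_def by linarith
    ultimately have "a * q * sin (\<psi> s) * \<delta> \<le> l s" by (simp add: algebra_simps)
    then have "0 < l s" using pos \<delta> by (meson less_le_trans mult_pos_pos)
    then show "\<exists>l>0. (f has_real_derivative l) (at s within {0..t})" using df[OF s] by blast
  qed
  then show ?thesis
    by (simp add: f_def \<psi>t) (simp add: \<theta>_def mult_ac)
qed

text \<open>The distance from \<open>0\<close> of the segment between a unit vector and its image under an evolution with
  total angle \<open>\<theta>\<close> is at least this number. The factor \<open>exp (- \<theta>)\<close> bounds the length of the image
  from below; the square root is the effect of the angle.\<close>

definition segment_gap :: "real \<Rightarrow> real" where
  "segment_gap \<theta> = sqrt ((1 + cos ((\<theta> + pi) / 2)) / 2) * exp (- \<theta>)"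

lemma segment_gap_pos:
  assumes "0 \<le> \<theta>" "\<theta> < pi"
  shows "0 < segment_gap \<theta>"
proof -
  have "cos pi < cos ((\<theta> + pi) / 2)"
    by (rule cos_monotone_0_pi) (use assms in auto)
  then show ?thesis by (simp add: segment_gap_def)
qed

text \<open>For \<open>p, q \<ge> 0\<close> and \<open>\<kappa> \<le> 1\<close> one has \<open>p\<^sup>2 + q\<^sup>2 + 2 \<kappa> p q \<ge> (1 + \<kappa>) / 2 \<cdot> (p + q)\<^sup>2\<close>; here \<open>p\<close> and \<open>q\<close>
  are the lengths of the two parts of the convex combination and \<open>\<kappa>\<close> is the cosine of the angle bound.\<close>

lemma norm_segment_lower_bound:
  fixes y :: "real \<Rightarrow> 'a::real_inner"
  assumes t: "0 \<le> t"
    and y: "\<And>s. s \<in> {0..t} \<Longrightarrow> (y has_vector_derivative y' s) (at s within {0..t})"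
    and b: "\<And>s. s \<in> {0..t} \<Longrightarrow> norm (y' s) \<le> \<beta> s * norm (y s)"
    and \<beta>: "continuous_on {0..t} \<beta>" "\<And>s. s \<in> {0..t} \<Longrightarrow> 0 \<le> \<beta> s"
    and less_pi: "integral {0..t} \<beta> < pi"
    and \<sigma>: "\<sigma> \<in> {0..1}"
  shows "segment_gap (integral {0..t} \<beta>) * norm (y 0) \<le> norm (y 0 + \<sigma> *\<^sub>R (y t - y 0))"
proof (cases "y 0 = 0")
  case False
  define \<theta> where "\<theta> = integral {0..t} \<beta>"
  define \<kappa> where "\<kappa> = cos ((\<theta> + pi) / 2)"
  define p where "p = (1 - \<sigma>) * norm (y 0)"
  define q where "q = \<sigma> * norm (y t)"
  have \<theta>0: "0 \<le> \<theta>"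
    unfolding \<theta>_def by (rule integral_nonneg) (use \<beta> in \<open>auto intro: integrable_continuous_real\<close>)
  have pq: "0 \<le> p" "0 \<le> q" using \<sigma> by (auto simp: p_def q_def)
  have \<kappa>: "-1 \<le> \<kappa>" "\<kappa> \<le> 1" by (auto simp: \<kappa>_def)
  have ip: "\<kappa> * (norm (y 0) * norm (y t)) \<le> inner (y 0) (y t)"
    using inner_solution_lower_bound[OF t y b \<beta> less_pi False] by (simp add: \<kappa>_def \<theta>_def)
  have "exp (- \<theta>) * norm (y 0) \<le> norm (y t)"
    using norm_solution_lower_bound[OF y b \<beta>(1), of t] t by (simp add: \<theta>_def)
  moreover have "exp (- \<theta>) * norm (y 0) \<le> norm (y 0)"
    using \<theta>0 by (simp add: mult_left_le_one_le)
  ultimately have "(1 - \<sigma>) * (exp (- \<theta>) * norm (y 0)) + \<sigma> * (exp (- \<theta>) * norm (y 0)) \<le> p + q"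
    unfolding p_def q_def using \<sigma> by (intro add_mono mult_left_mono) auto
  then have sum: "exp (- \<theta>) * norm (y 0) \<le> p + q" by (simp add: algebra_simps)
  have "((1 + \<kappa>) / 2) * (p + q) ^ 2 = p ^ 2 + q ^ 2 + 2 * \<kappa> * (p * q) - ((1 - \<kappa>) / 2) * (p - q) ^ 2"
    by (simp add: power2_eq_square field_simps)
  also have "\<dots> \<le> p ^ 2 + q ^ 2 + 2 * \<kappa> * (p * q)" using \<kappa> by simp
  also have "2 * \<kappa> * (p * q) = 2 * ((1 - \<sigma>) * \<sigma>) * (\<kappa> * (norm (y 0) * norm (y t)))"
    by (simp add: p_def q_def)
  also have "\<dots> \<le> 2 * ((1 - \<sigma>) * \<sigma>) * inner (y 0) (y t)"
    using ip \<sigma> by (intro mult_left_mono) auto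
  also have "p ^ 2 + q ^ 2 + 2 * ((1 - \<sigma>) * \<sigma>) * inner (y 0) (y t) = norm ((1 - \<sigma>) *\<^sub>R y 0 + \<sigma> *\<^sub>R y t) ^ 2"
    unfolding p_def q_def power_mult_distrib power2_norm_eq_inner inner_add_left inner_add_right
      inner_scaleR_left inner_scaleR_right inner_commute[of "y t" "y 0"]
    by (simp add: power2_eq_square algebra_simps)
  also have "(1 - \<sigma>) *\<^sub>R y 0 + \<sigma> *\<^sub>R y t = y 0 + \<sigma> *\<^sub>R (y t - y 0)"
    by (simp add: algebra_simps)
  finally have "sqrt (((1 + \<kappa>) / 2) * (p + q) ^ 2) \<le> norm (y 0 + \<sigma> *\<^sub>R (y t - y 0))"
    by (intro real_le_lsqrt) auto
  moreover have "sqrt (((1 + \<kappa>) / 2) * (p + q) ^ 2) = sqrt ((1 + \<kappa>) / 2) * (p + q)"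
    unfolding real_sqrt_mult using pq by simp
  ultimately have "sqrt ((1 + \<kappa>) / 2) * (p + q) \<le> norm (y 0 + \<sigma> *\<^sub>R (y t - y 0))"
    by simp
  moreover have "sqrt ((1 + \<kappa>) / 2) * (exp (- \<theta>) * norm (y 0)) \<le> sqrt ((1 + \<kappa>) / 2) * (p + q)"
    using sum \<kappa> by (intro mult_left_mono) auto
  ultimately show ?thesis
    by (simp add: segment_gap_def \<theta>_def \<kappa>_def mult.assoc)
qed simp

text \<open>The lower bound on all vectors bounds every inverse that exists, and this is what the continuation
  along the segment requires.\<close>

theorem evolution_segment_invertible:
  fixes B :: "real \<Rightarrow> 'a::{real_inner,banach,nontrivial_vector} endo"
  assumes t: "0 \<le> t" and B: "continuous_on {0..t} B"
    and \<beta>: "\<And>s. s \<in> {0..t} \<Longrightarrow> norm (B s) \<le> \<beta> s" "continuous_on {0..t} \<beta>"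
    and less_pi: "integral {0..t} \<beta> < pi"
    and \<sigma>: "\<sigma> \<in> {0..1}"
  shows "\<exists>G. inverse_pair G (1 + \<sigma> *\<^sub>R (evolution B t - 1)) \<and> norm G \<le> 1 / segment_gap (integral {0..t} \<beta>)"
proof -
  define g where "g = segment_gap (integral {0..t} \<beta>)"
  have \<beta>0: "0 \<le> \<beta> s" if "s \<in> {0..t}" for s using \<beta>(1)[OF that] norm_ge_zero order_trans by blast
  have "0 \<le> integral {0..t} \<beta>"
    by (rule integral_nonneg) (use \<beta> \<beta>0 in \<open>auto intro: integrable_continuous_real\<close>)
  then have g: "0 < g" unfolding g_def using less_pi by (rule segment_gap_pos)
  have lower: "g * norm x \<le> norm (eapp (1 + \<sigma> *\<^sub>R (evolution B t - 1)) x)" if \<sigma>: "\<sigma> \<in> {0..1}" for \<sigma> x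
  proof -
    define y where "y s = eapp (evolution B s) x" for s
    have "((\<lambda>s. eapp (evolution B s) x) has_vector_derivative eapp (B s) (y s)) (at s within {0..t})" if "s \<in> {0..t}" for s
      using bounded_linear.has_vector_derivative[OF 
          bounded_linear_compose[OF blinfun.bounded_linear_left bounded_linear_blinfun_of]
          evolution_has_vector_derivative[OF B that], of x]
      by (simp add: y_def)
    then have y: "(y has_vector_derivative eapp (B s) (y s)) (at s within {0..t})" if "s \<in> {0..t}" for s
      using that by (simp add: y_def[abs_def])
    have b: "norm (eapp (B s) (y s)) \<le> \<beta> s * norm (y s)" if "s \<in> {0..t}" for s
      using norm_blinfun[of "blinfun_of (B s)" "y s"] mult_right_mono[OF \<beta>(1)[OF that], of "norm (y s)"] by simp
    have "y 0 = x" by (simp add: y_def)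
    then show ?thesis
      using norm_segment_lower_bound[OF t y b \<beta>(2) \<beta>0 less_pi \<sigma>]
      by (simp add: g_def y_def blinfun.bilinear_simps)
  qed
  have bound: "norm G \<le> 1 / g" if \<sigma>: "\<sigma> \<in> {0..1}" and G: "inverse_pair G (1 + \<sigma> *\<^sub>R (evolution B t - 1))" for \<sigma> G
    unfolding norm_endo_def
  proof (rule norm_blinfun_bound)
    fix x
    have "eapp ((1 + \<sigma> *\<^sub>R (evolution B t - 1)) * G) x = x"
      using G by (simp add: inverse_pair_def del: blinfun_of_simps(6))
    then have "eapp (1 + \<sigma> *\<^sub>R (evolution B t - 1)) (eapp G x) = x" by simp
    then have "g * norm (eapp G x) \<le> norm x" using lower[OF \<sigma>, of "eapp G x"] by simp
    then show "norm (eapp G x) \<le> 1 / g * norm x" using g by (simp add: field_simps)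
  qed (use g in simp)
  have "\<exists>G. inverse_pair G (1 + \<sigma> *\<^sub>R (evolution B t - 1))"
    by (rule invertible_along_segment[OF bound \<sigma>])
  then show ?thesis using bound[OF \<sigma>] by (auto simp: g_def)
qed

section \<open>The logarithm as a holomorphic function of the coupling constant\<close>

lemma continuous_on_inverse_pair:
  fixes V G :: "'x::topological_space \<Rightarrow> 'b::real_normed_algebra_1"
  assumes V: "continuous_on T V" and G: "\<And>x. x \<in> T \<Longrightarrow> inverse_pair (G x) (V x)"
    and bound: "\<And>x. x \<in> T \<Longrightarrow> norm (G x) \<le> C"
  shows "continuous_on T G"
  unfolding continuous_on_def
proof
  fix x assume x: "x \<in> T"
  have "((\<lambda>y. G y - G x) \<longlongrightarrow> 0) (at x within T)"
  proof (rule Lim_null_comparison)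
    show "\<forall>\<^sub>F y in at x within T. norm (G y - G x) \<le> C * norm (V x - V y) * norm (G x)"
      unfolding eventually_at_filter
    proof (intro always_eventually allI impI)
      fix y assume y: "y \<in> T"
      have "norm (G y - G x) \<le> norm (G y) * norm (V x - V y) * norm (G x)"
        unfolding inverse_pair_diff[OF G[OF x] G[OF y]]
        by (intro order_trans[OF norm_mult_ineq] mult_right_mono norm_mult_ineq norm_ge_zero)
      also have "\<dots> \<le> C * norm (V x - V y) * norm (G x)"
        by (intro mult_right_mono bound y norm_ge_zero)
      finally show "norm (G y - G x) \<le> C * norm (V x - V y) * norm (G x)" .
    qed
    have "((\<lambda>y. C * norm (V x - V y) * norm (G x)) \<longlongrightarrow> C * norm (V x - V x) * norm (G x)) (at x within T)"
      using V x by (intro tendsto_intros) (auto simp: continuous_on_def)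
    then show "((\<lambda>y. C * norm (V x - V y) * norm (G x)) \<longlongrightarrow> 0) (at x within T)" by simp
  qed
  then show "(G \<longlongrightarrow> G x) (at x within T)" by (simp add: LIM_zero_iff)
qed

lemma has_derivative_0_bounded_mult:
  fixes q G :: "'x::real_normed_vector \<Rightarrow> 'b::real_normed_algebra"
  assumes q: "(q has_derivative (\<lambda>h. 0)) (at x within S)" "q x = 0"
    and bound: "\<And>y. y \<in> S \<Longrightarrow> norm (G y) \<le> C"
  shows "((\<lambda>y. G y * q y) has_derivative (\<lambda>h. 0)) (at x within S)"
  unfolding has_derivative_iff_norm
proof
  show "((\<lambda>y. norm (G y * q y - G x * q x - 0) / norm (y - x)) \<longlongrightarrow> 0) (at x within S)"
  proof (rule Lim_null_comparison)
    show "\<forall>\<^sub>F y in at x within S. norm (norm (G y * q y - G x * q x - 0) / norm (y - x)) \<le> C * (norm (q y) / norm (y - x))"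
      unfolding eventually_at_filter
    proof (intro always_eventually allI impI)
      fix y assume y: "y \<in> S"
      have "norm (G y * q y) \<le> C * norm (q y)"
        by (rule order_trans[OF norm_mult_ineq mult_right_mono[OF bound[OF y] norm_ge_zero]])
      then show "norm (norm (G y * q y - G x * q x - 0) / norm (y - x)) \<le> C * (norm (q y) / norm (y - x))"
        using divide_right_mono[of _ _ "norm (y - x)"] by (simp add: q)
    qed
    have "((\<lambda>y. norm (q y) / norm (y - x)) \<longlongrightarrow> 0) (at x within S)"
      using q unfolding has_derivative_iff_norm by simp
    from tendsto_mult_right_zero[OF this]
    show "((\<lambda>y. C * (norm (q y) / norm (y - x))) \<longlongrightarrow> 0) (at x within S)" .
  qed
qed simp

text \<open>The resolvent identity, used twice, writes the increment of \<open>G\<close> as its linear part plus \<open>G y\<close> times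
  a term that is quadratic in the increment of \<open>V\<close>. The product rule makes the derivative of that term
  zero, and \<open>G\<close> only needs to be bounded.\<close>

lemma has_derivative_inverse_pair:
  fixes V G :: "'x::real_normed_vector \<Rightarrow> 'b::real_normed_algebra_1"
  assumes V: "(V has_derivative V') (at x within S)" and x: "x \<in> S"
    and G: "\<And>y. y \<in> S \<Longrightarrow> inverse_pair (G y) (V y)"
    and bound: "\<And>y. y \<in> S \<Longrightarrow> norm (G y) \<le> C"
  shows "(G has_derivative (\<lambda>h. - (G x * V' h * G x))) (at x within S)"
proof -
  define q where "q y = (V y - V x) * G x * (V y - V x) * G x" for y
  have dV: "((\<lambda>y. V y - V x) has_derivative V') (at x within S)"
    using has_derivative_diff[OF V has_derivative_const[of "V x"]] by simp
  have 1: "((\<lambda>y. (V y - V x) * G x) has_derivative (\<lambda>h. V' h * G x)) (at x within S)"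
    by (rule has_derivative_mult_left[OF dV])
  have "(q has_derivative (\<lambda>h. 0)) (at x within S)"
    using has_derivative_mult[OF 1 1] by (simp add: q_def[abs_def] mult.assoc)
  then have 2: "((\<lambda>y. G y * q y) has_derivative (\<lambda>h. 0)) (at x within S)"
    by (rule has_derivative_0_bounded_mult[OF _ _ bound]) (simp add: q_def)
  have 3: "((\<lambda>y. G x * ((V y - V x) * G x)) has_derivative (\<lambda>h. G x * (V' h * G x))) (at x within S)"
    by (rule has_derivative_mult_right[OF 1])
  have 4: "((\<lambda>y. G x - G x * ((V y - V x) * G x) + G y * q y) has_derivative
      (\<lambda>h. 0 - G x * (V' h * G x) + 0)) (at x within S)"
    by (intro has_derivative_add has_derivative_diff has_derivative_const 2 3)
  have eq: "G y = G x - G x * ((V y - V x) * G x) + G y * q y" if "y \<in> S" for y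
  proof -
    define d where "d = V y - V x"
    have e: "G y = G x - G y * d * G x"
      using inverse_pair_diff[OF G[OF x] G[OF that]] by (simp add: d_def algebra_simps)
    then have "G y = G x - (G x - G y * d * G x) * d * G x" by simp
    then show ?thesis by (simp add: q_def d_def[symmetric] algebra_simps)
  qed
  show ?thesis
    using has_derivative_transform[OF x eq 4] by (simp add: mult.assoc)
qed

text \<open>The element \<open>J\<close> plays the part of the imaginary unit. The norm condition makes multiplication by a
  complex number \<open>z\<close> bounded by \<open>\<bar>z\<bar>\<close>, which the sharp constant \<open>\<pi>\<close> depends on.\<close>

locale complex_structure =
  fixes J :: "'b::{real_normed_algebra_1,banach}"
  assumes J_square: "J * J = - 1"
    and norm_complex: "norm (Re z *\<^sub>R 1 + Im z *\<^sub>R J) \<le> cmod z"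
begin

definition cx :: "complex \<Rightarrow> 'b" where
  "cx z = Re z *\<^sub>R 1 + Im z *\<^sub>R J"

lemma norm_cx: "norm (cx z) \<le> cmod z"
  unfolding cx_def by (rule norm_complex)

lemma cx_simps [simp]:
  "cx 0 = 0" "cx 1 = 1" "cx (complex_of_real r) = r *\<^sub>R 1" "cx (z + z') = cx z + cx z'"
  "cx (r *\<^sub>R z) = r *\<^sub>R cx z" "cx \<i> = J"
  by (simp_all add: cx_def algebra_simps)

lemma cx_mult: "cx (z * z') = cx z * cx z'"
  by (simp add: cx_def J_square algebra_simps)

lemma cx_power: "cx (z ^ n) = cx z ^ n"
  by (induction n) (simp_all add: cx_mult)

lemma bounded_linear_cx: "bounded_linear cx"
  by (rule bounded_linear_intro[of _ 1]) (simp_all add: norm_cx)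

lemma bounded_bilinear_cx: "bounded_bilinear (\<lambda>h d. cx h * d)"
  by (rule bounded_bilinear.comp1[OF bounded_bilinear_mult bounded_linear_cx])

lemma cx_commutes: "J * b = b * J \<Longrightarrow> cx z * b = b * cx z"
  by (simp add: cx_def algebra_simps)

text \<open>A real functional is the real part of one that is complex linear with respect to \<open>J\<close>. Composed with
  such functionals, algebra-valued functions become ordinary holomorphic functions.\<close>

definition complexify :: "('b \<Rightarrow> real) \<Rightarrow> 'b \<Rightarrow> complex" where
  "complexify \<phi> b = Complex (\<phi> b) (- \<phi> (J * b))"

lemma complexify_cx:
  assumes "bounded_linear \<phi>"
  shows "complexify \<phi> (cx z * b) = z * complexify \<phi> b"
proof -
  interpret bounded_linear \<phi> by fact
  have J: "J * (J * b) = - b" by (simp add: mult.assoc[symmetric] J_square)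
  show ?thesis
    by (simp add: complexify_def cx_def complex_eq_iff distrib_left distrib_right J add scaleR neg diff)
qed

lemma bounded_linear_complexify:
  assumes "bounded_linear \<phi>"
  shows "bounded_linear (complexify \<phi>)"
proof -
  have "bounded_linear (\<lambda>b. complex_of_real (\<phi> b) - \<i> * complex_of_real (\<phi> (J * b)))"
    by (intro bounded_linear_sub bounded_linear_const_mult bounded_linear_compose[OF bounded_linear_of_real]
        bounded_linear_compose[OF assms] bounded_linear_mult_right assms)
  also have "(\<lambda>b. complex_of_real (\<phi> b) - \<i> * complex_of_real (\<phi> (J * b))) = complexify \<phi>"
    by (simp add: fun_eq_iff complexify_def complex_eq_iff)
  finally show ?thesis .
qed

lemma norm_complexify:
  assumes "\<And>b. \<bar>\<phi> b\<bar> \<le> K * norm b"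
  shows "cmod (complexify \<phi> b) \<le> 2 * K * norm b"
proof -
  have "norm J \<le> 1" using norm_cx[of \<i>] by simp
  then have "norm (J * b) \<le> norm b"
    using norm_mult_ineq[of J b] mult_right_mono[of "norm J" 1 "norm b"] by simp
  moreover have "0 \<le> K" using assms[of 1] by simp
  ultimately have "\<bar>\<phi> (J * b)\<bar> \<le> K * norm b"
    using assms[of "J * b"] mult_left_mono order_trans by blast
  then show ?thesis
    using cmod_le[of "complexify \<phi> b"] assms[of b] by (simp add: complexify_def)
qed

end

text \<open>The situation on the disc of radius \<open>r > 1\<close>. Here \<open>w\<close> is any family of functions that satisfies
  the Magnus recursion in differential form, and \<open>C\<close> is a common bound on the inverses along all
  segments.\<close>

locale magnus_disc = complex_structure J
  for J :: "'b::{real_normed_algebra_1,banach}" +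
  fixes A :: "real \<Rightarrow> 'b" and t r C :: real and w :: "nat \<Rightarrow> real \<Rightarrow> 'b"
  assumes t: "0 \<le> t" and r: "1 < r"
    and A: "continuous_on {0..t} A"
    and JA: "s \<in> {0..t} \<Longrightarrow> J * A s = A s * J"
    and invertible: "cmod z < r \<Longrightarrow> \<sigma> \<in> {0..1} \<Longrightarrow>
      \<exists>G. inverse_pair G (1 + \<sigma> *\<^sub>R (evolution (\<lambda>s. cx z * A s) t - 1)) \<and> norm G \<le> C"
    and w_deriv: "s \<in> {0..t} \<Longrightarrow>
      ((w (Suc m)) has_vector_derivative magnus_rhs (\<lambda>k. w k s) (A s) m) (at s within {0..t})"
    and w_init: "w (Suc m) 0 = 0"
begin

abbreviation P :: "nat \<Rightarrow> 'b" where "P n \<equiv> dyson A n t"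

definition Y :: "complex \<Rightarrow> 'b" where "Y z = evolution (\<lambda>s. cx z * A s) t"

definition resolvent :: "complex \<Rightarrow> real \<Rightarrow> 'b" where
  "resolvent z \<sigma> = (SOME G. inverse_pair G (1 + \<sigma> *\<^sub>R (Y z - 1)) \<and> norm G \<le> C)"

definition logY :: "complex \<Rightarrow> 'b" where
  "logY z = integral {0..1} (\<lambda>\<sigma>. (Y z - 1) * resolvent z \<sigma>)"

lemma resolvent:
  assumes "z \<in> ball 0 r" "\<sigma> \<in> {0..1}"
  shows "inverse_pair (resolvent z \<sigma>) (1 + \<sigma> *\<^sub>R (Y z - 1))" "norm (resolvent z \<sigma>) \<le> C"
  using someI_ex[OF invertible[of z \<sigma>]] assms by (simp_all add: resolvent_def Y_def)

lemma C_nonneg: "0 \<le> C"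
  using order_trans[OF norm_ge_zero resolvent(2)[of 0 0]] r by simp

lemma P_commutes: "J * P n = P n * J"
  by (rule dyson_commutes[OF A JA]) (use t in auto)

lemma Y_series: "Y z = (\<Sum>n. cx (z ^ n) * P n)"
  unfolding Y_def evolution_def cx_power
  by (subst dyson_mult_commuting[OF A]) (use t JA in \<open>auto simp: cx_commutes\<close>)

lemma P_bound: obtains M where "0 \<le> M" "\<And>n. norm (P n) \<le> M ^ n / fact n"
proof -
  obtain M where "0 < M" "\<And>s. s \<in> {0..t} \<Longrightarrow> norm (A s) \<le> M" using norm_bound_exists[OF A] by blast
  then have "0 \<le> M * t" "\<And>n. norm (P n) \<le> (M * t) ^ n / fact n"
    using t dyson_bound[OF A] by auto
  then show ?thesis by (rule that)
qed

lemma summable_powers_P: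
  assumes "0 \<le> R" shows "summable (\<lambda>n. R ^ n * norm (P n))"
proof -
  obtain M where M: "0 \<le> M" "\<And>n. norm (P n) \<le> M ^ n / fact n" by (rule P_bound) blast
  show ?thesis
  proof (rule summable_comparison_test'[OF summable_exp_real[of "R * M"]])
    fix n
    show "norm (R ^ n * norm (P n)) \<le> (R * M) ^ n / fact n"
      using mult_left_mono[OF M(2)[of n], of "R ^ n"] assms by (simp add: power_mult_distrib)
  qed
qed

lemma norm_term_le: "norm (cx (z ^ n) * P n) \<le> cmod z ^ n * norm (P n)"
  using norm_cx[of "z ^ n"]
  by (intro order_trans[OF norm_mult_ineq] mult_right_mono) (simp_all add: norm_power)

lemma summable_Y: "summable (\<lambda>n. cx (z ^ n) * P n)"
  by (rule summable_comparison_test'[OF summable_powers_P[of "cmod z"]]) (simp_all add: norm_term_le)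

lemma norm_Y:
  assumes "z \<in> ball 0 r" shows "norm (Y z) \<le> (\<Sum>n. r ^ n * norm (P n))"
  unfolding Y_series
proof (rule norm_suminf_le[OF _ summable_powers_P])
  fix n
  have "cmod z ^ n * norm (P n) \<le> r ^ n * norm (P n)"
    using assms by (intro mult_right_mono power_mono) auto
  then show "norm (cx (z ^ n) * P n) \<le> r ^ n * norm (P n)"
    using norm_term_le order_trans by blast
qed (use r in simp)

lemma Y_commutes: "cx z' * Y z = Y z * cx z'"
proof -
  have "cx z' * Y z = (\<Sum>n. cx z' * (cx (z ^ n) * P n))"
    unfolding Y_series by (rule suminf_mult[OF summable_Y, symmetric])
  also have "\<dots> = (\<Sum>n. (cx (z ^ n) * P n) * cx z')"
    by (simp add: mult.assoc cx_commutes[OF P_commutes, symmetric])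
       (simp add: mult.assoc[symmetric] cx_mult[symmetric] mult.commute)
  also have "\<dots> = Y z * cx z'"
    unfolding Y_series by (rule suminf_mult2[OF summable_Y, symmetric])
  finally show ?thesis .
qed

lemma Y_0: "Y 0 = 1"
proof -
  have "(\<Sum>n. cx (0 ^ n) * P n) = (\<Sum>n\<in>{0}. cx (0 ^ n) * P n)"
    by (rule suminf_finite) (auto simp: power_0_left)
  then show ?thesis by (simp add: Y_series)
qed

definition Y' :: "complex \<Rightarrow> 'b" where
  "Y' z = (\<Sum>n. cx (of_nat n * z ^ (n - 1)) * P n)"

lemma norm_deriv_term_le:
  assumes "z \<in> ball 0 r"
  shows "norm (cx (of_nat n * z ^ (n - 1)) * P n) \<le> real n * r ^ (n - 1) * norm (P n)"
proof -
  have "norm (cx (of_nat n * z ^ (n - 1))) \<le> real n * cmod z ^ (n - 1)"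
    using norm_cx[of "of_nat n * z ^ (n - 1)"] by (simp add: norm_mult norm_power)
  also have "\<dots> \<le> real n * r ^ (n - 1)"
    using assms by (intro mult_left_mono power_mono) auto
  finally show ?thesis
    by (intro order_trans[OF norm_mult_ineq] mult_right_mono) auto
qed

lemma summable_deriv_bound: "summable (\<lambda>n. real n * r ^ (n - 1) * norm (P n))"
proof -
  obtain M where M: "0 \<le> M" "\<And>n. norm (P n) \<le> M ^ n / fact n" by (rule P_bound) blast
  have "summable (\<lambda>n. real (Suc n) * r ^ n * norm (P (Suc n)))"
  proof (rule summable_comparison_test'[OF summable_mult[OF summable_exp_real[of "r * M"], of M]])
    fix n
    have "real (Suc n) * r ^ n * norm (P (Suc n)) \<le> real (Suc n) * r ^ n * (M ^ Suc n / fact (Suc n))"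
      using r by (intro mult_left_mono M) auto
    also have "\<dots> = M * ((r * M) ^ n / fact n)"
      by (simp add: power_mult_distrib divide_simps del: of_nat_Suc)
    finally show "norm (real (Suc n) * r ^ n * norm (P (Suc n))) \<le> M * ((r * M) ^ n / fact n)"
      using r by simp
  qed
  then show ?thesis
    using summable_Suc_iff[of "\<lambda>n. real n * r ^ (n - 1) * norm (P n)"] by simp
qed

lemma Y_has_derivative:
  assumes z: "z \<in> ball 0 r"
  shows "(Y has_derivative (\<lambda>h. cx h * Y' z)) (at z within ball 0 r)"
  unfolding Y_series[abs_def] Y'_def
proof (rule has_derivative_suminf[OF bounded_bilinear_cx convex_ball _ norm_deriv_term_le summable_deriv_bound z summable_Y z])
  fix n and z :: complex
  have "((\<lambda>z. z ^ n) has_derivative (\<lambda>h. h * (of_nat n * z ^ (n - 1)))) (at z within ball 0 r)"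
    using has_derivative_power[OF has_derivative_ident, of n z "ball 0 r"] by (simp add: mult_ac)
  from has_derivative_mult_left[OF bounded_linear.has_derivative[OF bounded_linear_cx this]]
  show "((\<lambda>z. cx (z ^ n) * P n) has_derivative (\<lambda>h. cx h * (cx (of_nat n * z ^ (n - 1)) * P n))) (at z within ball 0 r)"
    by (simp add: cx_mult mult.assoc)
qed

lemma continuous_on_Y: "continuous_on (ball 0 r) Y"
  by (rule has_derivative_continuous_on[OF Y_has_derivative])

lemma continuous_on_Y': "continuous_on (ball 0 r) Y'"
proof -
  have "uniform_limit (ball 0 r) (\<lambda>n z. \<Sum>i<n. cx (of_nat i * z ^ (i - 1)) * P i) (\<lambda>z. \<Sum>i. cx (of_nat i * z ^ (i - 1)) * P i) sequentially"
    by (rule Weierstrass_m_test[OF norm_deriv_term_le summable_deriv_bound])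
  then show ?thesis
    unfolding Y'_def[abs_def]
    by (rule uniform_limit_theorem[rotated])
       (auto intro!: always_eventually continuous_intros bounded_linear.continuous_on[OF bounded_linear_cx])
qed

lemma continuous_on_resolvent:
  "continuous_on (ball 0 r \<times> {0..1}) (\<lambda>(z, \<sigma>). resolvent z \<sigma>)"
proof (rule continuous_on_inverse_pair[where V="\<lambda>(z, \<sigma>). 1 + \<sigma> *\<^sub>R (Y z - 1)" and C=C])
  show "continuous_on (ball 0 r \<times> {0..1}) (\<lambda>(z, \<sigma>). 1 + \<sigma> *\<^sub>R (Y z - 1))"
    unfolding split_def
    by (intro continuous_intros continuous_on_compose2[OF continuous_on_Y]) auto
qed (use resolvent in auto)

lemma resolvent_commutes:
  assumes "z \<in> ball 0 r" "\<sigma> \<in> {0..1}"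
  shows "cx h * resolvent z \<sigma> = resolvent z \<sigma> * cx h"
  by (rule inverse_pair_commute[OF resolvent(1)[OF assms]])
     (simp add: algebra_simps Y_commutes)

definition integrand :: "complex \<Rightarrow> real \<Rightarrow> 'b" where
  "integrand z \<sigma> = (Y z - 1) * resolvent z \<sigma>"

definition integrand' :: "complex \<Rightarrow> real \<Rightarrow> 'b" where
  "integrand' z \<sigma> = Y' z * resolvent z \<sigma> - (Y z - 1) * (resolvent z \<sigma> * (\<sigma> *\<^sub>R Y' z) * resolvent z \<sigma>)"

lemma integrand_has_derivative:
  assumes z: "z \<in> ball 0 r" and \<sigma>: "\<sigma> \<in> {0..1}"
  shows "((\<lambda>z. integrand z \<sigma>) has_derivative (\<lambda>h. cx h * integrand' z \<sigma>)) (at z within ball 0 r)"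
proof -
  define R where "R = resolvent z \<sigma>"
  have dU: "((\<lambda>z. Y z - 1) has_derivative (\<lambda>h. cx h * Y' z)) (at z within ball 0 r)"
    using has_derivative_diff[OF Y_has_derivative[OF z] has_derivative_const[of 1]] by simp
  have "((\<lambda>z. 1 + \<sigma> *\<^sub>R (Y z - 1)) has_derivative (\<lambda>h. \<sigma> *\<^sub>R (cx h * Y' z))) (at z within ball 0 r)"
    using has_derivative_add[OF has_derivative_const[of 1] has_derivative_scaleR_right[OF dU, of \<sigma>]] by simp
  then have dR: "((\<lambda>z. resolvent z \<sigma>) has_derivative (\<lambda>h. - (R * (\<sigma> *\<^sub>R (cx h * Y' z)) * R))) (at z within ball 0 r)"
    unfolding R_def
    by (rule has_derivative_inverse_pair[OF _ z]) (use resolvent \<sigma> in auto)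
  have "(Y z - 1) * - (R * (\<sigma> *\<^sub>R (cx h * Y' z)) * R) + cx h * Y' z * R = cx h * integrand' z \<sigma>" for h
  proof -
    have "R * (cx h * Y' z) = cx h * (R * Y' z)"
      using resolvent_commutes[OF z \<sigma>, of h] by (simp add: R_def mult.assoc[symmetric])
    moreover have "(Y z - 1) * (cx h * b) = cx h * ((Y z - 1) * b)" for b
    proof -
      have "(Y z - 1) * cx h = cx h * (Y z - 1)" by (simp add: algebra_simps Y_commutes)
      then show ?thesis by (simp add: mult.assoc[symmetric])
    qed
    ultimately show ?thesis
      by (simp add: integrand'_def R_def[symmetric] mult.assoc right_diff_distrib)
  qed
  with has_derivative_mult[OF dU dR]
  show ?thesis by (simp add: integrand_def R_def[symmetric])
qed

lemma continuous_on_integrand: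
  "continuous_on (ball 0 r \<times> {0..1}) (\<lambda>(z, \<sigma>). integrand z \<sigma>)"
  "continuous_on (ball 0 r \<times> {0..1}) (\<lambda>(z, \<sigma>). integrand' z \<sigma>)"
  unfolding integrand_def integrand'_def split_def
  using continuous_on_resolvent
  by (auto intro!: continuous_intros continuous_on_compose2[OF continuous_on_Y] continuous_on_compose2[OF continuous_on_Y']
      simp: split_def)

lemma continuous_on_slice:
  assumes "z \<in> ball 0 r"
  shows "continuous_on {0..1} (integrand z)" "continuous_on {0..1} (resolvent z)"
proof -
  have "continuous_on {0..1} (\<lambda>\<sigma>. case (z, \<sigma>) of (z, \<sigma>) \<Rightarrow> integrand z \<sigma>)"
    by (rule continuous_on_compose2[OF continuous_on_integrand(1)]) (use assms in \<open>auto intro!: continuous_intros\<close>)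
  moreover have "continuous_on {0..1} (\<lambda>\<sigma>. case (z, \<sigma>) of (z, \<sigma>) \<Rightarrow> resolvent z \<sigma>)"
    by (rule continuous_on_compose2[OF continuous_on_resolvent]) (use assms in \<open>auto intro!: continuous_intros\<close>)
  ultimately show "continuous_on {0..1} (integrand z)" "continuous_on {0..1} (resolvent z)" by simp_all
qed

lemma exp_logY: "z \<in> ball 0 r \<Longrightarrow> exp (logY z) = Y z"
  unfolding logY_def
  using exp_integral_log[OF resolvent(1) continuous_on_slice(2)] by simp

lemma norm_logY:
  assumes z: "z \<in> ball 0 r" shows "norm (logY z) \<le> norm (Y z - 1) * C"
proof -
  have "norm (integral {0..1} (integrand z)) \<le> (norm (Y z - 1) * C) * (1 - 0)"
  proof (rule integral_bound[OF _ continuous_on_slice(1)[OF z]])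
    fix \<sigma> :: real assume "\<sigma> \<in> {0..1}"
    then show "norm (integrand z \<sigma>) \<le> norm (Y z - 1) * C"
      unfolding integrand_def
      by (intro order_trans[OF norm_mult_ineq] mult_left_mono resolvent z) auto
  qed simp
  then show ?thesis by (simp add: logY_def integrand_def[abs_def])
qed

text \<open>Differentiation under the integral sign; the integrand and its derivative are jointly continuous
  because the inverses are uniformly bounded.\<close>

lemma logY_holomorphic:
  assumes \<phi>: "bounded_linear \<phi>"
  shows "(\<lambda>z. complexify \<phi> (logY z)) holomorphic_on ball 0 r"
proof -
  note bl = bounded_linear_complexify[OF \<phi>]
  have "(\<lambda>z. integral (cbox 0 1) (\<lambda>\<sigma>. complexify \<phi> (integrand z \<sigma>))) holomorphic_on ball 0 r"
  proof (rule leibniz_rule_holomorphic)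
    fix z :: complex and \<sigma> :: real assume z: "z \<in> ball 0 r" and \<sigma>: "\<sigma> \<in> cbox 0 1"
    then have "((\<lambda>z. complexify \<phi> (integrand z \<sigma>)) has_derivative (\<lambda>h. complexify \<phi> (cx h * integrand' z \<sigma>))) (at z within ball 0 r)"
      by (intro bounded_linear.has_derivative[OF bl] integrand_has_derivative) auto
    then show "((\<lambda>z. complexify \<phi> (integrand z \<sigma>)) has_field_derivative complexify \<phi> (integrand' z \<sigma>)) (at z within ball 0 r)"
      unfolding has_field_derivative_def complexify_cx[OF \<phi>]
      by (simp only: mult.commute[of _ "complexify \<phi> (integrand' z \<sigma>)"])
  next
    fix z :: complex assume z: "z \<in> ball 0 r"
    show "(\<lambda>\<sigma>. complexify \<phi> (integrand z \<sigma>)) integrable_on cbox 0 (1::real)"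
      using continuous_on_slice(1)[OF z]
      by (intro integrable_continuous bounded_linear.continuous_on[OF bl]) auto
  next
    show "continuous_on (ball 0 r \<times> cbox 0 (1::real)) (\<lambda>(z, \<sigma>). complexify \<phi> (integrand' z \<sigma>))"
      using bounded_linear.continuous_on[OF bl continuous_on_integrand(2)] by (simp add: split_def)
  qed (rule convex_ball)
  moreover have "integral (cbox 0 1) (\<lambda>\<sigma>. complexify \<phi> (integrand z \<sigma>)) = complexify \<phi> (logY z)"
    if "z \<in> ball 0 r" for z
    using integral_linear[OF integrable_continuous_real[OF continuous_on_slice(1)[OF that]] bl]
    by (simp add: o_def logY_def integrand_def[abs_def])
  ultimately show ?thesis
    by (rule holomorphic_transform)
qed

text \<open>The dummy value at \<open>0\<close> is the constant term of the expansion of \<open>log Y\<^sub>z\<close>, whatever \<open>w 0\<close> is.\<close>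

definition W :: "nat \<Rightarrow> 'b" where "W k = (if k = 0 then 0 else w k t)"

text \<open>Both families satisfy \<open>P\<^sub>n\<^sub>+\<^sub>1' = A P\<^sub>n\<close> with the same initial values.\<close>

lemma fexp_magnus_eq_dyson: "fps_nth (fexp (magnus_fps (\<lambda>k. w k t))) n = P n"
proof (rule dyson_unique[OF A])
  fix s assume s: "s \<in> {0..t}"
  show "fps_nth (fexp (magnus_fps (\<lambda>k. w k s))) 0 = 1" by (simp add: fexp_def)
  fix n
  show "((\<lambda>s. fps_nth (fexp (magnus_fps (\<lambda>k. w k s))) (Suc n)) has_vector_derivative
      A s * fps_nth (fexp (magnus_fps (\<lambda>k. w k s))) n) (at s within {0..t})"
    using fexp_magnus_has_derivative[OF w_deriv[OF s], of "Suc n"] by simp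
next
  fix n
  have "magnus_fps (\<lambda>k. w k 0) = 0"
  proof (rule fps_ext)
    fix k show "fps_nth (magnus_fps (\<lambda>k. w k 0)) k = fps_nth 0 k"
      using w_init by (cases k) (simp_all add: magnus_fps_def)
  qed
  then show "fps_nth (fexp (magnus_fps (\<lambda>k. w k 0))) (Suc n) = 0"
    by (auto simp add: fexp_def power_0_left intro!: sum.neutral)
qed (use t in simp)

text \<open>The exponentials of both sides have the same expansion, namely the Dyson series, and both sides are
  small, so that \<open>exp_injective_near_0\<close> compares the arguments.\<close>

lemma logY_expansion:
  "\<exists>D. \<forall>\<^sub>F \<epsilon> in at_right 0. norm (logY (complex_of_real \<epsilon>) - (\<Sum>k\<le>N. \<epsilon> ^ k *\<^sub>R W k)) \<le> D * \<epsilon> ^ Suc N"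
proof -
  define X where "X = magnus_fps (\<lambda>k. w k t)"
  have XW: "fps_nth X k = W k" for k by (simp add: X_def W_def magnus_fps_def)
  define x where "x \<epsilon> = (\<Sum>k\<le>N. \<epsilon> ^ k *\<^sub>R W k)" for \<epsilon> :: real
  have Pn: "fps_nth (fexp X) = P" using fexp_magnus_eq_dyson by (auto simp: X_def)
  have "asymptotic N (\<lambda>\<epsilon>. exp (x \<epsilon>)) P"
    using asymptotic_exp[OF vanishes_magnus_fps, of N "\<lambda>k. w k t", folded X_def] by (simp add: XW x_def Pn)
  then obtain C1 where C1: "0 \<le> C1" "\<And>\<epsilon>. 0 < \<epsilon> \<Longrightarrow> \<epsilon> \<le> 1 \<Longrightarrow>
      norm (exp (x \<epsilon>) - (\<Sum>k\<le>N. \<epsilon> ^ k *\<^sub>R P k)) \<le> C1 * \<epsilon> ^ Suc N"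
    by (rule asymptoticE) blast
  have "summable (\<lambda>n. norm (P n))" using summable_powers_P[of 1] by simp
  then have "asymptotic N (\<lambda>\<epsilon>. \<Sum>n. \<epsilon> ^ n *\<^sub>R P n) P" by (rule asymptotic_power_series)
  moreover have "(\<Sum>n. \<epsilon> ^ n *\<^sub>R P n) = Y (complex_of_real \<epsilon>)" for \<epsilon>
    by (simp add: Y_series of_real_power[symmetric] del: of_real_power)
  ultimately have "asymptotic N (\<lambda>\<epsilon>. Y (complex_of_real \<epsilon>)) P" by simp
  then obtain C2 where C2: "0 \<le> C2" "\<And>\<epsilon>. 0 < \<epsilon> \<Longrightarrow> \<epsilon> \<le> 1 \<Longrightarrow>
      norm (Y (complex_of_real \<epsilon>) - (\<Sum>k\<le>N. \<epsilon> ^ k *\<^sub>R P k)) \<le> C2 * \<epsilon> ^ Suc N"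
    by (rule asymptoticE) blast
  have "isCont Y 0"
    using continuous_on_Y r by (simp add: continuous_on_eq_continuous_at)
  then have "((\<lambda>\<epsilon>. Y (complex_of_real \<epsilon>)) \<longlongrightarrow> Y 0) (at_right 0)"
    by (rule isCont_tendsto_compose) (auto intro!: tendsto_eq_intros)
  then have "((\<lambda>\<epsilon>. norm (Y (complex_of_real \<epsilon>) - 1) * C) \<longlongrightarrow> norm (1 - 1 :: 'b) * C) (at_right 0)"
    unfolding Y_0 by (intro tendsto_intros)
  then have ev1: "\<forall>\<^sub>F \<epsilon> in at_right 0. norm (Y (complex_of_real \<epsilon>) - 1) * C < 1/4"
    by (rule order_tendstoD(2)) simp
  have "(x \<longlongrightarrow> x 0) (at_right 0)"
    unfolding x_def by (intro tendsto_intros)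
  moreover have "x 0 = 0" by (simp add: x_def W_def power_0_left if_distrib if_distribR cong: if_cong)
  ultimately have "((\<lambda>\<epsilon>. norm (x \<epsilon>)) \<longlongrightarrow> 0) (at_right 0)" by (simp add: tendsto_norm_zero)
  then have ev2: "\<forall>\<^sub>F \<epsilon> in at_right 0. norm (x \<epsilon>) < 1/4"
    by (rule order_tendstoD(2)) simp
  have ev3: "\<forall>\<^sub>F \<epsilon> in at_right (0::real). 0 < \<epsilon> \<and> \<epsilon> < 1"
    by (rule eventually_at_rightI[of 0 1]) auto
  from ev1 ev2 ev3 have "\<forall>\<^sub>F \<epsilon> in at_right 0. norm (logY (complex_of_real \<epsilon>) - x \<epsilon>) \<le> (2 * (C1 + C2)) * \<epsilon> ^ Suc N"
  proof eventually_elim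
    case (elim \<epsilon>)
    have e: "complex_of_real \<epsilon> \<in> ball 0 r" using elim r by simp
    have "norm (logY (complex_of_real \<epsilon>)) \<le> 1/4" using norm_logY[OF e] elim by simp
    then have "norm (logY (complex_of_real \<epsilon>) - x \<epsilon>) \<le> 2 * norm (exp (logY (complex_of_real \<epsilon>)) - exp (x \<epsilon>))"
      using elim by (intro exp_injective_near_0) auto
    also have "norm (exp (logY (complex_of_real \<epsilon>)) - exp (x \<epsilon>)) \<le> C2 * \<epsilon> ^ Suc N + C1 * \<epsilon> ^ Suc N"
      unfolding exp_logY[OF e]
      using C1(2)[of \<epsilon>] C2(2)[of \<epsilon>] elim by (smt (verit) norm_triangle_ineq4 diff_diff_eq2 diff_add_cancel add_diff_eq)
    finally show ?case by (simp add: algebra_simps)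
  qed
  then show ?thesis unfolding x_def by blast
qed

end

lemma expansion_unique:
  fixes f :: "real \<Rightarrow> 'c::real_normed_vector"
  assumes a: "\<And>N. \<exists>D. \<forall>\<^sub>F \<epsilon> in at_right 0. norm (f \<epsilon> - (\<Sum>k\<le>N. \<epsilon> ^ k *\<^sub>R a k)) \<le> D * \<epsilon> ^ Suc N"
    and b: "\<And>N. \<exists>D. \<forall>\<^sub>F \<epsilon> in at_right 0. norm (f \<epsilon> - (\<Sum>k\<le>N. \<epsilon> ^ k *\<^sub>R b k)) \<le> D * \<epsilon> ^ Suc N"
  shows "a n = b n"
proof (induction n rule: less_induct)
  case (less n)
  obtain D where D: "\<forall>\<^sub>F \<epsilon> in at_right 0. norm (f \<epsilon> - (\<Sum>k\<le>n. \<epsilon> ^ k *\<^sub>R a k)) \<le> D * \<epsilon> ^ Suc n" using a by blast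
  obtain E where E: "\<forall>\<^sub>F \<epsilon> in at_right 0. norm (f \<epsilon> - (\<Sum>k\<le>n. \<epsilon> ^ k *\<^sub>R b k)) \<le> E * \<epsilon> ^ Suc n" using b by blast
  have pos: "\<forall>\<^sub>F \<epsilon> in at_right (0::real). 0 < \<epsilon>" by (rule eventually_at_rightI[of 0 1]) auto
  from D E pos have "\<forall>\<^sub>F \<epsilon> in at_right 0. norm (a n - b n) \<le> (D + E) * \<epsilon>"
  proof eventually_elim
    case (elim \<epsilon>)
    define c where "c = (\<Sum>k<n. \<epsilon> ^ k *\<^sub>R a k)"
    have "(\<Sum>k\<le>n. \<epsilon> ^ k *\<^sub>R a k) = c + \<epsilon> ^ n *\<^sub>R a n" "(\<Sum>k\<le>n. \<epsilon> ^ k *\<^sub>R b k) = c + \<epsilon> ^ n *\<^sub>R b n"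
      using less by (simp_all add: c_def lessThan_Suc_atMost[symmetric])
    then have "\<epsilon> ^ n *\<^sub>R (a n - b n) = (f \<epsilon> - (\<Sum>k\<le>n. \<epsilon> ^ k *\<^sub>R b k)) - (f \<epsilon> - (\<Sum>k\<le>n. \<epsilon> ^ k *\<^sub>R a k))"
      by (simp add: algebra_simps)
    then have "norm (\<epsilon> ^ n *\<^sub>R (a n - b n)) = norm ((f \<epsilon> - (\<Sum>k\<le>n. \<epsilon> ^ k *\<^sub>R b k)) - (f \<epsilon> - (\<Sum>k\<le>n. \<epsilon> ^ k *\<^sub>R a k)))"
      by (rule arg_cong)
    then have "norm (\<epsilon> ^ n *\<^sub>R (a n - b n)) \<le> E * \<epsilon> ^ Suc n + D * \<epsilon> ^ Suc n"
      using elim norm_triangle_ineq4[of "f \<epsilon> - (\<Sum>k\<le>n. \<epsilon> ^ k *\<^sub>R b k)" "f \<epsilon> - (\<Sum>k\<le>n. \<epsilon> ^ k *\<^sub>R a k)"]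
      by linarith
    moreover have "norm (\<epsilon> ^ n *\<^sub>R (a n - b n)) = \<epsilon> ^ n * norm (a n - b n)" using elim by simp
    ultimately have "\<epsilon> ^ n * norm (a n - b n) \<le> \<epsilon> ^ n * ((D + E) * \<epsilon>)"
      by (simp only: distrib_left distrib_right power_Suc mult_ac add_ac)
    then show ?case using elim by simp
  qed
  moreover have "((\<lambda>\<epsilon>. (D + E) * \<epsilon>) \<longlongrightarrow> (D + E) * 0) (at_right 0)" by (intro tendsto_intros)
  ultimately have "norm (a n - b n) \<le> (D + E) * 0"
    by (intro tendsto_lowerbound[where F="at_right 0"]) auto
  then show ?case by simp
qed

context magnus_disc
begin

text \<open>Let \<open>\<psi>\<close> be the complex linear functional with real part \<open>\<phi>\<close>. The Taylor coefficients of the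
  holomorphic function \<open>\<psi> (log Y\<^sub>z)\<close> are \<open>\<psi> (\<Omega>\<^sub>n)\<close>, since both are coefficients of its asymptotic
  expansion along the positive reals. The bound is Cauchy's estimate on
  the circle of radius \<open>\<rho>\<close>, and the sum is the Taylor series at \<open>1\<close>.\<close>

lemma functional_magnus:
  assumes \<phi>: "bounded_linear \<phi>" and K: "\<And>b. \<bar>\<phi> b\<bar> \<le> K * norm b"
    and \<rho>: "1 < \<rho>" "\<rho> < r"
  shows "\<bar>\<phi> (W n)\<bar> \<le> 2 * K * (((\<Sum>n. r ^ n * norm (P n)) + 1) * C) / \<rho> ^ n"
    and "(\<lambda>n. \<phi> (W n)) sums \<phi> (logY 1)"
proof -
  define \<psi> where "\<psi> = complexify \<phi>"
  interpret \<psi>: bounded_linear \<psi> unfolding \<psi>_def by (rule bounded_linear_complexify[OF \<phi>])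
  define f where "f z = \<psi> (logY z)" for z
  define B where "B = 2 * K * (((\<Sum>n. r ^ n * norm (P n)) + 1) * C)"
  define a where "a n = (deriv ^^ n) f 0 / fact n" for n
  have K0: "0 \<le> K" using K[of 1] by simp
  have hol: "f holomorphic_on ball 0 r"
    unfolding f_def \<psi>_def by (rule logY_holomorphic[OF \<phi>])
  have fB: "cmod (f z) \<le> B" if "z \<in> ball 0 r" for z
  proof -
    have "norm (Y z - 1) \<le> (\<Sum>n. r ^ n * norm (P n)) + 1"
      using norm_Y[OF that] norm_triangle_ineq4[of "Y z" 1] by simp
    then have "norm (logY z) \<le> ((\<Sum>n. r ^ n * norm (P n)) + 1) * C"
      using norm_logY[OF that] mult_right_mono[OF _ C_nonneg] order_trans by blast
    then have "2 * K * norm (logY z) \<le> B"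
      unfolding B_def using K0 by (intro mult_left_mono) auto
    then show ?thesis
      using norm_complexify[of \<phi> K "logY z", OF K] by (simp add: f_def \<psi>_def)
  qed
  have aB: "cmod (a n) \<le> B / \<rho> ^ n" for n
  proof -
    have "norm ((deriv ^^ n) f 0) \<le> fact n * B / \<rho> ^ n"
    proof (rule Cauchy_inequality)
      show "f holomorphic_on ball 0 \<rho>" using hol \<rho> by (auto intro: holomorphic_on_subset)
      show "continuous_on (cball 0 \<rho>) f"
        using \<rho> by (intro holomorphic_on_imp_continuous_on holomorphic_on_subset[OF hol]) auto
    qed (use \<rho> fB in auto)
    then show ?thesis by (simp add: a_def norm_divide field_simps)
  qed
  have series: "(\<lambda>n. a n * z ^ n) sums f z" if "z \<in> ball 0 r" for z
    using holomorphic_power_series[OF hol that] by (simp add: a_def)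
  have "summable (\<lambda>n. B * (1 / \<rho>) ^ n)"
    using \<rho> by (intro summable_mult summable_geometric) auto
  then have "summable (\<lambda>n. norm (a n))"
    by (rule summable_comparison_test') (use aB in \<open>simp add: power_one_over\<close>)
  then have asym: "asymptotic N (\<lambda>\<epsilon>. \<Sum>n. \<epsilon> ^ n *\<^sub>R a n) a" for N
    by (rule asymptotic_power_series)
  have aW: "a n = \<psi> (W n)" for n
  proof (rule expansion_unique[where f="\<lambda>\<epsilon>. f (complex_of_real \<epsilon>)"])
    fix N
    obtain D where D: "0 \<le> D" "\<And>\<epsilon>. 0 < \<epsilon> \<Longrightarrow> \<epsilon> \<le> 1 \<Longrightarrow>
        norm ((\<Sum>n. \<epsilon> ^ n *\<^sub>R a n) - (\<Sum>k\<le>N. \<epsilon> ^ k *\<^sub>R a k)) \<le> D * \<epsilon> ^ Suc N"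
      by (rule asymptoticE[OF asym]) blast
    have "f (complex_of_real \<epsilon>) = (\<Sum>n. \<epsilon> ^ n *\<^sub>R a n)" if "0 < \<epsilon>" "\<epsilon> \<le> 1" for \<epsilon>
      using sums_unique[OF series[of "complex_of_real \<epsilon>"]] that r by (simp add: scaleR_conv_of_real mult.commute)
    with D(2) have "norm (f (complex_of_real \<epsilon>) - (\<Sum>k\<le>N. \<epsilon> ^ k *\<^sub>R a k)) \<le> D * \<epsilon> ^ Suc N" if "0 < \<epsilon>" "\<epsilon> \<le> 1" for \<epsilon>
      using that by metis
    then show "\<exists>D. \<forall>\<^sub>F \<epsilon> in at_right 0. norm (f (complex_of_real \<epsilon>) - (\<Sum>k\<le>N. \<epsilon> ^ k *\<^sub>R a k)) \<le> D * \<epsilon> ^ Suc N"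
      by (intro exI[of _ D] eventually_at_rightI[of 0 1]) auto
    obtain E where E: "\<forall>\<^sub>F \<epsilon> in at_right 0. norm (logY (complex_of_real \<epsilon>) - (\<Sum>k\<le>N. \<epsilon> ^ k *\<^sub>R W k)) \<le> E * \<epsilon> ^ Suc N"
      using logY_expansion by blast
    then have "\<forall>\<^sub>F \<epsilon> in at_right 0. norm (f (complex_of_real \<epsilon>) - (\<Sum>k\<le>N. \<epsilon> ^ k *\<^sub>R \<psi> (W k))) \<le> (2 * K * E) * \<epsilon> ^ Suc N"
    proof eventually_elim
      case (elim \<epsilon>)
      have "f (complex_of_real \<epsilon>) - (\<Sum>k\<le>N. \<epsilon> ^ k *\<^sub>R \<psi> (W k)) = \<psi> (logY (complex_of_real \<epsilon>) - (\<Sum>k\<le>N. \<epsilon> ^ k *\<^sub>R W k))"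
        by (simp add: f_def \<psi>.diff \<psi>.sum \<psi>.scaleR)
      also have "cmod \<dots> \<le> 2 * K * norm (logY (complex_of_real \<epsilon>) - (\<Sum>k\<le>N. \<epsilon> ^ k *\<^sub>R W k))"
        unfolding \<psi>_def by (rule norm_complexify[OF K])
      also have "\<dots> \<le> 2 * K * (E * \<epsilon> ^ Suc N)" using elim K0 by (intro mult_left_mono) auto
      finally show ?case by simp
    qed
    then show "\<exists>D. \<forall>\<^sub>F \<epsilon> in at_right 0. norm (f (complex_of_real \<epsilon>) - (\<Sum>k\<le>N. \<epsilon> ^ k *\<^sub>R \<psi> (W k))) \<le> D * \<epsilon> ^ Suc N" ..
  qed
  have Re: "Re (\<psi> b) = \<phi> b" for b by (simp add: \<psi>_def complexify_def)
  show "\<bar>\<phi> (W n)\<bar> \<le> 2 * K * (((\<Sum>n. r ^ n * norm (P n)) + 1) * C) / \<rho> ^ n"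
    using aB[of n] abs_Re_le_cmod[of "\<psi> (W n)"] by (simp add: aW Re B_def)
  have "(\<lambda>n. \<psi> (W n)) sums \<psi> (logY 1)"
    using series[of 1] r by (simp add: aW f_def)
  then show "(\<lambda>n. \<phi> (W n)) sums \<phi> (logY 1)"
    using sums_Re by (fastforce simp: Re)
qed

end

section \<open>Convergence for operators commuting with a complex structure\<close>

text \<open>A radius \<open>r > 1\<close> with \<open>r \<integral> \<alpha> < \<pi>\<close> puts \<open>1\<close> inside the disc of holomorphy. The functionals
  \<open>\<langle>x, \<cdot> y\<rangle>\<close> recover the operator norm, so the bounds for all of them together are a bound in norm.\<close>

theorem magnus_endo:
  fixes A :: "real \<Rightarrow> 'e::{real_inner,banach,nontrivial_vector} endo" and J :: "'e endo"
  assumes J: "complex_structure J"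
    and t: "0 \<le> t" and A: "continuous_on {0..t} A"
    and JA: "\<And>s. s \<in> {0..t} \<Longrightarrow> J * A s = A s * J"
    and \<alpha>: "continuous_on {0..t} \<alpha>" "\<And>s. s \<in> {0..t} \<Longrightarrow> norm (A s) \<le> \<alpha> s" "integral {0..t} \<alpha> < pi"
    and w_deriv: "\<And>m s. s \<in> {0..t} \<Longrightarrow>
      ((w (Suc m)) has_vector_derivative magnus_rhs (\<lambda>k. w k s) (A s) m) (at s within {0..t})"
    and w_init: "\<And>m. w (Suc m) 0 = 0"
  shows "summable (\<lambda>k. w (Suc k) t)" and "exp (\<Sum>k. w (Suc k) t) = evolution A t"
proof -
  interpret complex_structure J by fact
  define I where "I = integral {0..t} \<alpha>"
  define r where "r = 2 * pi / (pi + I)"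
  have \<alpha>0: "0 \<le> \<alpha> s" if "s \<in> {0..t}" for s using \<alpha>(2)[OF that] norm_ge_zero order_trans by blast
  have I0: "0 \<le> I"
    unfolding I_def by (rule integral_nonneg) (use \<alpha> \<alpha>0 in \<open>auto intro: integrable_continuous_real\<close>)
  have Ipi: "I < pi" using \<alpha> by (simp add: I_def)
  have pI: "0 < pi + I" using I0 pi_gt_zero by linarith
  have r: "1 < r" using Ipi pI by (simp add: r_def field_simps)
  have "r * I = pi * (2 * I / (pi + I))" by (simp add: r_def)
  also have "\<dots> < pi * 1" using Ipi pI by (intro mult_strict_left_mono) (auto simp: field_simps)
  finally have rI: "integral {0..t} (\<lambda>s. r * \<alpha> s) < pi" by (simp add: I_def)
  define C where "C = 1 / segment_gap (integral {0..t} (\<lambda>s. r * \<alpha> s))"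
  interpret magnus_disc J A t r C w
  proof
    fix z \<sigma> assume z: "cmod z < r" and \<sigma>: "\<sigma> \<in> {0..1::real}"
    show "\<exists>G. inverse_pair G (1 + \<sigma> *\<^sub>R (evolution (\<lambda>s. cx z * A s) t - 1)) \<and> norm G \<le> C"
      unfolding C_def
    proof (rule evolution_segment_invertible[OF t _ _ _ rI \<sigma>])
      show "continuous_on {0..t} (\<lambda>s. cx z * A s)" "continuous_on {0..t} (\<lambda>s. r * \<alpha> s)"
        by (intro continuous_intros A \<alpha>)+
      fix s assume s: "s \<in> {0..t}"
      have "norm (cx z * A s) \<le> cmod z * norm (A s)"
        by (intro order_trans[OF norm_mult_ineq] mult_right_mono norm_cx norm_ge_zero)
      also have "\<dots> \<le> r * \<alpha> s"
        using z r by (intro mult_mono \<alpha>(2) s) auto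
      finally show "norm (cx z * A s) \<le> r * \<alpha> s" .
    qed
  qed (use t r A JA w_deriv w_init in auto)
  define \<rho> where "\<rho> = (1 + r) / 2"
  have \<rho>: "1 < \<rho>" "\<rho> < r" using r by (auto simp: \<rho>_def)
  define M where "M = 2 * (((\<Sum>n. r ^ n * norm (P n)) + 1) * C)"
  define \<phi> where "\<phi> x y b = inner x (eapp b y)" for x y :: 'e and b
  have bl: "bounded_linear (\<phi> x y)" for x y
    unfolding \<phi>_def
    by (intro bounded_linear_compose[OF bounded_linear_inner_right]
        bounded_linear_compose[OF blinfun.bounded_linear_left bounded_linear_blinfun_of])
  have K: "\<bar>\<phi> x y b\<bar> \<le> (norm x * norm y) * norm b" for x y b
  proof -
    have "\<bar>\<phi> x y b\<bar> \<le> norm x * norm (eapp b y)" unfolding \<phi>_def by (rule Cauchy_Schwarz_ineq2)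
    also have "\<dots> \<le> norm x * (norm b * norm y)"
      using norm_blinfun[of "blinfun_of b" y] by (intro mult_left_mono) auto
    finally show ?thesis by (simp add: mult_ac)
  qed
  have "norm (W n) \<le> \<bar>M\<bar> * (1 / \<rho>) ^ n" for n
    unfolding norm_endo_def
  proof (rule norm_blinfun_bound)
    fix y
    define x where "x = eapp (W n) y"
    have "norm x * norm x = \<bar>\<phi> x y (W n)\<bar>" by (simp add: \<phi>_def x_def dot_square_norm power2_eq_square)
    also have "\<dots> \<le> norm x * norm y * (M / \<rho> ^ n)"
      using functional_magnus(1)[OF bl K \<rho>, of x y n] by (simp add: M_def mult_ac)
    also have "\<dots> \<le> norm x * norm y * (\<bar>M\<bar> / \<rho> ^ n)"
      using \<rho> by (intro mult_left_mono divide_right_mono) auto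
    finally have "norm x * norm x \<le> norm x * (\<bar>M\<bar> * (1 / \<rho>) ^ n * norm y)" by (simp add: power_one_over mult_ac)
    then have "norm x \<le> \<bar>M\<bar> * (1 / \<rho>) ^ n * norm y"
      using \<rho> by (cases "x = 0") auto
    then show "norm (eapp (W n) y) \<le> \<bar>M\<bar> * (1 / \<rho>) ^ n * norm y" by (simp add: x_def)
  qed (use \<rho> in simp)
  moreover have "summable (\<lambda>n. \<bar>M\<bar> * (1 / \<rho>) ^ n)"
    using \<rho> by (intro summable_mult summable_geometric) auto
  ultimately have sW: "summable W" by (rule summable_comparison_test'[rotated])
  have "\<phi> x y (suminf W) = \<phi> x y (logY 1)" for x y
    using bounded_linear.sums[OF bl summable_sums[OF sW], of x y] functional_magnus(2)[OF bl K \<rho>, of x y]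
    by (rule sums_unique2)
  then have "eapp (suminf W) y = eapp (logY 1) y" for y
    unfolding \<phi>_def by (metis inner_eq_zero_iff inner_diff_right right_minus_eq)
  then have "suminf W = logY 1" by (auto simp: endo_eq_iff intro: blinfun_eqI)
  moreover have "exp (logY 1) = evolution A t"
    using exp_logY[of 1] r by (simp add: Y_def)
  ultimately have expW: "exp (suminf W) = evolution A t" by simp
  have WSuc: "W (Suc k) = w (Suc k) t" for k by (simp add: W_def)
  show "summable (\<lambda>k. w (Suc k) t)"
    using sW summable_Suc_iff[of W] by (simp add: WSuc)
  show "exp (\<Sum>k. w (Suc k) t) = evolution A t"
    using expW suminf_split_head[OF sW] by (simp add: WSuc) (simp add: W_def)
qed

text \<open>Multiplication by the imaginary unit on \<open>E \<times> E\<close>, the complexification of \<open>E\<close>.\<close>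

definition rot :: "('e::nontrivial_vector \<times> 'e) endo" where
  "rot = Endo (Blinfun (\<lambda>p. (- snd p, fst p)))"

lemma eapp_rot: "eapp rot p = (- snd p, fst p)"
proof -
  have "bounded_linear (\<lambda>p::'a \<times> 'a. (- snd p, fst p))"
    by (intro bounded_linear_Pair bounded_linear_minus bounded_linear_fst bounded_linear_snd)
  then show ?thesis by (simp add: rot_def bounded_linear_Blinfun_apply)
qed

lemma complex_structure_rot:
  "complex_structure (rot :: ('e::{real_inner,banach,nontrivial_vector} \<times> 'e) endo)"
proof
  show "rot * rot = (- 1 :: ('e \<times> 'e) endo)"
    by (auto simp: endo_eq_iff eapp_rot blinfun.bilinear_simps intro!: blinfun_eqI)
  fix z :: complex
  show "norm (Re z *\<^sub>R 1 + Im z *\<^sub>R (rot :: ('e \<times> 'e) endo)) \<le> cmod z"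
    unfolding norm_endo_def
  proof (rule norm_blinfun_bound)
    fix p :: "'e \<times> 'e"
    obtain x y where p: "p = (x, y)" by fastforce
    define a b where "a = Re z" and "b = Im z"
    have e: "eapp (Re z *\<^sub>R 1 + Im z *\<^sub>R rot) p = (a *\<^sub>R x - b *\<^sub>R y, a *\<^sub>R y + b *\<^sub>R x)"
      by (simp add: p eapp_rot blinfun.bilinear_simps a_def b_def)
    have "norm (eapp (Re z *\<^sub>R 1 + Im z *\<^sub>R rot) p) ^ 2 = (a ^ 2 + b ^ 2) * (norm p) ^ 2"
      unfolding e
      unfolding p power2_norm_eq_inner
      by (simp add: inner_Pair inner_diff_left inner_diff_right inner_add_left inner_add_right
          inner_commute power2_eq_square algebra_simps)
    also have "\<dots> = (cmod z * norm p) ^ 2" by (simp add: a_def b_def cmod_power2 power_mult_distrib)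
    finally have "norm (eapp (Re z *\<^sub>R 1 + Im z *\<^sub>R rot) p) = cmod z * norm p"
      by (simp add: power2_eq_iff_nonneg)
    then show "norm (eapp (Re z *\<^sub>R 1 + Im z *\<^sub>R rot) p) \<le> cmod z * norm p" by simp
  qed simp
qed

section \<open>Transfer to an arbitrary real Hilbert space\<close>

text \<open>The summand \<open>real\<close> makes the space nonzero whatever \<open>'a\<close> is, and the square is its
  complexification.\<close>

type_synonym 'a enlarged = "('a \<times> real) \<times> ('a \<times> real)"

text \<open>An operator acts on both copies of \<open>'a\<close> and annihilates the copies of \<open>real\<close>. This embedding is
  multiplicative and does not increase the norm, but it does not preserve the unit.\<close>

definition amplify :: "('a::real_normed_vector \<Rightarrow>\<^sub>L 'a) \<Rightarrow> 'a enlarged endo" where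
  "amplify a = Endo (Blinfun (\<lambda>p. ((blinfun_apply a (fst (fst p)), 0), (blinfun_apply a (fst (snd p)), 0))))"

text \<open>The matrix entry belonging to the first copy of \<open>'a\<close>, a left inverse of \<open>amplify\<close>.\<close>

definition compress :: "'a::real_normed_vector enlarged endo \<Rightarrow> ('a \<Rightarrow>\<^sub>L 'a)" where
  "compress b = Blinfun (\<lambda>p. fst (fst p)) o\<^sub>L blinfun_of b o\<^sub>L Blinfun (\<lambda>x. ((x, 0), 0))"

lemma eapp_amplify:
  "eapp (amplify a) p = ((blinfun_apply a (fst (fst p)), 0), (blinfun_apply a (fst (snd p)), 0))"
proof -
  have "bounded_linear (\<lambda>p::'a enlarged. ((blinfun_apply a (fst (fst p)), 0::real), (blinfun_apply a (fst (snd p)), 0::real)))"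
    by (intro bounded_linear_Pair bounded_linear_zero bounded_linear_compose[OF blinfun.bounded_linear_right]
        bounded_linear_compose[OF bounded_linear_fst] bounded_linear_fst bounded_linear_snd)
  then show ?thesis by (simp add: amplify_def bounded_linear_Blinfun_apply)
qed

lemma compress_apply: "blinfun_apply (compress b) x = fst (fst (eapp b ((x, 0), 0)))"
proof -
  have "bounded_linear (\<lambda>p::'a enlarged. fst (fst p))"
    by (intro bounded_linear_compose[OF bounded_linear_fst] bounded_linear_fst)
  moreover have "bounded_linear (\<lambda>x::'a. ((x, 0), 0) :: 'a enlarged)"
    by (intro bounded_linear_Pair bounded_linear_zero bounded_linear_ident)
  ultimately show ?thesis by (simp add: compress_def bounded_linear_Blinfun_apply)
qed

lemma bounded_linear_compress: "bounded_linear compress"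
  unfolding compress_def
  by (intro bounded_linear_compose[OF bounded_bilinear.bounded_linear_left[OF bounded_bilinear_blinfun_compose]]
      bounded_linear_compose[OF bounded_bilinear.bounded_linear_right[OF bounded_bilinear_blinfun_compose]]
      bounded_linear_blinfun_of)

lemma norm_amplify: "norm (amplify a) \<le> norm (a :: 'a::real_inner \<Rightarrow>\<^sub>L 'a)"
  unfolding norm_endo_def
proof (rule norm_blinfun_bound)
  fix p :: "'a enlarged"
  obtain x u y v where p: "p = ((x, u), (y, v))" by (metis surj_pair)
  have "norm (eapp (amplify a) p) ^ 2 = norm (blinfun_apply a x) ^ 2 + norm (blinfun_apply a y) ^ 2"
    by (simp add: eapp_amplify p norm_Pair)
  also have "\<dots> \<le> (norm a * norm x) ^ 2 + (norm a * norm y) ^ 2"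
    by (intro add_mono power_mono norm_blinfun norm_ge_zero)
  also have "\<dots> \<le> (norm a * norm p) ^ 2"
    by (simp add: p norm_Pair power_mult_distrib distrib_left[symmetric] mult_left_mono)
  finally show "norm (eapp (amplify a) p) \<le> norm a * norm p"
    by (rule power2_le_imp_le) simp
qed simp

lemma bounded_linear_amplify: "bounded_linear (amplify :: ('a::real_inner \<Rightarrow>\<^sub>L 'a) \<Rightarrow> _)"
  by (rule bounded_linear_intro[of _ 1])
     (auto simp: norm_amplify endo_eq_iff eapp_amplify blinfun.bilinear_simps intro!: blinfun_eqI)

lemma amplify_mult: "amplify (a o\<^sub>L b) = amplify a * amplify b"
  by (auto simp: endo_eq_iff eapp_amplify intro!: blinfun_eqI)

lemma rot_amplify: "rot * amplify a = amplify a * rot"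
  by (auto simp: endo_eq_iff eapp_amplify eapp_rot blinfun.bilinear_simps intro!: blinfun_eqI)

lemma compress_amplify_mult: "compress (amplify a * b) = a o\<^sub>L compress b"
  by (auto simp: eapp_amplify compress_apply intro!: blinfun_eqI)

lemma compress_1: "compress 1 = id_blinfun"
  by (auto simp: compress_apply intro!: blinfun_eqI)

lemma compress_amplify: "compress (amplify a) = a"
  by (auto simp: compress_apply eapp_amplify intro!: blinfun_eqI)

lemma op_exp_eq_compress:
  fixes Z :: "'a::{real_inner,banach} \<Rightarrow>\<^sub>L 'a"
  shows "op_exp Z = compress (exp (amplify Z))"
proof -
  interpret bounded_linear "compress :: _ \<Rightarrow> ('a \<Rightarrow>\<^sub>L 'a)" by (rule bounded_linear_compress)
  have "compress (amplify Z ^ n) = ((\<lambda>W. Z o\<^sub>L W) ^^ n) id_blinfun" for n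
    by (induction n) (simp_all add: compress_1 compress_amplify_mult)
  then show ?thesis
    unfolding exp_def op_exp_def suminf[OF summable_exp_generic]
    by (simp add: scaleR divide_inverse)
qed

lemma bernoulli_0: "bernoulli 0 = 1"
  using bernoulli_convolution[of 0] by simp

lemma magnus_term_Suc:
  "magnus_term A (Suc m) t = (\<Sum>j\<le>m. (bernoulli j / fact j) *\<^sub>R
     (\<Sum>ks\<in>compositions j m. integral {0..t} (\<lambda>s. foldr (\<lambda>k Z. ad (magnus_term A k s) Z) ks (A s))))"
proof (cases m)
  case 0
  then show ?thesis
    by (subst magnus_term.simps) (simp add: compositions_0 bernoulli_0)
next
  case (Suc n)
  have "{..m} = insert 0 {1..m}" by auto
  then show ?thesis
    using Suc by (subst magnus_term.simps) (simp add: compositions_0)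
qed

lemma continuous_on_foldr_ad:
  assumes "continuous_on S A" "\<And>k. k \<in> set ks \<Longrightarrow> continuous_on S (X k)"
  shows "continuous_on S (\<lambda>s. foldr (\<lambda>k Z. ad (X k s) Z) ks (A s))"
  using assms(2)
proof (induction ks)
  case Nil
  then show ?case using assms(1) by simp
next
  case (Cons k ks)
  then show ?case
    by (auto simp: ad_def intro!: continuous_on_diff
        bounded_bilinear.continuous_on[OF bounded_bilinear_blinfun_compose])
qed

definition op_magnus_rhs :: "(nat \<Rightarrow> 'a::real_normed_vector \<Rightarrow>\<^sub>L 'a) \<Rightarrow> ('a \<Rightarrow>\<^sub>L 'a) \<Rightarrow> nat \<Rightarrow> ('a \<Rightarrow>\<^sub>L 'a)" where
  "op_magnus_rhs w a m = (\<Sum>j\<le>m. (bernoulli j / fact j) *\<^sub>R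
     (\<Sum>ks\<in>compositions j m. foldr (\<lambda>k Z. ad (w k) Z) ks a))"

text \<open>All terms that occur in the integrand have smaller index, so they are continuous by induction and the
  fundamental theorem of calculus applies.\<close>

lemma magnus_term_has_vector_derivative:
  fixes A :: "real \<Rightarrow> 'a::{real_normed_vector,banach} \<Rightarrow>\<^sub>L 'a"
  assumes A: "continuous_on {0..t} A" and s: "s \<in> {0..t}"
  shows "(magnus_term A (Suc m) has_vector_derivative op_magnus_rhs (\<lambda>k. magnus_term A k s) (A s) m) (at s within {0..t})"
  using s
proof (induction m arbitrary: s rule: less_induct)
  case (less m)
  have cont: "continuous_on {0..t} (magnus_term A k)" if "k \<le> m" for k
  proof (cases k)
    case 0
    then show ?thesis by (subst magnus_term.simps[abs_def]) simp
  next
    case (Suc l)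
    then have "l < m" using that by simp
    from has_vector_derivative_continuous[OF less.IH[OF this]] show ?thesis
      by (simp add: Suc continuous_on_eq_continuous_within)
  qed
  have "continuous_on {0..t} (\<lambda>s. foldr (\<lambda>k Z. ad (magnus_term A k s) Z) ks (A s))"
    if "ks \<in> compositions j m" for j ks
    by (rule continuous_on_foldr_ad[OF A cont]) (use that in \<open>auto simp: compositions_def dest: member_le_sum_list\<close>)
  from integral_has_vector_derivative[OF this less.prems]
  show ?case
    unfolding magnus_term_Suc[abs_def] op_magnus_rhs_def
    by (intro has_vector_derivative_sum bounded_linear.has_vector_derivative[OF bounded_linear_scaleR_right])
qed

lemma amplify_op_magnus_rhs:
  fixes a :: "'a::{real_inner,banach} \<Rightarrow>\<^sub>L 'a"
  shows "amplify (op_magnus_rhs w a m) = magnus_rhs (\<lambda>k. amplify (w k)) (amplify a) m"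
proof -
  interpret bounded_linear "amplify :: ('a \<Rightarrow>\<^sub>L 'a) \<Rightarrow> _" by (rule bounded_linear_amplify)
  have "amplify (foldr (\<lambda>k Z. ad (w k) Z) ks a) = foldr (\<lambda>k. commutator (amplify (w k))) ks (amplify a)" for ks
    by (induction ks) (simp_all add: ad_def commutator_def diff amplify_mult)
  then show ?thesis by (simp add: op_magnus_rhs_def magnus_rhs_def sum scaleR)
qed

text \<open>The amplified operators satisfy the hypotheses of \<open>magnus_endo\<close>, and compression maps its conclusion
  back.\<close>

theorem magnus_series_converges:
  fixes A Y :: "real \<Rightarrow> 'a::{real_inner,banach} \<Rightarrow>\<^sub>L 'a"
  assumes t: "0 \<le> t" and A: "continuous_on {0..t} A"
    and Y0: "Y 0 = id_blinfun"
    and Y: "\<And>s. s \<in> {0..t} \<Longrightarrow> (Y has_vector_derivative (A s o\<^sub>L Y s)) (at s within {0..t})"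
    and less_pi: "integral {0..t} (\<lambda>s. norm (A s)) < pi"
  shows "summable (\<lambda>k. magnus_term A (Suc k) t)"
    and "op_exp (\<Sum>k. magnus_term A (Suc k) t) = Y t"
proof -
  define w where "w k s = amplify (magnus_term A k s)" for k s
  define B where "B s = amplify (A s)" for s
  note amp = bounded_linear_amplify[where 'a='a]
  interpret amp: bounded_linear "amplify :: ('a \<Rightarrow>\<^sub>L 'a) \<Rightarrow> _" by (rule amp)
  have B: "continuous_on {0..t} B"
    unfolding B_def by (rule bounded_linear.continuous_on[OF amp A])
  have w_deriv: "(w (Suc m) has_vector_derivative magnus_rhs (\<lambda>k. w k s) (B s) m) (at s within {0..t})"
    if "s \<in> {0..t}" for m s
    using bounded_linear.has_vector_derivative[OF amp magnus_term_has_vector_derivative[OF A that]]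
    by (simp add: w_def[abs_def] B_def amplify_op_magnus_rhs)
  have w_init: "w (Suc m) 0 = 0" for m
    by (simp add: w_def magnus_term_Suc amp.zero)
  have "continuous_on {0..t} (\<lambda>s. norm (A s))" by (intro continuous_intros A)
  note main = magnus_endo[OF complex_structure_rot t B _ this _ less_pi w_deriv w_init]
  have s: "summable (\<lambda>k. w (Suc k) t)" and e: "exp (\<Sum>k. w (Suc k) t) = evolution B t"
    by (rule main; simp add: B_def rot_amplify norm_amplify)+
  show sum: "summable (\<lambda>k. magnus_term A (Suc k) t)"
    using bounded_linear.summable[OF bounded_linear_compress s] by (simp add: w_def compress_amplify)
  \<comment> \<open>The summand \<open>1 - amplify id_blinfun\<close> completes the non-unital image of \<open>Y\<close> by the identity on the
    copies of \<open>real\<close>, where the amplified equation is trivial.\<close>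
  have "amplify (Y t) + (1 - amplify id_blinfun) = evolution B t"
  proof (rule evolution_unique[OF B])
    fix s assume s: "s \<in> {0..t}"
    have "((\<lambda>s. amplify (Y s) + (1 - amplify id_blinfun)) has_vector_derivative amplify (A s o\<^sub>L Y s) + 0) (at s within {0..t})"
      by (intro has_vector_derivative_add has_vector_derivative_const bounded_linear.has_vector_derivative[OF amp Y] s)
    moreover have "B s * (1 - amplify id_blinfun) = 0"
      by (auto simp: B_def endo_eq_iff eapp_amplify blinfun.bilinear_simps zero_prod_def intro!: blinfun_eqI)
    ultimately show "((\<lambda>s. amplify (Y s) + (1 - amplify id_blinfun)) has_vector_derivative
        B s * (amplify (Y s) + (1 - amplify id_blinfun))) (at s within {0..t})"
      by (simp add: distrib_left amplify_mult B_def[symmetric])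
  qed (use t Y0 in auto)
  then have "compress (evolution B t) = compress (amplify (Y t)) + (compress 1 - compress (amplify id_blinfun))"
    using bounded_linear.linear[OF bounded_linear_compress[where 'a='a]]
    by (metis linear_add linear_diff)
  then have Yt: "compress (evolution B t) = Y t" by (simp add: compress_amplify compress_1)
  have "(\<Sum>k. w (Suc k) t) = amplify (\<Sum>k. magnus_term A (Suc k) t)"
    unfolding w_def by (rule amp.suminf[OF sum, symmetric])
  then show "op_exp (\<Sum>k. magnus_term A (Suc k) t) = Y t"
    using e Yt by (simp add: op_exp_eq_compress)
qed

theorem theorem3p4:
  fixes A Y :: "real \<Rightarrow> 'a::{real_inner,banach} \<Rightarrow>\<^sub>L 'a"
    and T :: real
    and scaleC :: "complex \<Rightarrow> 'a \<Rightarrow> 'a"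
    and cinner :: "'a \<Rightarrow> 'a \<Rightarrow> complex"
  assumes A_continuous: "continuous_on {0..<T} A"
    and Y_init: "Y 0 = id_blinfun"
    and Y_ode: "\<And>t. t \<in> {0..<T} \<Longrightarrow>
                  (Y has_vector_derivative (A t o\<^sub>L Y t)) (at t within {0..<T})"
    and A_integrable: "(\<lambda>s. norm (A s)) integrable_on {0..T}"
    and A_bound: "integral {0..T} (\<lambda>s. norm (A s)) < pi"
  shows
    "(dim_at_least_2 (scaleR :: real \<Rightarrow> 'a \<Rightarrow> 'a) \<and>
      (finite_dimensional (scaleR :: real \<Rightarrow> 'a \<Rightarrow> 'a)
        \<or> (\<forall>t\<in>{0..<T}. normal_op inner (Y t))
        \<or> (\<forall>t\<in>{0..<T}. unitary_op inner (Y t)))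
      \<longrightarrow> (\<forall>t\<in>{0..<T}. summable (\<lambda>k. magnus_term A (Suc k) t)
            \<and> op_exp (\<Sum>k. magnus_term A (Suc k) t) = Y t))
     \<and>
     (complex_hilbert_space scaleC cinner \<and>
      dim_at_least_2 scaleC \<and>
      (\<forall>t\<in>{0..<T}. Vector_Spaces.linear scaleC scaleC (blinfun_apply (A t))) \<and>
      (finite_dimensional scaleC
        \<or> (\<forall>t\<in>{0..<T}. normal_op cinner (Y t))
        \<or> (\<forall>t\<in>{0..<T}. unitary_op cinner (Y t)))
      \<longrightarrow> (\<forall>t\<in>{0..<T}. summable (\<lambda>k. magnus_term A (Suc k) t)
            \<and> op_exp (\<Sum>k. magnus_term A (Suc k) t) = Y t))"
proof -
  have "summable (\<lambda>k. magnus_term A (Suc k) t) \<and> op_exp (\<Sum>k. magnus_term A (Suc k) t) = Y t"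
    if t: "t \<in> {0..<T}" for t
  proof -
    have sub: "{0..t} \<subseteq> {0..<T}" using t by auto
    have cont: "continuous_on {0..t} A" by (rule continuous_on_subset[OF A_continuous sub])
    have "(\<lambda>s. norm (A s)) integrable_on {0..t}"
      by (intro integrable_continuous_real continuous_intros cont)
    then have "integral {0..t} (\<lambda>s. norm (A s)) \<le> integral {0..T} (\<lambda>s. norm (A s))"
      using t by (intro integral_subset_le A_integrable) auto
    then have less_pi: "integral {0..t} (\<lambda>s. norm (A s)) < pi" using A_bound by simp
    have ode: "(Y has_vector_derivative (A s o\<^sub>L Y s)) (at s within {0..t})" if "s \<in> {0..t}" for s
      by (rule has_vector_derivative_within_subset[OF Y_ode sub]) (use that sub in auto)
    have "0 \<le> t" using t by simp
    from magnus_series_converges[OF this cont Y_init ode less_pi] show ?thesis by blast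
  qed
  then have "\<forall>t\<in>{0..<T}. summable (\<lambda>k. magnus_term A (Suc k) t) \<and> op_exp (\<Sum>k. magnus_term A (Suc k) t) = Y t"
    by blast
  then show ?thesis by simp
qed

end
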